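(* Let $p$ be any odd prime and let $n\geq 4$ be any integer. There exists a finite $p$-group $G$ of nilpotency class two and of order $p^{n+\binom{n}{2}}$ such that $T(G)$ is a semidirect product of an elementary abelian (normal) subgroup of order \[p^{\binom{n}{2}\binom{n+1}{2}}\] by a subgroup which is isomorphic to \[ \mathbb{F}_p^{\left(\binom{n}{2}-n\right)\times n}\rtimes \left( \mathrm{GL}_n(\mathbb{F}_p)\times \mathrm{GL}_{\binom{n}{2}-n}(\mathbb{F}_p)\right),\] where the latter semidirect product is given by the action \[Q^{(A,M)} = M^{-1}QA\] for any $Q\in \mathbb{F}_p^{\left(\binom{n}{2}-n\right)\times n}$, $A\in \mathrm{GL}_n(\mathbb{F}_p)$, and $M\in \mathrm{GL}_{\binom{n}{2}-n}(\mathbb{F}_p)$.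
   Context: For a group $G$, let $S(G)$ be the group of permutations of the set $G$, with maps composed from left to right, and let $\rho:G\to S(G)$ be the right regular representation, $x^{\rho(y)}=xy$. The holomorph of $G$ is $\mathrm{Hol}(G)=N_{S(G)}(\rho(G))$, the multiple holomorph of $G$ is $\mathrm{NHol}(G)=N_{S(G)}(\mathrm{Hol}(G))$, and $T(G)=\mathrm{NHol}(G)/\mathrm{Hol}(G)$. The notation $\mathbb{F}_p^{a\times b}$ denotes the additive group of $a\times b$ matrices over $\mathbb{F}_p$. A semidirect product $N\rtimes H$ has $N$ as its normal factor, and the right action $q^h$ of $H$ on $N$ is conjugation $h^{-1}qh$. *)

theory Defs
  imports
    "HOL-Algebra.Bij"
    "HOL-Algebra.Coset"
    "HOL-Algebra.Generated_Groups"
    "HOL-Algebra.Group_Action"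
    "HOL-Computational_Algebra.Primes"
    "Jordan_Normal_Form.Matrix"
begin

section \<open>The multiple holomorph\<close>

text \<open>Permutations are composed from left to right, so \<^term>\<open>compose X g f\<close>, which applies
  \<^term>\<open>f\<close> first, is the product of \<^term>\<open>f\<close> and \<^term>\<open>g\<close> in this order. This is the
  opposite of the group \<^const>\<open>BijGroup\<close>. With this convention the right regular
  representation is a homomorphism.\<close>

definition perm_group :: "'a set \<Rightarrow> ('a \<Rightarrow> 'a) monoid" where
  "perm_group X =
    \<lparr>carrier = Bij X,
     monoid.mult = \<lambda>f\<in>Bij X. \<lambda>g\<in>Bij X. compose X g f,
     one = \<lambda>x\<in>X. x\<rparr>"

definition right_regular :: "('a, 'b) monoid_scheme \<Rightarrow> 'a \<Rightarrow> ('a \<Rightarrow> 'a)" where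
  "right_regular G y = (\<lambda>x\<in>carrier G. x \<otimes>\<^bsub>G\<^esub> y)"

definition holomorph :: "('a, 'b) monoid_scheme \<Rightarrow> ('a \<Rightarrow> 'a) set" where
  "holomorph G = normalizer (perm_group (carrier G)) (right_regular G ` carrier G)"

definition multiple_holomorph :: "('a, 'b) monoid_scheme \<Rightarrow> ('a \<Rightarrow> 'a) set" where
  "multiple_holomorph G = normalizer (perm_group (carrier G)) (holomorph G)"

definition T_group :: "('a, 'b) monoid_scheme \<Rightarrow> ('a \<Rightarrow> 'a) set monoid" where
  "T_group G =
    (perm_group (carrier G))\<lparr>carrier := multiple_holomorph G\<rparr> Mod holomorph G"

section \<open>Group-theoretic notions\<close>

definition commutator_subgroup ::
    "('a, 'b) monoid_scheme \<Rightarrow> 'a set \<Rightarrow> 'a set \<Rightarrow> 'a set" where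
  "commutator_subgroup G H K =
    generate G {inv\<^bsub>G\<^esub> h \<otimes>\<^bsub>G\<^esub> inv\<^bsub>G\<^esub> k \<otimes>\<^bsub>G\<^esub> h \<otimes>\<^bsub>G\<^esub> k | h k. h \<in> H \<and> k \<in> K}"

text \<open>The indexing starts at 0: \<^term>\<open>lower_central G i\<close> is the term usually
  written \<open>\<gamma>\<close> with index \<open>i + 1\<close>, so the nilpotency class is the least index
  at which the series becomes trivial.\<close>

primrec lower_central :: "('a, 'b) monoid_scheme \<Rightarrow> nat \<Rightarrow> 'a set" where
  "lower_central G 0 = carrier G"
| "lower_central G (Suc i) = commutator_subgroup G (lower_central G i) (carrier G)"

definition has_nilpotency_class :: "('a, 'b) monoid_scheme \<Rightarrow> nat \<Rightarrow> bool" where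
  "has_nilpotency_class G c \<longleftrightarrow>
    lower_central G c = {\<one>\<^bsub>G\<^esub>} \<and> (\<forall>i<c. lower_central G i \<noteq> {\<one>\<^bsub>G\<^esub>})"

definition elementary_abelian :: "nat \<Rightarrow> ('a, 'b) monoid_scheme \<Rightarrow> bool" where
  "elementary_abelian p G \<longleftrightarrow>
    comm_group G \<and> (\<forall>x\<in>carrier G. x [^]\<^bsub>G\<^esub> p = \<one>\<^bsub>G\<^esub>)"

definition internal_semidirect ::
    "('a, 'b) monoid_scheme \<Rightarrow> 'a set \<Rightarrow> 'a set \<Rightarrow> bool" where
  "internal_semidirect G N H \<longleftrightarrow>
    N \<lhd> G \<and> subgroup H G \<and> N \<inter> H = {\<one>\<^bsub>G\<^esub>} \<and> N <#>\<^bsub>G\<^esub> H = carrier G"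

text \<open>The external semidirect product of \<^term>\<open>N\<close> (normal) by \<^term>\<open>H\<close> with respect to a
  right action \<^term>\<open>act q h\<close>, that is \<open>q\<close> to the power \<open>h\<close>, which is to become the
  conjugate of \<open>q\<close> by \<open>h\<close> (inverse of \<open>h\<close>, then \<open>q\<close>, then \<open>h\<close>). The pair \<open>(h, q)\<close>
  stands for the product of \<open>h\<close> and \<open>q\<close> in this order; hence
  \<open>(h q) (k r) = (h k) (act q k r)\<close>.\<close>

definition semidirect ::
    "('q, 'c) monoid_scheme \<Rightarrow> ('h, 'd) monoid_scheme \<Rightarrow> ('q \<Rightarrow> 'h \<Rightarrow> 'q) \<Rightarrow> ('h \<times> 'q) monoid"
  where
  "semidirect N H act =
    \<lparr>carrier = carrier H \<times> carrier N,
     monoid.mult = \<lambda>(h, q) (k, r). (h \<otimes>\<^bsub>H\<^esub> k, act q k \<otimes>\<^bsub>N\<^esub> r),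
     one = (\<one>\<^bsub>H\<^esub>, \<one>\<^bsub>N\<^esub>)\<rparr>"

section \<open>Matrices over the prime field\<close>

text \<open>The field with \<^term>\<open>p\<close> elements is the set of integers from \<open>0\<close> to \<open>p - 1\<close> with
  arithmetic modulo \<^term>\<open>p\<close>; matrices over it are integer matrices with reduced entries.\<close>

definition red_mat :: "nat \<Rightarrow> int mat \<Rightarrow> int mat" where
  "red_mat p A = map_mat (\<lambda>x. x mod int p) A"

definition fp_mat :: "nat \<Rightarrow> nat \<Rightarrow> nat \<Rightarrow> int mat set" where
  "fp_mat p a b = {A \<in> carrier_mat a b. elements_mat A \<subseteq> {0..<int p}}"

definition fp_mat_mult :: "nat \<Rightarrow> int mat \<Rightarrow> int mat \<Rightarrow> int mat" where
  "fp_mat_mult p A B = red_mat p (A * B)"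

definition fp_mat_add_group :: "nat \<Rightarrow> nat \<Rightarrow> nat \<Rightarrow> int mat monoid" where
  "fp_mat_add_group p a b =
    \<lparr>carrier = fp_mat p a b, monoid.mult = \<lambda>A B. red_mat p (A + B), one = 0\<^sub>m a b\<rparr>"

definition GL :: "nat \<Rightarrow> nat \<Rightarrow> int mat monoid" where
  "GL p n = units_of \<lparr>carrier = fp_mat p n n, monoid.mult = fp_mat_mult p, one = 1\<^sub>m n\<rparr>"

text \<open>The group of \<open>m \<times> n\<close> matrices \<open>Q\<close> extended by the pairs \<open>(A, M)\<close>, where \<open>A\<close> has size
  \<open>n\<close> and \<open>M\<close> has size \<open>m\<close>.\<close>

definition GL_pair_action :: "nat \<Rightarrow> nat \<Rightarrow> int mat \<Rightarrow> int mat \<times> int mat \<Rightarrow> int mat" where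
  "GL_pair_action p m Q = (\<lambda>(A, M). fp_mat_mult p (fp_mat_mult p (inv\<^bsub>GL p m\<^esub> M) Q) A)"

definition matrix_semidirect ::
    "nat \<Rightarrow> nat \<Rightarrow> nat \<Rightarrow> ((int mat \<times> int mat) \<times> int mat) monoid" where
  "matrix_semidirect p n m =
    semidirect (fp_mat_add_group p m n) (GL p n \<times>\<times> GL p m) (GL_pair_action p m)"

end

theory Submission
imports Defs "HOL-Algebra.Zassenhaus" "HOL-Library.Function_Algebras" "HOL-Number_Theory.Cong"
begin

text \<open>Let \<open>N = n choose 2\<close> and let \<open>L\<close> be the abelian group \<open>(\<int>/p\<^sup>2)\<^sup>n \<times> (\<int>/p)\<^sup>N\<^sup>-\<^sup>n\<close>, with
  subgroup \<open>Z \<cong> (\<int>/p)\<^sup>N\<close> of elements killed by \<open>p\<close>. A bilinear map \<open>\<beta> : L/Z \<times> L/Z \<rightarrow> Z\<close>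
  turns \<open>L\<close> into a group \<open>G\<close> of class two with product \<open>x + y + \<beta>(x, y)\<close>,
  whose \<open>p\<close>-th power map is \<open>x \<mapsto> p x\<close> because \<open>p\<close> is odd. The commutators of the generators form a
  basis of \<open>Z\<close>, and the relations \<open>p e\<^sub>0 = [e\<^sub>1, e\<^sub>3]\<close>, \<open>p e\<^sub>1 = [e\<^sub>1, e\<^sub>2]\<close>,
  \<open>p e\<^sub>i\<^sub>+\<^sub>1 = [e\<^sub>0, e\<^sub>i]\<close> force every automorphism of \<open>G\<close> to act trivially on \<open>L/Z\<close> and on \<open>Z\<close>.
  Hence the automorphisms are the maps \<open>x \<mapsto> x + \<tau> x\<close> with \<open>\<tau> \<in> Hom(L/Z, Z)\<close>, and the holomorph of \<open>G\<close>
  is the set \<open>H\<close> of all maps \<open>x \<mapsto> x + \<tau> x + a\<close>, which no longer depends on \<open>\<beta>\<close>.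

  If \<open>\<phi>\<close> normalizes \<open>H\<close>, then \<open>\<phi>(x + y) - \<phi>(x) - \<phi>(y) + \<phi>(0)\<close> is a symmetric bilinear map
  \<open>L/Z \<times> L/Z \<rightarrow> Z\<close>. So up to translations \<open>\<phi>\<close> is an automorphism of the abelian group \<open>L\<close> plus a quadratic
  map. The quadratic parts give the elementary abelian normal subgroup of \<open>T(G)\<close>; the complement is
  \<open>Aut(L)/Hom(L/Z, Z)\<close>, which acts faithfully on \<open>Z\<close> and consists of the automorphisms of \<open>Z\<close> that preserve \<open>p L\<close>,
  that is, of invertible block triangular matrices.\<close>

section \<open>Permutation groups and normalizers\<close>

text \<open>The relations are built around p e_1 = [e_1, e_2], where e_1 occurs on both sides. It
  makes the exterior product of the images v of e_1 and w of e_2 a linear function of v alone, so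
  the Pluecker relation yields quadratic equations in v, which leave only multiples of e_1. The
  remaining rows follow by cancelling the entry of v at 1, and p e_0 = [e_1, e_3] removes the
  freedom of scaling. Multiplication by p embeds L/Z into Z, so what acts trivially on Z acts
  trivially on L/Z; this is why matrices of the action on Z suffice for the complement. The
  quadratic part splits off because 2 is invertible modulo p: subtracting half of the polarization
  on the diagonal leaves an additive map. No type can depend on p, so L is placed inside functions
  into the rationals modulo 1, and the finished group is copied to the naturals at the end. Since
  permutations compose from left to right, matrices act on row vectors, and products then match
  without reversal.\<close>

lemma carrier_perm_group [simp]: "carrier (perm_group X) = Bij X"
  by (simp add: perm_group_def)

lemma one_perm_group [simp]: "\<one>\<^bsub>perm_group X\<^esub> = (\<lambda>x\<in>X. x)"
  by (simp add: perm_group_def)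

lemma mult_perm_group [simp]:
  "f \<in> Bij X \<Longrightarrow> g \<in> Bij X \<Longrightarrow> f \<otimes>\<^bsub>perm_group X\<^esub> g = compose X g f"
  by (simp add: perm_group_def)

lemma compose_restrict_inv_into: "f \<in> Bij X \<Longrightarrow> compose X f (restrict (inv_into X f) X) = (\<lambda>x\<in>X. x)"
  by (auto simp: Bij_def compose_def bij_betw_inv_into_right fun_eq_iff)

lemma Bij_compose_Id: "f \<in> Bij X \<Longrightarrow> compose X f (\<lambda>x\<in>X. x) = f"
  by (rule extensionalityI[of _ X]) (auto simp: Bij_def compose_def)

lemma group_perm_group: "group (perm_group X)"
proof (rule groupI)
  fix f assume f: "f \<in> carrier (perm_group X)"
  then have "restrict (inv_into X f) X \<otimes>\<^bsub>perm_group X\<^esub> f = \<one>\<^bsub>perm_group X\<^esub>"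
    by (simp add: restrict_inv_into_Bij compose_restrict_inv_into)
  with f show "\<exists>g\<in>carrier (perm_group X). g \<otimes>\<^bsub>perm_group X\<^esub> f = \<one>\<^bsub>perm_group X\<^esub>"
    using restrict_inv_into_Bij by fastforce
qed (auto simp: compose_Bij id_Bij Bij_imp_funcset Bij_imp_extensional compose_assoc [symmetric]
    Bij_compose_Id)

lemma Bij_apply: "f \<in> Bij X \<Longrightarrow> x \<in> X \<Longrightarrow> f x \<in> X"
  using Bij_imp_funcset by blast

text \<open>Conjugation is injective, so on a finite set one inclusion already gives equality. Every
  later normalizer check is therefore one-sided.\<close>

lemma (in group) mem_normalizer_iff:
  assumes "S \<subseteq> carrier G" "finite S"
  shows "g \<in> normalizer G S \<longleftrightarrow> g \<in> carrier G \<and> (\<forall>h\<in>S. inv g \<otimes> h \<otimes> g \<in> S)"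
proof (cases "g \<in> carrier G")
  case g: True
  let ?c = "\<lambda>h. inv g \<otimes> h \<otimes> g"
  have eq: "g <# S #> inv g = (\<lambda>h. g \<otimes> h \<otimes> inv g) ` S"
    by (auto simp: l_coset_def r_coset_def)
  have a: "g \<otimes> (inv g \<otimes> h \<otimes> g) \<otimes> inv g = h" "inv g \<otimes> (g \<otimes> h \<otimes> inv g) \<otimes> g = h" if "h \<in> S" for h
  proof -
    have h: "h \<in> carrier G" using that assms(1) by blast
    have "g \<otimes> (inv g \<otimes> h \<otimes> g) \<otimes> inv g = (g \<otimes> inv g) \<otimes> h \<otimes> (g \<otimes> inv g)"
      using g h by (simp only: m_assoc m_closed inv_closed)
    then show "g \<otimes> (inv g \<otimes> h \<otimes> g) \<otimes> inv g = h" using g h by simp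
    have "inv g \<otimes> (g \<otimes> h \<otimes> inv g) \<otimes> g = (inv g \<otimes> g) \<otimes> h \<otimes> (inv g \<otimes> g)"
      using g h by (simp only: m_assoc m_closed inv_closed)
    then show "inv g \<otimes> (g \<otimes> h \<otimes> inv g) \<otimes> g = h" using g h by simp
  qed
  have inj: "inj_on ?c S"
    by (rule inj_on_inverseI[of _ "\<lambda>h. g \<otimes> h \<otimes> inv g"]) (rule a)
  have "(g <# S #> inv g = S) \<longleftrightarrow> (\<forall>h\<in>S. ?c h \<in> S)"
  proof
    assume "g <# S #> inv g = S"
    then have "\<forall>h\<in>S. \<exists>k\<in>S. h = g \<otimes> k \<otimes> inv g" unfolding eq by blast
    then show "\<forall>h\<in>S. ?c h \<in> S" using a(2) by force
  next
    assume c: "\<forall>h\<in>S. ?c h \<in> S"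
    then have "?c ` S = S" using inj assms(2) by (intro endo_inj_surj) auto
    then have "(\<lambda>h. g \<otimes> h \<otimes> inv g) ` S = (\<lambda>h. g \<otimes> h \<otimes> inv g) ` ?c ` S" by simp
    also have "\<dots> = S" using a by (auto simp: image_iff) 
    finally show "g <# S #> inv g = S" unfolding eq .
  qed
  then show ?thesis
    using assms(1) g by (simp add: normalizer_def stabilizer_def)
qed (simp add: normalizer_def stabilizer_def)

lemma finite_Bij: "finite X \<Longrightarrow> finite (Bij X)"
  by (rule finite_subset[of _ "X \<rightarrow>\<^sub>E X"]) (auto simp: Bij_def bij_betw_def PiE_def intro: finite_PiE[unfolded PiE_def])

text \<open>Multiplying by \<open>\<phi>\<close> on the left turns the conjugate into an
  intertwining relation, which can be checked pointwise without inverses.\<close>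

lemma mem_normalizer_perm_group_iff:
  assumes "finite X" "S \<subseteq> Bij X"
  shows "\<phi> \<in> normalizer (perm_group X) S \<longleftrightarrow>
    \<phi> \<in> Bij X \<and> (\<forall>h\<in>S. \<exists>h'\<in>S. \<forall>x\<in>X. \<phi> (h x) = h' (\<phi> x))"
proof -
  interpret P: group "perm_group X" by (rule group_perm_group)
  have fin: "finite S" using assms finite_Bij finite_subset by blast
  have "(inv\<^bsub>perm_group X\<^esub> \<phi> \<otimes>\<^bsub>perm_group X\<^esub> h \<otimes>\<^bsub>perm_group X\<^esub> \<phi> \<in> S) \<longleftrightarrow>
      (\<exists>h'\<in>S. \<forall>x\<in>X. \<phi> (h x) = h' (\<phi> x))" if \<phi>: "\<phi> \<in> Bij X" and h: "h \<in> S" for h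
  proof -
    have hB: "h \<in> Bij X" using h assms by blast
    have eq: "(inv\<^bsub>perm_group X\<^esub> \<phi> \<otimes>\<^bsub>perm_group X\<^esub> h \<otimes>\<^bsub>perm_group X\<^esub> \<phi> = h') \<longleftrightarrow>
        (\<forall>x\<in>X. \<phi> (h x) = h' (\<phi> x))" if h': "h' \<in> S" for h'
    proof -
      have hB': "h' \<in> Bij X" using h' assms by blast
      have "(inv\<^bsub>perm_group X\<^esub> \<phi> \<otimes>\<^bsub>perm_group X\<^esub> h \<otimes>\<^bsub>perm_group X\<^esub> \<phi> = h') \<longleftrightarrow>
          h \<otimes>\<^bsub>perm_group X\<^esub> \<phi> = \<phi> \<otimes>\<^bsub>perm_group X\<^esub> h'"
        using \<phi> hB hB' P.inv_solve_left'[of h' \<phi> "h \<otimes>\<^bsub>perm_group X\<^esub> \<phi>"]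
          P.m_assoc[of "inv\<^bsub>perm_group X\<^esub> \<phi>" h \<phi>] P.m_closed[of h \<phi>] P.inv_closed[of \<phi>] by simp
      also have "\<dots> \<longleftrightarrow> (\<forall>x\<in>X. \<phi> (h x) = h' (\<phi> x))"
        using \<phi> hB hB' by (auto simp: compose_def fun_eq_iff restrict_def)
      finally show ?thesis .
    qed
    then show ?thesis by blast
  qed
  then show ?thesis
    using P.mem_normalizer_iff[of S \<phi>] assms fin by auto
qed

text \<open>\<open>E\<close> and \<open>K\<close> overlap exactly in the subgroup divided out, so
  their images meet trivially. It allows all work to be done with permutations rather than
  cosets.\<close>

lemma quotient_internal_semidirect:
  assumes H: "H \<lhd> G" and E: "E \<lhd> G" and K: "subgroup K G"
    and int: "E \<inter> K = H" and gen: "E <#>\<^bsub>G\<^esub> K = carrier G"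
  shows "internal_semidirect (G Mod H) ((\<lambda>x. H #>\<^bsub>G\<^esub> x) ` E) ((\<lambda>x. H #>\<^bsub>G\<^esub> x) ` K)"
proof -
  interpret H: normal H G by fact
  interpret E: normal E G by fact
  interpret K: subgroup K G by fact
  let ?r = "\<lambda>x. H #>\<^bsub>G\<^esub> x"
  interpret Q: group "G Mod H" by (rule H.factorgroup_is_group)
  interpret r: group_hom G "G Mod H" ?r
    by unfold_locales (rule H.r_coset_hom_Mod)
  have surj: "?r ` carrier G = carrier (G Mod H)" by (simp add: carrier_FactGroup)
  have "?r ` E \<lhd> G Mod H"
    by (metis E.normal_axioms normal.surj_hom_normal_subgroup r.group_hom_axioms surj)
  moreover have "subgroup (?r ` K) (G Mod H)"
    by (rule r.subgroup_img_is_subgroup) fact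
  moreover have "?r ` E \<inter> ?r ` K = {\<one>\<^bsub>G Mod H\<^esub>}"
  proof -
    have "?r x = H" if x: "x \<in> E" "y \<in> K" "?r x = ?r y" for x y
    proof -
      \<comment> \<open>Equal cosets give \<open>x = h y\<close> with \<open>h\<close> in
        \<open>H\<close>, hence in \<open>K\<close>; so \<open>x\<close> lies in both
        \<open>E\<close> and \<open>K\<close>.\<close>
      have "x \<in> H #>\<^bsub>G\<^esub> y" using x H.rcos_self E.mem_carrier H.subgroup_axioms by metis
      then obtain h where h: "h \<in> H" "x = h \<otimes>\<^bsub>G\<^esub> y" by (auto simp: r_coset_def)
      then have "x \<in> K" using x int K.m_closed by blast
      then have "x \<in> H" using x int by blast
      then show ?thesis by (simp add: H.rcos_const)
    qed
    then have "?r ` E \<inter> ?r ` K \<subseteq> {H}" by fastforce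
    moreover have "?r \<one>\<^bsub>G\<^esub> = H" by (rule H.coset_mult_one) (rule H.subset)
    then have "H \<in> ?r ` E" "H \<in> ?r ` K" using E.one_closed K.one_closed by (metis imageI)+
    ultimately show ?thesis unfolding one_FactGroup by blast
  qed
  moreover have "?r ` E <#>\<^bsub>G Mod H\<^esub> ?r ` K = carrier (G Mod H)"
  proof -
    have "?r ` E <#>\<^bsub>G Mod H\<^esub> ?r ` K = ?r ` (E <#>\<^bsub>G\<^esub> K)"
      using E.mem_carrier K.mem_carrier by (force simp: set_mult_def H.rcos_sum image_iff)
    then show ?thesis by (simp add: gen surj)
  qed
  ultimately show ?thesis by (simp add: internal_semidirect_def)
qed

section \<open>Transport along isomorphisms\<close>

lemma group_hom_of_iso: "group G \<Longrightarrow> group G' \<Longrightarrow> h \<in> iso G G' \<Longrightarrow> group_hom G G' h"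
  by (simp add: group_hom_def group_hom_axioms_def iso_def)

lemma iso_image_normalizer:
  assumes "group G" "group G'" "h \<in> iso G G'" "S \<subseteq> carrier G"
  shows "h ` normalizer G S = normalizer G' (h ` S)"
proof -
  interpret h: group_hom G G' h using assms by (simp add: group_hom_of_iso)
  have inj: "inj_on h (carrier G)" and surj: "h ` carrier G = carrier G'"
    using assms(3) by (auto simp: iso_def bij_betw_def)
  have c: "h ` (g <#\<^bsub>G\<^esub> S #>\<^bsub>G\<^esub> inv\<^bsub>G\<^esub> g) = h g <#\<^bsub>G'\<^esub> (h ` S) #>\<^bsub>G'\<^esub> inv\<^bsub>G'\<^esub> h g" if "g \<in> carrier G" for g
  proof -
    have eq: "g <#\<^bsub>F\<^esub> R #>\<^bsub>F\<^esub> k = (\<lambda>s. g \<otimes>\<^bsub>F\<^esub> s \<otimes>\<^bsub>F\<^esub> k) ` R" for F :: "('x, 'y) monoid_scheme" and g k R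
      by (auto simp: l_coset_def r_coset_def)
    show ?thesis
      unfolding eq image_image by (rule image_cong) (use that assms(4) in \<open>auto simp: subset_iff\<close>)
  qed
  have iff: "g \<in> normalizer G S \<longleftrightarrow> h g \<in> normalizer G' (h ` S)" if g: "g \<in> carrier G" for g
  proof -
    have "g <#\<^bsub>G\<^esub> S #>\<^bsub>G\<^esub> inv\<^bsub>G\<^esub> g \<subseteq> carrier G"
      using g assms(4) h.G.l_coset_subset_G h.G.r_coset_subset_G by simp
    then have "g <#\<^bsub>G\<^esub> S #>\<^bsub>G\<^esub> inv\<^bsub>G\<^esub> g = S \<longleftrightarrow> h ` (g <#\<^bsub>G\<^esub> S #>\<^bsub>G\<^esub> inv\<^bsub>G\<^esub> g) = h ` S"
      using inj_on_image_eq_iff[OF inj _ assms(4)] by blast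
    then show ?thesis
      using g assms(4) surj unfolding c[OF g] by (auto simp: normalizer_def stabilizer_def)
  qed
  show ?thesis
  proof (intro equalityI subsetI)
    fix y assume "y \<in> h ` normalizer G S"
    then obtain g where g: "g \<in> normalizer G S" "y = h g" by blast
    then have "g \<in> carrier G" by (simp add: normalizer_def stabilizer_def)
    with g iff show "y \<in> normalizer G' (h ` S)" by blast
  next
    fix y assume y: "y \<in> normalizer G' (h ` S)"
    then have "y \<in> h ` carrier G" by (simp add: normalizer_def stabilizer_def surj)
    with y iff show "y \<in> h ` normalizer G S" by blast
  qed
qed

text \<open>Elements of the quotient are sets of group elements, so the isomorphism of quotients is
  the image map of \<open>h\<close>. The form matches \<open>T_group\<close>, a quotient of a
  structure with changed carrier.\<close>

lemma FactGroup_image_iso: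
  assumes G: "group G" "group G'" and h: "h \<in> iso G G'" and N: "N \<subseteq> carrier G" and H: "H \<subseteq> carrier G"
  shows "(`) h \<in> iso (G\<lparr>carrier := N\<rparr> Mod H) (G'\<lparr>carrier := h ` N\<rparr> Mod h ` H)"
proof -
  interpret h: group_hom G G' h using assms by (simp add: group_hom_of_iso)
  have inj: "inj_on h (carrier G)"
    using h by (auto simp: iso_def bij_betw_def)
  have coset: "h ` (H #>\<^bsub>G\<^esub> x) = h ` H #>\<^bsub>G'\<^esub> h x" if "x \<in> N" for x
    using that N H by (auto simp: r_coset_def image_iff subset_iff)
  have sub: "H #>\<^bsub>G\<^esub> x \<subseteq> carrier G" if "x \<in> N" for x
    using that N H h.G.r_coset_subset_G by blast
  have mult: "h ` (X <#>\<^bsub>G\<^esub> Y) = h ` X <#>\<^bsub>G'\<^esub> h ` Y" if "X \<subseteq> carrier G" "Y \<subseteq> carrier G" for X Y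
    using that by (force simp: set_mult_def image_iff subset_iff)
  have r: "r_coset (G\<lparr>carrier := N\<rparr>) = r_coset G" "r_coset (G'\<lparr>carrier := h ` N\<rparr>) = r_coset G'"
    "set_mult (G\<lparr>carrier := N\<rparr>) = set_mult G" "set_mult (G'\<lparr>carrier := h ` N\<rparr>) = set_mult G'"
    by (simp_all add: fun_eq_iff r_coset_def set_mult_def)
  have C: "carrier (G\<lparr>carrier := N\<rparr> Mod H) = (\<lambda>x. H #>\<^bsub>G\<^esub> x) ` N"
    "carrier (G'\<lparr>carrier := h ` N\<rparr> Mod h ` H) = (\<lambda>x. h ` H #>\<^bsub>G'\<^esub> h x) ` N"
    by (auto simp: carrier_FactGroup r)
  show ?thesis
  proof (rule isoI)
    show "(`) h \<in> hom (G\<lparr>carrier := N\<rparr> Mod H) (G'\<lparr>carrier := h ` N\<rparr> Mod h ` H)"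
    proof (rule homI)
      fix X Y
      assume "X \<in> carrier (G\<lparr>carrier := N\<rparr> Mod H)" "Y \<in> carrier (G\<lparr>carrier := N\<rparr> Mod H)"
      then have "X \<subseteq> carrier G" "Y \<subseteq> carrier G" using sub unfolding C by blast+
      then show "h ` (X \<otimes>\<^bsub>G\<lparr>carrier := N\<rparr> Mod H\<^esub> Y) = h ` X \<otimes>\<^bsub>G'\<lparr>carrier := h ` N\<rparr> Mod h ` H\<^esub> h ` Y"
        by (simp add: r mult)
    qed (use coset in \<open>auto simp: C\<close>)
    show "bij_betw ((`) h) (carrier (G\<lparr>carrier := N\<rparr> Mod H)) (carrier (G'\<lparr>carrier := h ` N\<rparr> Mod h ` H))"
      unfolding bij_betw_def C
    proof
      show "inj_on ((`) h) ((\<lambda>x. H #>\<^bsub>G\<^esub> x) ` N)"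
        by (rule inj_on_subset[OF inj_on_image_Pow[OF inj]]) (use sub in auto)
      show "(`) h ` (\<lambda>x. H #>\<^bsub>G\<^esub> x) ` N = (\<lambda>x. h ` H #>\<^bsub>G'\<^esub> h x) ` N"
        by (simp add: image_image coset)
    qed
  qed
qed

definition perm_conj :: "'a set \<Rightarrow> 'b set \<Rightarrow> ('a \<Rightarrow> 'b) \<Rightarrow> ('a \<Rightarrow> 'a) \<Rightarrow> ('b \<Rightarrow> 'b)" where
  "perm_conj X Y h \<sigma> = (\<lambda>y\<in>Y. h (\<sigma> (inv_into X h y)))"

lemma perm_conj_iso:
  assumes h: "bij_betw h X Y"
  shows "perm_conj X Y h \<in> iso (perm_group X) (perm_group Y)"
proof -
  let ?k = "inv_into X h"
  have k: "bij_betw ?k Y X" and hk: "\<And>y. y \<in> Y \<Longrightarrow> h (?k y) = y" and kh: "\<And>x. x \<in> X \<Longrightarrow> ?k (h x) = x"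
    using h by (auto simp: bij_betw_inv_into bij_betw_inv_into_right bij_betw_inv_into_left)
  have hX: "h x \<in> Y" if "x \<in> X" for x using h that bij_betwE by blast
  have kY: "?k y \<in> X" if "y \<in> Y" for y using k that bij_betwE by blast
  \<comment> \<open>Stated for arbitrary types because it is applied both to \<open>h\<close> and to
    its inverse.\<close>
  have mem: "perm_conj A B f \<sigma> \<in> Bij B" if f: "bij_betw f A B" and \<sigma>: "\<sigma> \<in> Bij A"
    for A B \<sigma> and f :: "'c \<Rightarrow> 'd"
  proof -
    have "bij_betw (f \<circ> \<sigma> \<circ> inv_into A f) B B"
      using f \<sigma> bij_betw_inv_into[OF f] unfolding Bij_def by (auto intro!: bij_betw_trans)
    then show ?thesis
      by (simp add: Bij_def perm_conj_def o_def)
  qed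
  show ?thesis
  proof (rule isoI)
    show "perm_conj X Y h \<in> hom (perm_group X) (perm_group Y)"
    proof (rule homI)
      fix \<sigma> \<tau> assume "\<sigma> \<in> carrier (perm_group X)" "\<tau> \<in> carrier (perm_group X)"
      then show "perm_conj X Y h (\<sigma> \<otimes>\<^bsub>perm_group X\<^esub> \<tau>) =
          perm_conj X Y h \<sigma> \<otimes>\<^bsub>perm_group Y\<^esub> perm_conj X Y h \<tau>"
        using hX kY kh by (simp add: mem[OF h]) (auto simp: perm_conj_def compose_def Bij_apply)
    qed (use mem[OF h] in auto)
    have "\<sigma> = perm_conj Y X ?k (perm_conj X Y h \<sigma>)" if "\<sigma> \<in> Bij X" for \<sigma>
      using that hX kY kh hk Bij_apply[OF that] inv_into_inv_into_eq[OF h]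
      by (intro extensionalityI[of _ X]) (auto simp: perm_conj_def Bij_def)
    moreover have "\<sigma> = perm_conj X Y h (perm_conj Y X ?k \<sigma>)" if "\<sigma> \<in> Bij Y" for \<sigma>
      using that hX kY kh hk Bij_apply[OF that] inv_into_inv_into_eq[OF h]
      by (intro extensionalityI[of _ Y]) (auto simp: perm_conj_def Bij_def)
    ultimately show "bij_betw (perm_conj X Y h) (carrier (perm_group X)) (carrier (perm_group Y))"
      by (intro bij_betw_byWitness[where f' = "perm_conj Y X ?k"])
        (use mem[OF h] mem[OF k] in auto)
  qed
qed

lemma right_regular_Bij:
  assumes "group G" "y \<in> carrier G" shows "right_regular G y \<in> Bij (carrier G)"
proof -
  interpret group G by fact
  have "bij_betw (\<lambda>x. x \<otimes>\<^bsub>G\<^esub> y) (carrier G) (carrier G)"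
    using assms(2) by (intro bij_betw_byWitness[where f' = "\<lambda>x. x \<otimes>\<^bsub>G\<^esub> inv\<^bsub>G\<^esub> y"]) (auto simp: m_assoc)
  then show ?thesis by (simp add: right_regular_def Bij_def)
qed

lemma image_right_regular:
  assumes "group G" "h \<in> iso G G'"
  shows "perm_conj (carrier G) (carrier G') h ` right_regular G ` carrier G = right_regular G' ` carrier G'"
proof -
  interpret group G by fact
  have h: "bij_betw h (carrier G) (carrier G')" "h \<in> hom G G'" using assms by (auto simp: iso_def)
  have "perm_conj (carrier G) (carrier G') h (right_regular G x) = right_regular G' (h x)"
    if "x \<in> carrier G" for x
    using that h bij_betwE[OF bij_betw_inv_into[OF h(1)]]
    by (auto simp: perm_conj_def right_regular_def hom_mult bij_betw_inv_into_right[OF h(1)] intro!: restrict_ext)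
  then have "perm_conj (carrier G) (carrier G') h ` right_regular G ` carrier G = right_regular G' ` h ` carrier G"
    by (simp add: image_image)
  then show ?thesis
    using h(1) by (simp add: bij_betw_def)
qed

lemma holomorph_subset: "holomorph G \<subseteq> Bij (carrier G)"
  and multiple_holomorph_subset: "multiple_holomorph G \<subseteq> Bij (carrier G)"
  by (auto simp: multiple_holomorph_def holomorph_def normalizer_def stabilizer_def)

lemma holomorph_subgroup:
  assumes "group G" shows "subgroup (holomorph G) (perm_group (carrier G))"
  unfolding holomorph_def
  by (rule group.normalizer_imp_subgroup[OF group_perm_group])
     (use assms in \<open>auto simp: right_regular_Bij\<close>)

lemma holomorph_normal:
  assumes "group G" 
  shows "holomorph G \<lhd> (perm_group (carrier G))\<lparr>carrier := multiple_holomorph G\<rparr>"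
  unfolding multiple_holomorph_def
  by (rule group.subgroup_in_normalizer[OF group_perm_group holomorph_subgroup[OF assms]])

lemma group_T_group: "group G \<Longrightarrow> group (T_group G)"
  unfolding T_group_def by (rule normal.factorgroup_is_group[OF holomorph_normal])

text \<open>Conjugation by \<open>h\<close> carries the regular representation over, and then each
  normalizer built on it.\<close>

lemma T_group_iso:
  assumes "group G" "group G'" "h \<in> iso G G'"
  shows "T_group G \<cong> T_group G'"
proof -
  let ?c = "perm_conj (carrier G) (carrier G') h"
  have c: "?c \<in> iso (perm_group (carrier G)) (perm_group (carrier G'))"
    using assms(3) by (intro perm_conj_iso) (simp add: iso_def)
  have hol: "?c ` holomorph G = holomorph G'"
    unfolding holomorph_def image_right_regular[OF assms(1,3), symmetric]
    by (rule iso_image_normalizer[OF group_perm_group group_perm_group c])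
       (use assms(1) right_regular_Bij in auto)
  have "?c ` multiple_holomorph G = multiple_holomorph G'"
    unfolding multiple_holomorph_def hol[symmetric]
    by (rule iso_image_normalizer[OF group_perm_group group_perm_group c])
       (simp add: holomorph_subset)
  moreover have "(`) ?c \<in> iso (perm_group (carrier G)\<lparr>carrier := multiple_holomorph G\<rparr> Mod holomorph G)
      (perm_group (carrier G')\<lparr>carrier := ?c ` multiple_holomorph G\<rparr> Mod ?c ` holomorph G)"
    using holomorph_subset[of G] multiple_holomorph_subset[of G]
    by (intro FactGroup_image_iso group_perm_group c) simp_all
  ultimately show ?thesis
    unfolding T_group_def hol by (auto intro: is_isoI)
qed

lemma iso_internal_semidirect:
  assumes "group T" "group T'" "f \<in> iso T T'" "internal_semidirect T E K"
  shows "internal_semidirect T' (f ` E) (f ` K)"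
proof -
  interpret f: group_hom T T' f using assms by (simp add: group_hom_of_iso)
  have inj: "inj_on f (carrier T)" and surj: "f ` carrier T = carrier T'"
    using assms(3) by (auto simp: iso_def bij_betw_def)
  have E: "E \<lhd> T" "subgroup E T" and K: "subgroup K T" and int: "E \<inter> K = {\<one>\<^bsub>T\<^esub>}" and EK: "E <#>\<^bsub>T\<^esub> K = carrier T"
    using assms(4) by (auto simp: internal_semidirect_def normal_imp_subgroup)
  have sub: "E \<subseteq> carrier T" "K \<subseteq> carrier T" using E K by (auto simp: subgroup.subset)
  have "f ` E \<inter> f ` K = {\<one>\<^bsub>T'\<^esub>}"
    using inj_on_image_Int[OF inj sub] int by simp
  moreover have "f ` E <#>\<^bsub>T'\<^esub> f ` K = f ` (E <#>\<^bsub>T\<^esub> K)"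
    using sub by (force simp: set_mult_def image_iff subset_iff)
  ultimately show ?thesis
    using E K assms EK surj unfolding internal_semidirect_def
    by (auto simp: iso_normal_subgroup f.subgroup_img_is_subgroup)
qed

lemma setcompr2_eq_image: "{f x y | x y. x \<in> A \<and> y \<in> B} = (\<lambda>(x, y). f x y) ` (A \<times> B)"
  by fast

text \<open>The inclusion is part of the induction because \<open>h\<close> respects products and
  inverses only on the carrier.\<close>

lemma iso_lower_central:
  assumes "group G" "group G'" "h \<in> iso G G'"
  shows "lower_central G i \<subseteq> carrier G \<and> lower_central G' i = h ` lower_central G i"
proof -
  interpret h: group_hom G G' h using assms by (simp add: group_hom_of_iso)
  have surj: "h ` carrier G = carrier G'"
    using assms(3) by (auto simp: iso_def bij_betw_def)
  show ?thesis
  proof (induction i)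
    case (Suc i)
    let ?S = "{inv\<^bsub>G\<^esub> x \<otimes>\<^bsub>G\<^esub> inv\<^bsub>G\<^esub> k \<otimes>\<^bsub>G\<^esub> x \<otimes>\<^bsub>G\<^esub> k | x k. x \<in> lower_central G i \<and> k \<in> carrier G}"
    have S: "?S \<subseteq> carrier G" using Suc.IH by (auto simp: subset_iff)
    let ?c = "\<lambda>(x, k). inv\<^bsub>G\<^esub> x \<otimes>\<^bsub>G\<^esub> inv\<^bsub>G\<^esub> k \<otimes>\<^bsub>G\<^esub> x \<otimes>\<^bsub>G\<^esub> k"
    let ?c' = "\<lambda>(x, k). inv\<^bsub>G'\<^esub> x \<otimes>\<^bsub>G'\<^esub> inv\<^bsub>G'\<^esub> k \<otimes>\<^bsub>G'\<^esub> x \<otimes>\<^bsub>G'\<^esub> k"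
    have "?c' ` map_prod h h ` (lower_central G i \<times> carrier G) = h ` ?c ` (lower_central G i \<times> carrier G)"
    proof -
      have "h (inv\<^bsub>G\<^esub> x \<otimes>\<^bsub>G\<^esub> inv\<^bsub>G\<^esub> k \<otimes>\<^bsub>G\<^esub> x \<otimes>\<^bsub>G\<^esub> k) = inv\<^bsub>G'\<^esub> h x \<otimes>\<^bsub>G'\<^esub> inv\<^bsub>G'\<^esub> h k \<otimes>\<^bsub>G'\<^esub> h x \<otimes>\<^bsub>G'\<^esub> h k"
        if "x \<in> lower_central G i" "k \<in> carrier G" for x k
        using that Suc.IH by (simp add: subset_iff)
      then show ?thesis unfolding image_image by (intro image_cong refl) clarsimp
    qed
    moreover have "?S = ?c ` (lower_central G i \<times> carrier G)" by (rule setcompr2_eq_image)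
    moreover have "{inv\<^bsub>G'\<^esub> x \<otimes>\<^bsub>G'\<^esub> inv\<^bsub>G'\<^esub> k \<otimes>\<^bsub>G'\<^esub> x \<otimes>\<^bsub>G'\<^esub> k | x k. x \<in> lower_central G' i \<and> k \<in> carrier G'}
        = ?c' ` map_prod h h ` (lower_central G i \<times> carrier G)"
    proof -
      have "map_prod h h ` (lower_central G i \<times> carrier G) = lower_central G' i \<times> carrier G'"
        by (rule map_prod_surj_on) (use Suc.IH surj in simp_all)
      then show ?thesis unfolding setcompr2_eq_image by simp
    qed
    ultimately have "{inv\<^bsub>G'\<^esub> x \<otimes>\<^bsub>G'\<^esub> inv\<^bsub>G'\<^esub> k \<otimes>\<^bsub>G'\<^esub> x \<otimes>\<^bsub>G'\<^esub> k | x k. x \<in> lower_central G' i \<and> k \<in> carrier G'}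
        = h ` ?S" by (simp only:)
    then have "lower_central G' (Suc i) = h ` lower_central G (Suc i)"
      using S by (simp add: commutator_subgroup_def h.generate_img)
    moreover have "lower_central G (Suc i) \<subseteq> carrier G"
      using S by (simp add: commutator_subgroup_def h.G.generate_incl)
    ultimately show ?case by blast
  qed (simp add: surj)
qed

lemma iso_has_nilpotency_class:
  assumes "group G" "group G'" "h \<in> iso G G'"
  shows "has_nilpotency_class G' c \<longleftrightarrow> has_nilpotency_class G c"
proof -
  interpret h: group_hom G G' h using assms by (simp add: group_hom_of_iso)
  have "inj_on h (carrier G)"
    using assms(3) by (auto simp: iso_def bij_betw_def)
  then have "lower_central G' i = {\<one>\<^bsub>G'\<^esub>} \<longleftrightarrow> lower_central G i = {\<one>\<^bsub>G\<^esub>}" for i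
    using iso_lower_central[OF assms, of i]
      inj_on_image_eq_iff[of h "carrier G" "lower_central G i" "{\<one>\<^bsub>G\<^esub>}"] by simp
  then show ?thesis by (simp add: has_nilpotency_class_def)
qed

lemma iso_elementary_abelian:
  assumes "group G" "group G'" "h \<in> iso G G'" "elementary_abelian p G"
  shows "elementary_abelian p G'"
proof -
  interpret h: group_hom G G' h using assms by (simp add: group_hom_of_iso)
  have surj: "h ` carrier G = carrier G'"
    using assms(3) by (auto simp: iso_def bij_betw_def)
  have "comm_group G'"
    using assms comm_group.iso_imp_comm_group is_isoI
    by (metis elementary_abelian_def group.is_monoid)
  moreover have "y [^]\<^bsub>G'\<^esub> p = \<one>\<^bsub>G'\<^esub>" if "y \<in> carrier G'" for y
    using that assms(4) surj h.hom_nat_pow h.hom_one by (metis elementary_abelian_def imageE)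
  ultimately show ?thesis by (simp add: elementary_abelian_def)
qed

text \<open>The multiplication is pulled back along an enumeration of the carrier; this yields the
  type demanded by the theorem.\<close>

lemma obtain_nat_copy:
  fixes G :: "'a monoid"
  assumes "group G" "finite (carrier G)"
  obtains G' :: "nat monoid" and h where "group G'" "h \<in> iso G G'"
proof -
  interpret group G by fact
  obtain h where h: "bij_betw h (carrier G) {0..<card (carrier G)}"
    using ex_bij_betw_finite_nat[OF assms(2)] by blast
  let ?k = "inv_into (carrier G) h"
  define G' where "G' = \<lparr>carrier = {0..<card (carrier G)}, monoid.mult = \<lambda>x y. h (?k x \<otimes>\<^bsub>G\<^esub> ?k y), one = h \<one>\<^bsub>G\<^esub>\<rparr>"
  have "h \<in> iso G G'"
    using h bij_betwE[OF h] bij_betw_inv_into_left[OF h] by (auto simp: iso_def hom_def G'_def)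
  moreover have "group G'"
    using iso_imp_img_group[OF calculation] by (simp add: G'_def)
  ultimately show ?thesis using that by blast
qed

section \<open>Integer multiples and the rationals modulo 1\<close>

text \<open>At least one of the two iterates is 0, according to the sign of \<open>k\<close>. Works
  in any abelian group type.\<close>

definition zscale :: "int \<Rightarrow> 'a::ab_group_add \<Rightarrow> 'a" (infixr "*\<^sub>Z" 75) where
  "k *\<^sub>Z x = ((+) x ^^ nat k) 0 - ((+) x ^^ nat (- k)) 0"

lemma funpow_add_commute: "((+) x ^^ m) ((y::'a::ab_group_add) + z) = y + ((+) x ^^ m) z"
  by (induction m) (simp_all add: algebra_simps)

text \<open>Any way of writing the integer as a difference gives the same multiple, which spares
  sign distinctions in the distributive law.\<close>

lemma zscale_diff_nat: "(int a - int b) *\<^sub>Z x = ((+) x ^^ a) 0 - ((+) x ^^ b) 0"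
proof (induction a arbitrary: b)
  case 0
  then show ?case by (simp add: zscale_def)
next
  case (Suc a)
  show ?case
  proof (cases b)
    case 0
    then show ?thesis by (simp add: zscale_def del: funpow.simps of_nat_Suc)
  next
    case (Suc b')
    then show ?thesis using Suc.IH[of b'] by simp
  qed
qed

lemma zscale_1 [simp]: "1 *\<^sub>Z x = x"
  by (simp add: zscale_def)

lemma zscale_left_distrib: "(j + k) *\<^sub>Z x = j *\<^sub>Z x + k *\<^sub>Z x"
proof -
  obtain a b c d where "j = int a - int b" "k = int c - int d" by (metis int_diff_cases)
  moreover have "((+) x ^^ (m + n)) 0 = ((+) x ^^ m) 0 + ((+) x ^^ n) 0" for m n
    using funpow_add_commute[of m x "((+) x ^^ n) 0" 0] by (simp add: funpow_add add.commute)
  moreover have "int a - int b + (int c - int d) = int (a + c) - int (b + d)" by simp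
  ultimately show ?thesis by (simp only: zscale_diff_nat) (simp add: algebra_simps)
qed

text \<open>Besides homomorphisms, it is applied to maps in the scalar itself, which gives
  associativity of scaling and \<open>pnt_scale\<close>.\<close>

lemma zscale_of_additive:
  fixes f :: "'a::ab_group_add \<Rightarrow> 'b::ab_group_add"
  assumes "\<And>x y. f (x + y) = f x + f y"
  shows "f (k *\<^sub>Z x) = k *\<^sub>Z f x"
proof -
  have f0: "f 0 = 0" using assms[of 0 0] by simp
  then have fd: "f (x - y) = f x - f y" for x y using assms[of "x - y" y] by (simp add: algebra_simps)
  have "f (((+) x ^^ n) 0) = ((+) (f x) ^^ n) 0" for n
    by (induction n) (simp_all add: f0 assms)
  then show ?thesis by (simp add: zscale_def fd)
qed

lemma zscale_right_distrib: "k *\<^sub>Z (x + y) = k *\<^sub>Z x + k *\<^sub>Z y"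
proof -
  have n: "((+) (x + y) ^^ n) 0 = ((+) x ^^ n) 0 + ((+) y ^^ n) 0" for n
    by (induction n) (simp_all add: algebra_simps)
  show ?thesis by (simp add: zscale_def n algebra_simps)
qed

lemma zscale_int: "k *\<^sub>Z (j::int) = k * j"
proof -
  have "((+) j ^^ n) 0 = int n * j" for n by (induction n) (simp_all add: algebra_simps)
  then show ?thesis by (cases "k \<ge> 0") (simp_all add: zscale_def)
qed

lemma zscale_scale: "j *\<^sub>Z (k *\<^sub>Z x) = (j * k) *\<^sub>Z x"
  using zscale_of_additive[of "\<lambda>i. i *\<^sub>Z x" j k, OF zscale_left_distrib] by (simp add: zscale_int)

global_interpretation zmod: Modules.module "zscale :: int \<Rightarrow> 'a::ab_group_add \<Rightarrow> 'a"
  by unfold_locales (simp_all add: zscale_right_distrib zscale_left_distrib zscale_scale)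

\<comment> \<open>A single abelian group type that contains a cyclic group of every finite order, in
  particular of order \<open>p * p\<close> for every \<open>p\<close>.\<close>
quotient_type qz = rat / "\<lambda>x y. x - y \<in> \<int>"
proof (rule equivpI)
  show "reflp (\<lambda>x y :: rat. x - y \<in> \<int>)" by (simp add: reflp_def)
  show "symp (\<lambda>x y :: rat. x - y \<in> \<int>)"
    by (rule sympI) (metis Ints_minus minus_diff_eq)
  show "transp (\<lambda>x y :: rat. x - y \<in> \<int>)"
    by (rule transpI) (metis Ints_add diff_add_cancel diff_add_eq add_diff_eq)
qed

instantiation qz :: ab_group_add
begin

lift_definition zero_qz :: qz is 0 .
lift_definition plus_qz :: "qz \<Rightarrow> qz \<Rightarrow> qz" is "(+)"
  by (metis Ints_add add_diff_add)
lift_definition uminus_qz :: "qz \<Rightarrow> qz" is uminus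
  by (metis Ints_minus minus_diff_minus)
lift_definition minus_qz :: "qz \<Rightarrow> qz \<Rightarrow> qz" is "(-)"
  by (metis Ints_diff diff_diff_eq2 diff_add_eq diff_diff_eq add.commute)

instance
  by standard (transfer; simp add: algebra_simps)+

end

text \<open>The class of \<open>a / d\<close> modulo 1 vanishes exactly when \<open>d\<close>
  divides \<open>a\<close>; this embeds the integers modulo \<open>d\<close>.\<close>

lemma ex_int_hom:
  assumes "d > 0"
  shows "\<exists>f :: int \<Rightarrow> qz. (\<forall>a b. f (a + b) = f a + f b) \<and> (\<forall>a. f a = 0 \<longleftrightarrow> d dvd a)"
proof -
  define f where "f a = abs_qz (of_int a / of_int d)" for a
  have "f (a + b) = f a + f b" for a b
    by (simp add: f_def plus_qz.abs_eq add_divide_distrib)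
  moreover have "f a = 0 \<longleftrightarrow> d dvd a" for a
  proof -
    have "f a = 0 \<longleftrightarrow> (of_int a / of_int d :: rat) \<in> \<int>"
      by (simp add: f_def zero_qz_def qz.abs_eq_iff)
    also have "\<dots> \<longleftrightarrow> d dvd a"
      using assms by (auto simp: Ints_def field_simps dvd_def simp flip: of_int_mult)
    finally show ?thesis .
  qed
  ultimately show ?thesis by blast
qed

section \<open>The abelian group underlying the construction\<close>

text \<open>The map \<open>pnt\<close> presents \<open>(\<int>/p\<^sup>2)\<^sup>N\<close> as a quotient of \<open>\<int>\<^sup>N\<close> inside an ambient abelian group type;
  \<open>lat c\<close> is the image of the vectors whose \<open>i\<close>-th entry is divisible by \<open>c\<^sub>i\<close>.\<close>

locale p_lattice =
  fixes p n N :: nat and pnt :: "(nat \<Rightarrow> int) \<Rightarrow> 'v::ab_group_add"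
  assumes prime: "prime p" and odd: "odd p" and n: "0 < n" and nN: "n \<le> N"
    and pnt_plus: "pnt (\<lambda>i. u i + v i) = pnt u + pnt v"
    and pnt_eq_0_iff: "pnt u = 0 \<longleftrightarrow> (\<forall>i<N. int p * int p dvd u i)"
begin

definition lat :: "(nat \<Rightarrow> int) \<Rightarrow> 'v set" where
  "lat c = pnt ` {u. \<forall>i<N. c i dvd u i}"

text \<open>Each factor of order \<open>p\<close> is realized as the multiples of \<open>p\<close>
  modulo \<open>p * p\<close>. Thus all coordinates have one modulus and \<open>Z\<close> has a
  uniform description.\<close>

definition L :: "'v set" where "L = lat (\<lambda>i. if i < n then 1 else int p)"
definition Z :: "'v set" where "Z = lat (\<lambda>_. int p)"

text \<open>The coordinates \<open>co x\<close> are chosen integer lifts, meaningful only modulo \<open>p\<^sup>2\<close>.\<close>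

definition co :: "'v \<Rightarrow> nat \<Rightarrow> int" where "co x = (SOME u. pnt u = x)"

definition e :: "nat \<Rightarrow> 'v" where "e i = pnt (\<lambda>j. if j = i then 1 else 0)"
text \<open>These form the basis of \<open>Z\<close>. For \<open>n \<le> i < N\<close> the point
  \<open>e i\<close> lies outside \<open>L\<close>, and \<open>eps i\<close> itself serves as a
  generator of \<open>L\<close>.\<close>

definition eps :: "nat \<Rightarrow> 'v" where "eps i = pnt (\<lambda>j. if j = i then int p else 0)"

lemma p_gt_0: "int p > 0" and p_gt_1: "int p > 1"
  using prime prime_gt_0_nat prime_gt_1_nat by auto

lemma prime_int: "prime (int p)" using prime by simp

lemma pnt_add: "pnt u + pnt v = pnt (\<lambda>i. u i + v i)"
  by (simp add: pnt_plus)
lemma pnt_diff: "pnt u - pnt v = pnt (\<lambda>i. u i - v i)"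
  using pnt_plus[of "\<lambda>i. u i - v i" v] by (simp add: algebra_simps)
lemma pnt_scale: "k *\<^sub>Z pnt u = pnt (\<lambda>i. k * u i)"
  using zscale_of_additive[of "\<lambda>j. pnt (\<lambda>i. j * u i)" k 1]
  by (simp add: pnt_plus zscale_int distrib_right)
lemma pnt_0: "pnt (\<lambda>_. 0) = 0"
  by (simp add: pnt_eq_0_iff)
lemma pnt_eq_iff: "pnt u = pnt v \<longleftrightarrow> (\<forall>i<N. [u i = v i] (mod (int p * int p)))"
proof -
  have "pnt u = pnt v \<longleftrightarrow> pnt (\<lambda>i. u i - v i) = 0" by (simp flip: pnt_diff)
  then show ?thesis by (simp add: pnt_eq_0_iff cong_iff_dvd_diff)
qed

lemma lat_0: "0 \<in> lat c"
  unfolding lat_def pnt_0[symmetric] by (rule imageI) simp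
lemma lat_add: "x \<in> lat c \<Longrightarrow> y \<in> lat c \<Longrightarrow> x + y \<in> lat c"
  by (auto simp: lat_def pnt_add)
lemma lat_diff: "x \<in> lat c \<Longrightarrow> y \<in> lat c \<Longrightarrow> x - y \<in> lat c"
  by (auto simp: lat_def pnt_diff)
lemma lat_scale: "x \<in> lat c \<Longrightarrow> k *\<^sub>Z x \<in> lat c"
  by (auto simp: lat_def pnt_scale)
lemma lat_minus: "x \<in> lat c \<Longrightarrow> - x \<in> lat c"
  using lat_diff[OF lat_0] by fastforce
lemma lat_sum: "(\<And>i. i \<in> I \<Longrightarrow> f i \<in> lat c) \<Longrightarrow> sum f I \<in> lat c"
  by (induction I rule: infinite_finite_induct) (auto simp: lat_0 lat_add)

lemmas L_closed [simp, intro] = lat_0[of "\<lambda>i. if i < n then 1 else int p", folded L_def]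
  lat_add[of _ "\<lambda>i. if i < n then 1 else int p", folded L_def]
  lat_diff[of _ "\<lambda>i. if i < n then 1 else int p", folded L_def]
  lat_scale[of _ "\<lambda>i. if i < n then 1 else int p", folded L_def]
  lat_minus[of _ "\<lambda>i. if i < n then 1 else int p", folded L_def]

lemmas Z_closed [simp, intro] = lat_0[of "\<lambda>_. int p", folded Z_def]
  lat_add[of _ "\<lambda>_. int p", folded Z_def]
  lat_diff[of _ "\<lambda>_. int p", folded Z_def]
  lat_scale[of _ "\<lambda>_. int p", folded Z_def]
  lat_minus[of _ "\<lambda>_. int p", folded Z_def]
lemmas Z_sum [intro] = lat_sum[of _ _ "\<lambda>_. int p", folded Z_def]

lemma Z_subset_L: "Z \<subseteq> L" unfolding Z_def L_def lat_def by (rule image_mono) auto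
lemma Z_L [simp, intro]: "z \<in> Z \<Longrightarrow> z \<in> L" using Z_subset_L by blast

lemma e_L [simp, intro]: "i < n \<Longrightarrow> e i \<in> L"
  unfolding e_def L_def lat_def by (rule imageI) auto
lemma eps_Z [simp, intro]: "eps i \<in> Z"
  unfolding eps_def Z_def lat_def by (rule imageI) auto
lemma p_e: "int p *\<^sub>Z e i = eps i"
  unfolding e_def eps_def pnt_scale by (rule arg_cong[of _ _ pnt]) auto

lemma p_scale_Z: "z \<in> Z \<Longrightarrow> int p *\<^sub>Z z = 0"
  unfolding Z_def lat_def by (auto simp: pnt_scale pnt_eq_iff cong_0_iff simp flip: pnt_0)
lemma p_scale_L: "x \<in> L \<Longrightarrow> int p *\<^sub>Z x \<in> Z"
  unfolding Z_def L_def lat_def by (auto simp: pnt_scale)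
text \<open>Together with \<open>p_scale_Z\<close> it makes \<open>Z\<close> the p-torsion of
  \<open>L\<close>; so maps commuting with multiplication by \<open>p\<close> respect
  \<open>Z\<close>.\<close>

lemma L_torsion: "x \<in> L \<Longrightarrow> int p *\<^sub>Z x = 0 \<Longrightarrow> x \<in> Z"
  using p_gt_0 unfolding Z_def L_def lat_def
  by (auto simp: pnt_scale pnt_eq_iff cong_0_iff simp flip: pnt_0)

text \<open>\<open>Z\<close> is a vector space over the field with \<open>p\<close> elements, so the
  ambiguity of the lifts \<open>co\<close> is harmless in coefficients of elements of
  \<open>Z\<close>.\<close>

lemma scale_cong:
  assumes "z \<in> Z" "[a = b] (mod int p)" shows "a *\<^sub>Z z = b *\<^sub>Z z"
proof -
  obtain k where "a - b = k * int p" using assms(2) by (auto simp: cong_iff_dvd_diff dvd_def mult.commute)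
  then have "(a - b) *\<^sub>Z z = 0"
    using p_scale_Z[OF assms(1)] zscale_scale[of k "int p" z] by simp
  then show ?thesis by (simp add: zmod.scale_left_diff_distrib)
qed

lemma pnt_co:
  assumes "x \<in> L" shows "pnt (co x) = x"
proof -
  obtain u where "pnt u = x" using assms unfolding L_def lat_def by blast
  then show ?thesis unfolding co_def by (rule someI[of "\<lambda>u. pnt u = x"])
qed

lemma co_pnt:
  assumes "pnt u \<in> L" "i < N" shows "[co (pnt u) i = u i] (mod (int p * int p))"
  using pnt_co[OF assms(1)] assms(2) pnt_eq_iff by blast

text \<open>The lift is determined modulo \<open>p * p\<close> only, but divisibility by a divisor
  of \<open>p * p\<close> does not depend on the choice.\<close>

lemma co_dvd_lat:
  assumes "x \<in> lat c" "x \<in> L" "i < N" "c i dvd int p * int p" shows "c i dvd co x i"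
proof -
  obtain u where u: "x = pnt u" "\<forall>i<N. c i dvd u i" using assms(1) by (auto simp: lat_def)
  have "[co x i = u i] (mod c i)"
    using co_pnt[of u i] assms u cong_dvd_modulus by blast
  then show ?thesis using u assms(3) by (simp add: cong_dvd_iff)
qed

lemma co_dvd: "x \<in> L \<Longrightarrow> n \<le> i \<Longrightarrow> i < N \<Longrightarrow> int p dvd co x i"
  using co_dvd_lat[of x "\<lambda>i. if i < n then 1 else int p" i] by (simp add: L_def)
lemma co_dvd_Z: "x \<in> Z \<Longrightarrow> i < N \<Longrightarrow> int p dvd co x i"
  using co_dvd_lat[of x "\<lambda>_. int p" i] by (simp add: Z_def[symmetric])

lemma co_add2:
  assumes "x \<in> L" "y \<in> L" "i < N" shows "[co (x + y) i = co x i + co y i] (mod (int p * int p))"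
proof -
  have "x + y = pnt (\<lambda>i. co x i + co y i)"
    using assms by (simp add: pnt_co flip: pnt_add)
  moreover have "x + y \<in> L" using assms by blast
  ultimately show ?thesis using co_pnt[of "\<lambda>i. co x i + co y i" i] assms(3) by simp
qed
lemma co_add:
  assumes "x \<in> L" "y \<in> L" "i < N" shows "[co (x + y) i = co x i + co y i] (mod int p)"
  using co_add2[OF assms] by (rule cong_dvd_modulus) simp

lemma co_pnt_p: "pnt u \<in> L \<Longrightarrow> i < N \<Longrightarrow> [co (pnt u) i = u i] (mod int p)"
  using co_pnt[of u i] by (rule cong_dvd_modulus) simp_all

lemma co_e: "i < n \<Longrightarrow> j < N \<Longrightarrow> [co (e i) j = (if j = i then 1 else 0)] (mod int p)"
  using co_pnt_p[of "\<lambda>j. if j = i then 1 else 0" j] e_L[of i] by (simp add: e_def)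

lemma co_Z_n: "z \<in> Z \<Longrightarrow> i < n \<Longrightarrow> [co z i = 0] (mod int p)"
  using co_dvd_Z[of z i] nN by (simp add: cong_0_iff)

text \<open>Normal form: entry \<open>i\<close> is \<open>c i\<close> times a digit below
  \<open>r i\<close>, the order of \<open>c i\<close> modulo \<open>p * p\<close>. It gives both the
  cardinalities and an induction principle.\<close>

lemma lat_bij:
  assumes c: "\<And>i. i < N \<Longrightarrow> c i > 0 \<and> c i * int (r i) = int p * int p"
  shows "bij_betw (\<lambda>w. pnt (\<lambda>i. c i * int (w i))) (PiE {..<N} (\<lambda>i. {..<r i})) (lat c)"
proof (rule bij_betw_imageI)
  show "inj_on (\<lambda>w. pnt (\<lambda>i. c i * int (w i))) (PiE {..<N} (\<lambda>i. {..<r i}))"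
  proof (rule inj_onI)
    fix w v assume w: "w \<in> PiE {..<N} (\<lambda>i. {..<r i})" and v: "v \<in> PiE {..<N} (\<lambda>i. {..<r i})"
      and eq: "pnt (\<lambda>i. c i * int (w i)) = pnt (\<lambda>i. c i * int (v i))"
    have "w i = v i" if i: "i < N" for i
    proof -
      have "c i * int (r i) dvd c i * (int (w i) - int (v i))"
        using eq i c[OF i] by (auto simp: pnt_eq_iff cong_iff_dvd_diff algebra_simps)
      then have "int (r i) dvd int (w i) - int (v i)" 
        by (subst (asm) dvd_times_left_cancel_iff) (use c[OF i] in simp_all)
      then have "[w i = v i] (mod r i)" by (simp flip: cong_int_iff add: cong_iff_dvd_diff)
      moreover have "w i < r i" "v i < r i" using w v i by auto
      ultimately show ?thesis by (simp add: cong_def)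
    qed
    then show "w = v" using w v by (intro PiE_ext) auto
  qed
  show "(\<lambda>w. pnt (\<lambda>i. c i * int (w i))) ` PiE {..<N} (\<lambda>i. {..<r i}) = lat c"
  proof (intro equalityI subsetI)
    fix x assume "x \<in> lat c"
    then obtain u where u: "x = pnt u" "\<forall>i<N. c i dvd u i" by (auto simp: lat_def)
    \<comment> \<open>The digits are the quotients by \<open>c i\<close>, reduced to the range below
      \<open>r i\<close>.\<close>
    define w where "w = (\<lambda>i\<in>{..<N}. nat ((u i div c i) mod int (r i)))"
    have r: "r i > 0" if "i < N" for i using c[OF that] p_gt_0 by (intro Nat.gr0I) auto
    have "w \<in> PiE {..<N} (\<lambda>i. {..<r i})"
      using r by (auto simp: w_def nat_less_iff)
    moreover have "x = pnt (\<lambda>i. c i * int (w i))"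
      unfolding u(1) pnt_eq_iff
    proof (intro allI impI)
      fix i assume i: "i < N"
      have w: "int (w i) = (u i div c i) mod int (r i)" using i r[OF i] by (simp add: w_def)
      have "c i * (u i div c i) = u i" using u i by simp
      then have "u i - c i * int (w i) = c i * ((u i div c i) - (u i div c i) mod int (r i))"
        by (simp add: w algebra_simps)
      also have "\<dots> = c i * int (r i) * ((u i div c i) div int (r i))"
        by (simp add: minus_mod_eq_mult_div)
      finally show "[u i = c i * int (w i)] (mod (int p * int p))"
        using c[OF i] by (simp add: cong_iff_dvd_diff)
    qed
    ultimately show "x \<in> (\<lambda>w. pnt (\<lambda>i. c i * int (w i))) ` PiE {..<N} (\<lambda>i. {..<r i})" by blast
  qed (auto simp: lat_def)
qed

lemma lat_card:
  assumes "\<And>i. i < N \<Longrightarrow> c i > 0 \<and> c i * int (r i) = int p * int p"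
  shows "finite (lat c)" "card (lat c) = (\<Prod>i<N. r i)"
  using bij_betw_finite[OF lat_bij[OF assms]] bij_betw_same_card[OF lat_bij[OF assms]]
  by (simp_all add: card_PiE finite_PiE)

lemma finite_L: "finite L" and card_L: "card L = p ^ (n + N)"
proof -
  note * = lat_card[of "\<lambda>i. if i < n then 1 else int p" "\<lambda>i. if i < n then p * p else p", folded L_def]
  show "finite L" using * p_gt_0 by simp
  have "card L = (\<Prod>i<N. if i < n then p * p else p)" using * p_gt_0 by simp
  \<comment> \<open>Every coordinate contributes one factor \<open>p\<close>, and the first
    \<open>n\<close> coordinates contribute a second one.\<close>
  also have "\<dots> = (\<Prod>i<N. p * (if i < n then p else 1))" by (intro prod.cong) auto
  also have "\<dots> = p ^ N * (\<Prod>i<N. if i < n then p else 1)" by (simp add: prod.distrib)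
  also have "(\<Prod>i<N. if i < n then p else 1) = (\<Prod>i\<in>{..<N} \<inter> {..<n}. p)"
    by (subst prod.inter_restrict) (auto intro: prod.cong)
  also have "{..<N} \<inter> {..<n} = {..<n}" using nN by auto
  finally show "card L = p ^ (n + N)" by (simp add: power_add)
qed

lemma card_Z: "card Z = p ^ N"
  using lat_card(2)[of "\<lambda>_. int p" "\<lambda>_. p", folded Z_def] p_gt_0 by simp

text \<open>The digits are natural numbers, so every element arises from 0 by adding generators, and
  the induction runs over the digit sum.\<close>

lemma lat_induct:
  assumes c: "\<And>i. i < N \<Longrightarrow> c i > 0 \<and> c i * int (r i) = int p * int p"
    and x: "x \<in> lat c" and 0: "P 0"
    and step: "\<And>x i. x \<in> lat c \<Longrightarrow> P x \<Longrightarrow> i < N \<Longrightarrow> P (x + pnt (\<lambda>j. if j = i then c i else 0))"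
  shows "P x"
proof -
  obtain w where w: "x = pnt (\<lambda>i. c i * int (w i))" using x lat_bij[of c r, OF c] by (auto simp: bij_betw_def)
  have "P (pnt (\<lambda>i. c i * int (w i)))" for w
  proof (induction "\<Sum>i<N. w i" arbitrary: w)
    case 0
    then have "pnt (\<lambda>i. c i * int (w i)) = pnt (\<lambda>_. 0)" unfolding pnt_eq_iff by simp
    then show ?case using 0 assms(3) by (simp add: pnt_0)
  next
    case (Suc k)
    then have "(\<Sum>i<N. w i) \<noteq> 0" by (metis nat.distinct(1))
    then have "\<exists>i<N. w i > 0" by (meson gr0I lessThan_iff sum.neutral)
    then obtain i where i: "i < N" "w i > 0" by blast
    \<comment> \<open>Lowering a positive digit removes exactly one generator.\<close>
    define v where "v = w(i := w i - 1)"
    have "(\<Sum>i<N. w i) = w i + (\<Sum>i\<in>{..<N}-{i}. w i)" "(\<Sum>i<N. v i) = v i + (\<Sum>i\<in>{..<N}-{i}. v i)"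
      using i by (intro sum.remove; simp)+
    moreover have "(\<Sum>i\<in>{..<N}-{i}. w i) = (\<Sum>i\<in>{..<N}-{i}. v i)" by (intro sum.cong) (auto simp: v_def)
    moreover have "v i = w i - 1" by (simp add: v_def)
    ultimately have "k = (\<Sum>i<N. v i)" using Suc.hyps(2) i by linarith
    then have "P (pnt (\<lambda>i. c i * int (v i)))" by (rule Suc.hyps(1))
    moreover have "pnt (\<lambda>i. c i * int (v i)) \<in> lat c" by (auto simp: lat_def)
    ultimately have "P (pnt (\<lambda>i. c i * int (v i)) + pnt (\<lambda>j. if j = i then c i else 0))"
      using step i by blast
    moreover have "pnt (\<lambda>i. c i * int (v i)) + pnt (\<lambda>j. if j = i then c i else 0) = pnt (\<lambda>i. c i * int (w i))"
      unfolding pnt_add using i by (intro arg_cong[of _ _ pnt]) (auto simp: v_def algebra_simps of_nat_diff)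
    ultimately show ?case by simp
  qed
  then show ?thesis using w by simp
qed

lemma L_induct:
  assumes "x \<in> L" "P 0" "\<And>x i. x \<in> L \<Longrightarrow> P x \<Longrightarrow> i < n \<Longrightarrow> P (x + e i)"
    "\<And>x i. x \<in> L \<Longrightarrow> P x \<Longrightarrow> i < N \<Longrightarrow> P (x + eps i)"
  shows "P x"
proof (rule lat_induct[of "\<lambda>i. if i < n then 1 else int p" "\<lambda>i. if i < n then p * p else p"])
  fix x i assume "x \<in> lat (\<lambda>i. if i < n then 1 else int p)" "P x" "i < N"
  then show "P (x + pnt (\<lambda>j. if j = i then if i < n then 1 else int p else 0))"
    using assms(3,4)[of x i] by (auto simp: L_def e_def eps_def)
qed (use assms p_gt_0 in \<open>auto simp: L_def\<close>)

lemma Z_induct: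
  assumes "z \<in> Z" "P 0" "\<And>z i. z \<in> Z \<Longrightarrow> P z \<Longrightarrow> i < N \<Longrightarrow> P (z + eps i)"
  shows "P z"
  by (rule lat_induct[of "\<lambda>_. int p" "\<lambda>_. p"])
    (use assms p_gt_0 in \<open>auto simp: Z_def eps_def\<close>)

section \<open>Linear and bilinear maps from L/Z to Z with prescribed values on the
  generators\<close>

definition linmap :: "(nat \<Rightarrow> 'v) \<Rightarrow> 'v \<Rightarrow> 'v" where
  "linmap t x = (\<Sum>i<n. co x i *\<^sub>Z t i)"

definition bilmap :: "(nat \<Rightarrow> nat \<Rightarrow> 'v) \<Rightarrow> 'v \<Rightarrow> 'v \<Rightarrow> 'v" where
  "bilmap s x y = linmap (\<lambda>i. linmap (s i) y) x"

context
  fixes t assumes t: "\<And>i. i < n \<Longrightarrow> t i \<in> Z"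
begin

lemma linmap_Z: "linmap t x \<in> Z"
  unfolding linmap_def by (rule Z_sum) (use t in auto)

lemma linmap_add: "x \<in> L \<Longrightarrow> y \<in> L \<Longrightarrow> linmap t (x + y) = linmap t x + linmap t y"
  unfolding linmap_def sum.distrib[symmetric] zscale_left_distrib[symmetric]
  using nN by (intro sum.cong refl scale_cong co_add t) auto

lemma linmap_e:
  assumes "a < n" shows "linmap t (e a) = t a"
proof -
  have "linmap t (e a) = (\<Sum>i<n. (if i = a then 1 else 0) *\<^sub>Z t i)"
    unfolding linmap_def using nN assms by (intro sum.cong refl scale_cong co_e t) auto
  also have "\<dots> = (\<Sum>i<n. if i = a then t i else 0)" by (intro sum.cong) auto
  finally show ?thesis using assms by simp
qed

lemma linmap_eq_0: assumes "z \<in> Z" shows "linmap t z = 0"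
  unfolding linmap_def
proof (intro sum.neutral ballI)
  fix i assume "i \<in> {..<n}"
  then show "co z i *\<^sub>Z t i = 0"
    using scale_cong[OF t co_Z_n[OF assms]] by simp
qed

end

context
  fixes s assumes s: "\<And>i j. i < n \<Longrightarrow> j < n \<Longrightarrow> s i j \<in> Z"
begin

lemma bilmap_Z: "bilmap s x y \<in> Z"
  unfolding bilmap_def by (intro linmap_Z s)

lemma bilmap_add_left: "x \<in> L \<Longrightarrow> x' \<in> L \<Longrightarrow> bilmap s (x + x') y = bilmap s x y + bilmap s x' y"
  unfolding bilmap_def by (intro linmap_add linmap_Z s)

lemma bilmap_add_right:
  assumes "y \<in> L" "y' \<in> L" shows "bilmap s x (y + y') = bilmap s x y + bilmap s x y'"
proof -
  have "bilmap s x (y + y') = linmap (\<lambda>i. linmap (s i) y + linmap (s i) y') x"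
    unfolding bilmap_def linmap_def[of _ x] using assms by (intro sum.cong refl) (simp add: linmap_add s)
  then show ?thesis by (simp add: bilmap_def linmap_def zscale_right_distrib sum.distrib)
qed

lemma bilmap_e: "a < n \<Longrightarrow> b < n \<Longrightarrow> bilmap s (e a) (e b) = s a b"
  unfolding bilmap_def by (simp add: linmap_e linmap_Z s)

lemma bilmap_eq_0_left: "x \<in> Z \<Longrightarrow> bilmap s x y = 0"
  unfolding bilmap_def by (intro linmap_eq_0 linmap_Z s)

lemma bilmap_eq_0_right: "y \<in> Z \<Longrightarrow> bilmap s x y = 0"
  unfolding bilmap_def linmap_def[of _ x] by (intro sum.neutral ballI) (simp add: linmap_eq_0 s)

lemma bilmap_minus_left: "x \<in> L \<Longrightarrow> bilmap s (- x) y = - bilmap s x y"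
  using bilmap_add_left[of x "- x" y] bilmap_eq_0_left[of 0 y] by (simp add: eq_neg_iff_add_eq_0 add.commute)

end

end

section \<open>Permutations normalizing the candidate holomorph\<close>

context p_lattice
begin

text \<open>This is Hom(L/Z, Z), encoded by functions on the ambient type that are constrained on
  \<open>L\<close> only; vanishing on \<open>Z\<close> replaces the quotient.\<close>

definition homs :: "('v \<Rightarrow> 'v) set" where
  "homs = {\<tau>. (\<forall>x\<in>L. \<tau> x \<in> Z) \<and> (\<forall>x\<in>L. \<forall>y\<in>L. \<tau> (x + y) = \<tau> x + \<tau> y) \<and> (\<forall>z\<in>Z. \<tau> z = 0)}"

definition H :: "('v \<Rightarrow> 'v) set" where
  "H = {\<lambda>x\<in>L. x + \<tau> x + a | \<tau> a. \<tau> \<in> homs \<and> a \<in> L}"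

lemma homs_Z: "\<tau> \<in> homs \<Longrightarrow> x \<in> L \<Longrightarrow> \<tau> x \<in> Z"
  and homs_add: "\<tau> \<in> homs \<Longrightarrow> x \<in> L \<Longrightarrow> y \<in> L \<Longrightarrow> \<tau> (x + y) = \<tau> x + \<tau> y"
  and homs_0: "\<tau> \<in> homs \<Longrightarrow> z \<in> Z \<Longrightarrow> \<tau> z = 0"
  by (auto simp: homs_def)

lemma homs_L: "\<tau> \<in> homs \<Longrightarrow> x \<in> L \<Longrightarrow> \<tau> x \<in> L"
  by (rule Z_L[OF homs_Z])

lemma H_I: "\<tau> \<in> homs \<Longrightarrow> a \<in> L \<Longrightarrow> (\<lambda>x\<in>L. x + \<tau> x + a) \<in> H"
  by (auto simp: H_def)

lemma homs_diff: "\<tau> \<in> homs \<Longrightarrow> x \<in> L \<Longrightarrow> y \<in> L \<Longrightarrow> \<tau> (x - y) = \<tau> x - \<tau> y"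
  using homs_add[of \<tau> "x - y" y] by (simp add: L_closed algebra_simps)

lemma linmap_homs: "(\<And>i. i < n \<Longrightarrow> t i \<in> Z) \<Longrightarrow> linmap t \<in> homs"
  by (auto simp: homs_def linmap_Z linmap_add linmap_eq_0)

lemma zero_homs: "(\<lambda>_. 0) \<in> homs"
  by (auto simp: homs_def)

lemma translation_H: "a \<in> L \<Longrightarrow> (\<lambda>x\<in>L. x + a) \<in> H"
  using H_I[OF zero_homs] by simp

lemma bij_betw_L:
  assumes "\<And>x. x \<in> L \<Longrightarrow> f x \<in> L" "inj_on f L" shows "bij_betw f L L"
  using assms finite_L endo_inj_surj[of L f] by (auto simp: bij_betw_def)

lemma H_Bij: "H \<subseteq> Bij L"
proof
  fix h assume "h \<in> H"
  then obtain \<tau> a where \<tau>: "\<tau> \<in> homs" and a: "a \<in> L" and h: "h = (\<lambda>x\<in>L. x + \<tau> x + a)"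
    by (auto simp: H_def)
  have "bij_betw (\<lambda>x. x + \<tau> x + a) L L"
  proof (rule bij_betw_L)
    show "inj_on (\<lambda>x. x + \<tau> x + a) L"
    proof (rule inj_onI)
      fix x y assume x: "x \<in> L" and y: "y \<in> L" and eq: "x + \<tau> x + a = y + \<tau> y + a"
      then have "x - y = \<tau> y - \<tau> x" by (simp add: algebra_simps)
      \<comment> \<open>Points with equal image differ by an element of \<open>Z\<close>, and
        \<open>\<tau>\<close> kills it.\<close>
      then have "x - y \<in> Z" using homs_Z[OF \<tau>] x y by auto
      then have "\<tau> x = \<tau> y" using homs_0[OF \<tau>, of "x - y"] homs_diff[OF \<tau> x y] by simp
      then show "x = y" using eq by simp
    qed
 qed (use \<tau> a homs_L[OF \<tau>] in auto)
  then show "h \<in> Bij L" unfolding h Bij_def by simp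
qed

section \<open>Polarization of permutations that normalize H\<close>

definition NH :: "('v \<Rightarrow> 'v) set" where "NH = normalizer (perm_group L) H"

lemma NH_iff: "\<phi> \<in> NH \<longleftrightarrow> \<phi> \<in> Bij L \<and> (\<forall>h\<in>H. \<exists>h'\<in>H. \<forall>x\<in>L. \<phi> (h x) = h' (\<phi> x))"
  unfolding NH_def by (rule mem_normalizer_perm_group_iff[OF finite_L H_Bij])

lemma NH_Bij: "\<phi> \<in> NH \<Longrightarrow> \<phi> \<in> Bij L"
  by (simp add: NH_iff)

lemma NH_L: "\<phi> \<in> NH \<Longrightarrow> x \<in> L \<Longrightarrow> \<phi> x \<in> L"
  by (rule Bij_apply[OF NH_Bij])

lemma NH_inj: "\<phi> \<in> NH \<Longrightarrow> \<phi> x = \<phi> y \<Longrightarrow> x \<in> L \<Longrightarrow> y \<in> L \<Longrightarrow> x = y"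
  using NH_Bij by (auto simp: Bij_def bij_betw_def inj_on_def)

text \<open>Normalizes the value at 0 to 0; translations belong to \<open>H\<close>, so nothing is
  lost modulo \<open>H\<close>.\<close>

definition ctr :: "('v \<Rightarrow> 'v) \<Rightarrow> 'v \<Rightarrow> 'v" where "ctr \<phi> x = \<phi> x - \<phi> 0"
definition polar :: "('v \<Rightarrow> 'v) \<Rightarrow> 'v \<Rightarrow> 'v \<Rightarrow> 'v" where "polar \<phi> x y = \<phi> (x + y) - \<phi> x - \<phi> y + \<phi> 0"

lemma ctr_0 [simp]: "ctr \<phi> 0 = 0" by (simp add: ctr_def)
lemma ctr_L [intro]: "\<phi> \<in> NH \<Longrightarrow> x \<in> L \<Longrightarrow> ctr \<phi> x \<in> L"
  using NH_L[of \<phi> x] NH_L[of \<phi> 0] by (auto simp: ctr_def)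
lemma ctr_add: "ctr \<phi> (x + y) = ctr \<phi> x + ctr \<phi> y + polar \<phi> x y"
  by (simp add: ctr_def polar_def algebra_simps)
lemma polar_commute: "polar \<phi> x y = polar \<phi> y x"
  by (simp add: polar_def algebra_simps)

text \<open>Conjugating the translation by \<open>a\<close> yields \<open>\<phi>(x + a) = \<phi>(x) + \<tau>(\<phi>(x)) + c\<close>, which makes the
  polarization of \<open>\<phi>\<close> linear in \<open>\<phi>(x) - \<phi>(0)\<close>.\<close>

lemma NH_translation:
  assumes "\<phi> \<in> NH" "a \<in> L"
  shows "\<exists>\<tau>\<in>homs. \<forall>x\<in>L. polar \<phi> x a = \<tau> (ctr \<phi> x)"
proof -
  obtain h' where "h' \<in> H" and h': "\<forall>x\<in>L. \<phi> ((\<lambda>x\<in>L. x + a) x) = h' (\<phi> x)"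
    using assms translation_H unfolding NH_iff by blast
  then obtain \<tau> c where \<tau>: "\<tau> \<in> homs" and c: "c \<in> L" and "h' = (\<lambda>x\<in>L. x + \<tau> x + c)"
    by (auto simp: H_def)
  then have *: "\<phi> (x + a) = \<phi> x + \<tau> (\<phi> x) + c" if "x \<in> L" for x
    using h' that NH_L[OF assms(1)] by auto
  have "polar \<phi> x a = \<tau> (ctr \<phi> x)" if x: "x \<in> L" for x
    using *[OF x] *[of 0] x NH_L[OF assms(1)] by (simp add: polar_def ctr_def homs_diff[OF \<tau>] L_closed)
  with \<tau> show ?thesis by blast
qed

lemma polar_Z [intro]: "\<phi> \<in> NH \<Longrightarrow> x \<in> L \<Longrightarrow> y \<in> L \<Longrightarrow> polar \<phi> x y \<in> Z"
  by (metis NH_translation homs_Z ctr_L)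

text \<open>The commutators of elements of \<open>H\<close> are exactly the translations by elements of \<open>Z\<close>.\<close>

lemma ctr_Z [intro]:
  assumes \<phi>: "\<phi> \<in> NH" and z: "z \<in> Z" shows "ctr \<phi> z \<in> Z"
proof -
  \<comment> \<open>Chosen with \<open>\<tau> (e 0) = z\<close>, so that its shear and the
    translation by \<open>e 0\<close> commute up to the translation by \<open>z\<close>.\<close>
  define \<tau> where "\<tau> = linmap (\<lambda>i. if i = 0 then z else 0)"
  have \<tau>: "\<tau> \<in> homs" "\<tau> (e 0) = z"
    unfolding \<tau>_def using z n by (auto intro!: linmap_homs simp: linmap_e)
  define s t where "s = (\<lambda>x\<in>L. x + \<tau> x + 0)" and "t = (\<lambda>x\<in>L. x + e 0)"
  have "s \<in> H" "t \<in> H"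
    unfolding s_def t_def by (rule H_I[OF \<tau>(1) L_closed(1)], rule translation_H, rule e_L[OF n])
  obtain s' where H's: "s' \<in> H" and s': "\<forall>x\<in>L. \<phi> (s x) = s' (\<phi> x)"
    using \<phi> \<open>s \<in> H\<close> unfolding NH_iff by blast
  obtain t' where H't: "t' \<in> H" and t': "\<forall>x\<in>L. \<phi> (t x) = t' (\<phi> x)"
    using \<phi> \<open>t \<in> H\<close> unfolding NH_iff by blast
  obtain \<tau>s c where \<tau>s: "\<tau>s \<in> homs" "c \<in> L" "s' = (\<lambda>x\<in>L. x + \<tau>s x + c)"
    using H's by (auto simp: H_def)
  obtain \<tau>t d where \<tau>t: "\<tau>t \<in> homs" "d \<in> L" "t' = (\<lambda>x\<in>L. x + \<tau>t x + d)"
    using H't by (auto simp: H_def)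
  have st: "s (t x) = t (s x) + z" if "x \<in> L" for x
    using that \<tau> n by (simp add: s_def t_def L_closed homs_L homs_add algebra_simps)
  have L: "s 0 \<in> L" "t 0 \<in> L" "t (s 0) \<in> L"
    using \<tau> n by (auto simp: s_def t_def homs_0)
  define y where "y = \<phi> 0"
  have y: "y \<in> L" unfolding y_def using NH_L[OF \<phi>] by blast
  have "\<phi> (s (t 0)) = s' (t' y)" using s' t' L by (simp add: y_def)
  then have "\<phi> (t (s 0) + z) = s' (t' y)" by (simp add: st)
  \<comment> \<open>The conjugates lie in \<open>H\<close> again, so they also commute up to an
    element of \<open>Z\<close>.\<close>
  also have "\<dots> = t' (s' y) + (\<tau>s d - \<tau>t c)"
    using y \<tau>s \<tau>t by (simp add: homs_add homs_L homs_0 homs_Z L_closed algebra_simps)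
  also have "t' (s' y) = \<phi> (t (s 0))"
    using s' t' L by (simp add: y_def)
  finally have *: "\<phi> (t (s 0) + z) - \<phi> (t (s 0)) \<in> Z"
    using homs_Z[OF \<tau>s(1) \<tau>t(2)] homs_Z[OF \<tau>t(1) \<tau>s(2)] by simp
  \<comment> \<open>Moving the base point to 0 costs a value of \<open>polar\<close>, which is
    already known to lie in \<open>Z\<close>.\<close>
  have "\<phi> (t (s 0) + z) - \<phi> (t (s 0)) = ctr \<phi> z + polar \<phi> (t (s 0)) z"
    by (simp add: ctr_def polar_def)
  then have "ctr \<phi> z = (\<phi> (t (s 0) + z) - \<phi> (t (s 0))) - polar \<phi> (t (s 0)) z" by simp
  then show ?thesis using Z_closed(3)[OF * polar_Z[OF \<phi> L(3), of z]] z by simp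
qed

text \<open>\<open>polar \<phi> z y\<close> is \<open>\<tau> (ctr \<phi> z)\<close>, and
  \<open>ctr_Z\<close> keeps the argument in \<open>Z\<close>, where \<open>\<tau>\<close>
  vanishes.\<close>

lemma polar_eq_0_left: "\<phi> \<in> NH \<Longrightarrow> z \<in> Z \<Longrightarrow> y \<in> L \<Longrightarrow> polar \<phi> z y = 0"
  using NH_translation[of \<phi> y] homs_0 ctr_Z[of \<phi> z] by fastforce
lemma polar_eq_0_right: "\<phi> \<in> NH \<Longrightarrow> z \<in> Z \<Longrightarrow> y \<in> L \<Longrightarrow> polar \<phi> y z = 0"
  by (simp only: polar_commute[of \<phi> y z] polar_eq_0_left)

text \<open>\<open>ctr \<phi>\<close> is not additive, but its defect is a value of
  \<open>polar\<close>, hence in \<open>Z\<close> and invisible to \<open>\<tau>\<close>.\<close>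

lemma polar_add_left:
  assumes \<phi>: "\<phi> \<in> NH" and x: "x \<in> L" "x' \<in> L" and y: "y \<in> L"
  shows "polar \<phi> (x + x') y = polar \<phi> x y + polar \<phi> x' y"
proof -
  obtain \<tau> where \<tau>: "\<tau> \<in> homs" "\<And>x. x \<in> L \<Longrightarrow> polar \<phi> x y = \<tau> (ctr \<phi> x)"
    using NH_translation[OF \<phi> y] by blast
  have "polar \<phi> (x + x') y = \<tau> (ctr \<phi> x + ctr \<phi> x' + polar \<phi> x x')"
    using x \<tau> by (simp add: ctr_add L_closed)
  also have "\<dots> = \<tau> (ctr \<phi> x) + \<tau> (ctr \<phi> x') + \<tau> (polar \<phi> x x')"
    using \<phi> x by (subst homs_add[OF \<tau>(1)], auto)+
  also have "\<tau> (polar \<phi> x x') = 0" using homs_0[OF \<tau>(1)] polar_Z[OF \<phi> x] by blast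
  finally show ?thesis using \<tau> x by simp
qed

lemma polar_add_right:
  "\<phi> \<in> NH \<Longrightarrow> x \<in> L \<Longrightarrow> x' \<in> L \<Longrightarrow> y \<in> L \<Longrightarrow> polar \<phi> y (x + x') = polar \<phi> y x + polar \<phi> y x'"
  by (simp only: polar_commute[of \<phi> y] polar_add_left)

lemma ctr_add_Z: "\<phi> \<in> NH \<Longrightarrow> x \<in> L \<Longrightarrow> z \<in> Z \<Longrightarrow> ctr \<phi> (x + z) = ctr \<phi> x + ctr \<phi> z"
  by (simp add: ctr_add polar_eq_0_right)

text \<open>The usual expansion of a quadratic map along multiples of one vector.\<close>

lemma ctr_scale_nat:
  assumes \<phi>: "\<phi> \<in> NH" and x: "x \<in> L"
  shows "ctr \<phi> (int k *\<^sub>Z x) = int k *\<^sub>Z ctr \<phi> x + int (k choose 2) *\<^sub>Z polar \<phi> x x"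
proof (induction k)
  case (Suc k)
  have D: "polar \<phi> (int k *\<^sub>Z x) x = int k *\<^sub>Z polar \<phi> x x"
  proof (induction k)
    case 0
    show ?case using polar_eq_0_left[OF \<phi>, of 0] x by simp
  next
    case (Suc k)
    then show ?case using polar_add_left[OF \<phi> x _ x, of "int k *\<^sub>Z x"] x
      by (simp add: zscale_left_distrib)
  qed
  have "Suc k choose 2 = k + (k choose 2)" by (simp add: numeral_2_eq_2)
  then have C: "int (Suc k choose 2) *\<^sub>Z polar \<phi> x x = int k *\<^sub>Z polar \<phi> x x + int (k choose 2) *\<^sub>Z polar \<phi> x x"
    by (simp add: zscale_left_distrib)
  have S: "int (Suc k) *\<^sub>Z v = int k *\<^sub>Z v + v" for v :: 'v
    by (simp add: zscale_left_distrib)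
  show ?case
    unfolding S C ctr_add Suc.IH D by (simp add: algebra_simps)
next
  case 0
  then show ?case by (simp add: numeral_2_eq_2)
qed

lemma p_dvd_choose: "p dvd (p choose 2)"
proof -
  have "p \<noteq> 2" using odd by auto
  then have "2 < p" using prime prime_ge_2_nat[of p] by simp
  then show ?thesis using prime by (intro dvd_choose_prime) auto
qed

text \<open>For odd \<open>p\<close> the binomial coefficient is divisible by \<open>p\<close>, and
  \<open>p\<close> kills the values of \<open>polar\<close>.\<close>

lemma ctr_p:
  assumes \<phi>: "\<phi> \<in> NH" and x: "x \<in> L" shows "ctr \<phi> (int p *\<^sub>Z x) = int p *\<^sub>Z ctr \<phi> x"
proof -
  have "int (p choose 2) *\<^sub>Z polar \<phi> x x = 0 *\<^sub>Z polar \<phi> x x"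
    using p_dvd_choose polar_Z[OF \<phi> x x] by (intro scale_cong) (simp_all add: cong_0_iff)
  then show ?thesis using ctr_scale_nat[OF \<phi> x, of p] by simp
qed

lemma H_NH: "H \<subseteq> NH"
proof
  fix h assume h: "h \<in> H"
  then obtain \<tau> a where \<tau>: "\<tau> \<in> homs" and a: "a \<in> L" and h_eq: "h = (\<lambda>x\<in>L. x + \<tau> x + a)"
    by (auto simp: H_def)
  have "\<exists>h'\<in>H. \<forall>x\<in>L. h (k x) = h' (h x)" if "k \<in> H" for k
  proof -
    obtain \<sigma> b where \<sigma>: "\<sigma> \<in> homs" and b: "b \<in> L" and k_eq: "k = (\<lambda>x\<in>L. x + \<sigma> x + b)"
      using \<open>k \<in> H\<close> by (auto simp: H_def)
    \<comment> \<open>Conjugating \<open>k\<close> by \<open>h\<close> keeps the linear part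
      \<open>\<sigma>\<close> and changes the translation part by
      \<open>\<tau> b - \<sigma> a\<close>.\<close>
    have c: "b + \<tau> b - \<sigma> a \<in> L" using homs_L[OF \<tau> b] homs_L[OF \<sigma> a] b by auto
    have "h (k x) = (\<lambda>x\<in>L. x + \<sigma> x + (b + \<tau> b - \<sigma> a)) (h x)" if "x \<in> L" for x
      using that \<tau> \<sigma> a b by (simp add: h_eq k_eq homs_add homs_L homs_0 homs_Z L_closed algebra_simps)
    then show ?thesis using H_I[OF \<sigma> c] by blast
  qed
  then show "h \<in> NH" using h H_Bij unfolding NH_iff by blast
qed

text \<open>\<open>Ehat\<close> and \<open>Khat\<close> are the preimages in \<open>NH\<close> of
  the two factors of the quotient: the maps trivial on \<open>Z\<close> up to translation, and the
  affine maps.\<close>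

definition Ehat :: "('v \<Rightarrow> 'v) set" where "Ehat = {\<phi> \<in> NH. \<forall>z\<in>Z. ctr \<phi> z = z}"
definition Khat :: "('v \<Rightarrow> 'v) set" where "Khat = {\<phi> \<in> NH. \<forall>x\<in>L. \<forall>y\<in>L. polar \<phi> x y = 0}"

lemma Ehat_NH: "\<phi> \<in> Ehat \<Longrightarrow> \<phi> \<in> NH" and Khat_NH: "\<phi> \<in> Khat \<Longrightarrow> \<phi> \<in> NH"
  by (auto simp: Ehat_def Khat_def)

text \<open>The element \<open>int p *\<^sub>Z x\<close> of \<open>Z\<close> is fixed, so
  \<open>ctr \<phi> x - x\<close> is killed by \<open>p\<close>.\<close>

lemma Ehat_mod_Z:
  assumes "\<phi> \<in> Ehat" "x \<in> L" shows "ctr \<phi> x - x \<in> Z"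
proof (rule L_torsion)
  have "int p *\<^sub>Z ctr \<phi> x = int p *\<^sub>Z x"
    using assms ctr_p[of \<phi> x] p_scale_L[of x] by (simp add: Ehat_def)
  then show "int p *\<^sub>Z (ctr \<phi> x - x) = 0" by (simp add: zmod.scale_right_diff_distrib)
qed (use assms Ehat_NH in auto)

lemma Ehat_Int_Khat: "Ehat \<inter> Khat = H"
proof (intro equalityI subsetI)
  fix \<phi> assume "\<phi> \<in> Ehat \<inter> Khat"
  then have E: "\<phi> \<in> Ehat" and K: "\<phi> \<in> Khat" by auto
  note \<phi> = Ehat_NH[OF E]
  define \<tau> where "\<tau> x = ctr \<phi> x - x" for x
  \<comment> \<open>Additivity comes from \<open>Khat\<close>; values in \<open>Z\<close> and
    vanishing on \<open>Z\<close> come from \<open>Ehat\<close>.\<close>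
  have "\<tau> \<in> homs"
    using Ehat_mod_Z[OF E] E K by (auto simp: homs_def \<tau>_def ctr_add Khat_def Ehat_def)
  moreover have "\<phi> = (\<lambda>x\<in>L. x + \<tau> x + \<phi> 0)"
    using NH_Bij[OF \<phi>] by (intro extensionalityI[of _ L]) (auto simp: \<tau>_def ctr_def Bij_def)
  ultimately show "\<phi> \<in> H" using H_I[of \<tau> "\<phi> 0"] NH_L[OF \<phi>, of 0] by auto
next
  fix h assume h: "h \<in> H"
  then obtain \<tau> a where \<tau>: "\<tau> \<in> homs" and a: "a \<in> L" and h_eq: "h = (\<lambda>x\<in>L. x + \<tau> x + a)"
    by (auto simp: H_def)
  have "ctr h z = z" if "z \<in> Z" for z
    using that \<tau> by (simp add: h_eq ctr_def homs_0 L_closed)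
  moreover have "polar h x y = 0" if "x \<in> L" "y \<in> L" for x y
    using that \<tau> by (simp add: h_eq polar_def homs_0 homs_add L_closed)
  ultimately show "h \<in> Ehat \<inter> Khat" using h H_NH by (auto simp: Ehat_def Khat_def)
qed

text \<open>A chain rule: the polarization of \<open>\<phi>\<close> is pulled back along
  \<open>\<psi>\<close>, that of \<open>\<psi>\<close> is pushed forward. The shift by
  \<open>\<psi> 0\<close> cancels by bilinearity.\<close>

lemma polar_compose:
  assumes \<phi>: "\<phi> \<in> NH" and \<psi>: "\<psi> \<in> NH" and x: "x \<in> L" and y: "y \<in> L"
  shows "polar (compose L \<phi> \<psi>) x y = polar \<phi> (ctr \<psi> x) (ctr \<psi> y) + ctr \<phi> (polar \<psi> x y)"
proof -
  let ?a = "ctr \<psi> x" and ?b = "ctr \<psi> y" and ?c = "\<psi> 0" and ?d = "polar \<psi> x y"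
  have L: "?a \<in> L" "?b \<in> L" "?c \<in> L" and d: "?d \<in> Z" using \<phi> \<psi> x y NH_L[OF \<psi>, of 0] by auto
  have "\<psi> (x + y) = (?c + ?a + ?b) + ?d" "\<psi> x = ?c + ?a" "\<psi> y = ?c + ?b"
    by (simp_all add: ctr_def polar_def algebra_simps)
  moreover have "polar (compose L \<phi> \<psi>) x y = ctr \<phi> (\<psi> (x + y)) - ctr \<phi> (\<psi> x) - ctr \<phi> (\<psi> y) + ctr \<phi> ?c"
    using x y by (simp add: polar_def ctr_def[of \<phi>] compose_def L_closed)
  ultimately have "polar (compose L \<phi> \<psi>) x y = ctr \<phi> ((?c + ?a + ?b) + ?d) - ctr \<phi> (?c + ?a) - ctr \<phi> (?c + ?b) + ctr \<phi> ?c"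
    by simp
  also have "ctr \<phi> ((?c + ?a + ?b) + ?d) = ctr \<phi> (?c + ?a + ?b) + ctr \<phi> ?d"
    by (rule ctr_add_Z[OF \<phi> _ d]) (use L in auto)
  also have "ctr \<phi> (?c + ?a + ?b) = ctr \<phi> (?c + ?a) + ctr \<phi> ?b + (polar \<phi> ?c ?b + polar \<phi> ?a ?b)"
    using polar_add_left[OF \<phi> L(3) L(1) L(2)] by (simp add: ctr_add)
  also have "ctr \<phi> (?c + ?b) = ctr \<phi> ?c + ctr \<phi> ?b + polar \<phi> ?c ?b" by (rule ctr_add)
  finally show ?thesis by (simp add: algebra_simps)
qed

lemma ctr_compose:
  assumes \<phi>: "\<phi> \<in> NH" and \<psi>: "\<psi> \<in> NH" and z: "z \<in> Z"
  shows "ctr (compose L \<phi> \<psi>) z = ctr \<phi> (ctr \<psi> z)"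
proof -
  have "ctr (compose L \<phi> \<psi>) z = ctr \<phi> (\<psi> z) - ctr \<phi> (\<psi> 0)"
    using z by (simp add: ctr_def compose_def L_closed)
  also have "\<psi> z = \<psi> 0 + ctr \<psi> z" by (simp add: ctr_def)
  also have "ctr \<phi> (\<psi> 0 + ctr \<psi> z) = ctr \<phi> (\<psi> 0) + ctr \<phi> (ctr \<psi> z)"
    by (rule ctr_add_Z[OF \<phi>]) (use \<psi> z NH_L[OF \<psi>, of 0] in auto)
  finally show ?thesis by simp
qed

text \<open>An additive bijection conjugates translations to translations and \<open>\<tau>\<close>
  to \<open>\<alpha> \<tau> \<alpha>\<inverse>\<close>, which is again in Hom(L/Z, Z) because
  \<open>\<alpha>\<close> and its inverse preserve the p-torsion.\<close>

lemma additive_Khat: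
  assumes bij: "bij_betw \<alpha> L L" and add: "\<And>x y. x \<in> L \<Longrightarrow> y \<in> L \<Longrightarrow> \<alpha> (x + y) = \<alpha> x + \<alpha> y"
  shows "restrict \<alpha> L \<in> Khat" "\<And>x. x \<in> L \<Longrightarrow> ctr (restrict \<alpha> L) x = \<alpha> x"
proof -
  let ?k = "inv_into L \<alpha>"
  have \<alpha>L: "\<alpha> x \<in> L" and kL: "?k x \<in> L" and \<alpha>k: "\<alpha> (?k x) = x" and k\<alpha>: "?k (\<alpha> x) = x" if "x \<in> L" for x
    using that bij bij_betwE[OF bij] bij_betwE[OF bij_betw_inv_into[OF bij]]
    by (auto simp: bij_betw_inv_into_left bij_betw_inv_into_right)
  have \<alpha>0: "\<alpha> 0 = 0" using add[of 0 0] by simp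
  have scale: "\<alpha> (int m *\<^sub>Z x) = int m *\<^sub>Z \<alpha> x" if "x \<in> L" for x m
    using that by (induction m) (simp_all add: \<alpha>0 zscale_left_distrib add L_closed)
  have \<alpha>Z: "\<alpha> z \<in> Z" if "z \<in> Z" for z
    using that scale[of z p] \<alpha>0 by (intro L_torsion) (auto simp: p_scale_Z \<alpha>L)
  have kZ: "?k z \<in> Z" if "z \<in> Z" for z
  proof (rule L_torsion)
    have "\<alpha> (int p *\<^sub>Z ?k z) = \<alpha> 0" using that scale[of "?k z" p] by (simp add: \<alpha>0 kL \<alpha>k p_scale_Z)
    then show "int p *\<^sub>Z ?k z = 0"
      using bij kL that by (auto simp: bij_betw_def dest!: inj_onD)
  qed (use kL that in auto)
  have kadd: "?k (x + y) = ?k x + ?k y" if "x \<in> L" "y \<in> L" for x y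
  proof -
    have "\<alpha> (?k x + ?k y) = x + y" using that by (simp add: add kL \<alpha>k)
    then show ?thesis using k\<alpha>[of "?k x + ?k y"] that by (simp add: kL)
  qed
  have "\<exists>h'\<in>H. \<forall>x\<in>L. restrict \<alpha> L (h x) = h' (restrict \<alpha> L x)" if "h \<in> H" for h
  proof -
    obtain \<tau> a where \<tau>: "\<tau> \<in> homs" and a: "a \<in> L" and h_eq: "h = (\<lambda>x\<in>L. x + \<tau> x + a)"
      using \<open>h \<in> H\<close> by (auto simp: H_def)
    have "(\<lambda>y. \<alpha> (\<tau> (?k y))) \<in> homs"
      using \<tau> by (auto simp: homs_def \<alpha>Z kL kadd add kZ \<alpha>0)
    moreover have "restrict \<alpha> L (h x) = (\<lambda>y\<in>L. y + (\<lambda>y. \<alpha> (\<tau> (?k y))) y + \<alpha> a) (restrict \<alpha> L x)"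
      if "x \<in> L" for x
      using that a \<tau> by (simp add: h_eq \<alpha>L k\<alpha> add homs_L L_closed)
    ultimately show ?thesis using H_I[OF _ \<alpha>L[OF a]] by blast
  qed
  moreover have "restrict \<alpha> L \<in> Bij L" using bij by (simp add: Bij_def)
  ultimately have "restrict \<alpha> L \<in> NH" unfolding NH_iff by blast
  moreover have "polar (restrict \<alpha> L) x y = 0" if "x \<in> L" "y \<in> L" for x y
    using that by (simp add: polar_def add \<alpha>0 L_closed)
  ultimately show "restrict \<alpha> L \<in> Khat" by (simp add: Khat_def)
  show "ctr (restrict \<alpha> L) x = \<alpha> x" if "x \<in> L" for x
    using that by (simp add: ctr_def \<alpha>0 L_closed)
qed

text \<open>If \<open>x\<close> is in the kernel, so is its p-th multiple, which lies in
  \<open>Z\<close> and hence is 0; then \<open>x\<close> itself lies in \<open>Z\<close>. Finiteness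
  turns injectivity into bijectivity.\<close>

lemma additive_bij:
  assumes L: "\<And>x. x \<in> L \<Longrightarrow> \<alpha> x \<in> L" and add: "\<And>x y. x \<in> L \<Longrightarrow> y \<in> L \<Longrightarrow> \<alpha> (x + y) = \<alpha> x + \<alpha> y"
    and inj: "\<And>z. z \<in> Z \<Longrightarrow> \<alpha> z = 0 \<Longrightarrow> z = 0"
  shows "bij_betw \<alpha> L L"
proof (rule bij_betw_L[OF L])
  have \<alpha>0: "\<alpha> 0 = 0" using add[of 0 0] by simp
  have scale: "\<alpha> (int m *\<^sub>Z x) = int m *\<^sub>Z \<alpha> x" if "x \<in> L" for x m
    using that by (induction m) (simp_all add: \<alpha>0 zscale_left_distrib add L_closed)
  have *: "x = 0" if "x \<in> L" "\<alpha> x = 0" for x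
  proof -
    have "\<alpha> (int p *\<^sub>Z x) = 0" using scale that by simp
    then have "int p *\<^sub>Z x = 0" using inj p_scale_L that by blast
    then show ?thesis using L_torsion inj that by blast
  qed
  have "\<alpha> (x - y) = \<alpha> x - \<alpha> y" if "x \<in> L" "y \<in> L" for x y
    using add[of "x - y" y] that by (simp add: L_closed algebra_simps)
  then show "inj_on \<alpha> L" using * by (intro inj_onI) (metis L_closed(3) right_minus_eq)
qed

text \<open>For odd \<open>p\<close> the integer \<open>(p + 1) / 2\<close> inverts 2 modulo
  \<open>p\<close>.\<close>

lemma half: "((int p + 1) div 2) *\<^sub>Z (2 *\<^sub>Z z) = z" if "z \<in> Z"
proof -
  obtain k where "p = 2 * k + 1" using odd by (rule oddE)
  then have "((int p + 1) div 2) * 2 = int p + 1" by simp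
  then show ?thesis using p_scale_Z[OF that] by (simp add: zscale_scale zscale_left_distrib)
qed

text \<open>Half of the polarization on the diagonal is the quadratic part; subtracting it leaves an
  additive map, and nothing changes on \<open>Z\<close>. This splits \<open>NH\<close> into
  \<open>Ehat\<close> and \<open>Khat\<close>.\<close>

lemma NH_lift:
  assumes \<phi>: "\<phi> \<in> NH"
  shows "\<exists>\<alpha>\<in>Khat. \<forall>z\<in>Z. ctr \<alpha> z = ctr \<phi> z"
proof -
  define h where "h = (int p + 1) div 2"
  define \<alpha> where "\<alpha> x = ctr \<phi> x - h *\<^sub>Z polar \<phi> x x" for x
  have \<alpha>L: "\<alpha> x \<in> L" if "x \<in> L" for x
    using that \<phi> by (auto simp: \<alpha>_def)
  have \<alpha>add: "\<alpha> (x + y) = \<alpha> x + \<alpha> y" if "x \<in> L" "y \<in> L" for x y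
  proof -
    have "polar \<phi> (x + y) (x + y) = polar \<phi> x x + 2 *\<^sub>Z polar \<phi> x y + polar \<phi> y y"
      using that \<phi> zscale_left_distrib[of 1 1 "polar \<phi> x y"]
      by (simp add: polar_add_left polar_add_right polar_commute[of _ y x] L_closed algebra_simps)
    moreover have "h *\<^sub>Z (2 *\<^sub>Z polar \<phi> x y) = polar \<phi> x y"
      unfolding h_def by (rule half) (use that \<phi> in auto)
    ultimately show ?thesis
      by (simp add: \<alpha>_def ctr_add zscale_right_distrib del: zmod.scale_scale zscale_scale)
  qed
  have \<alpha>Z: "\<alpha> z = ctr \<phi> z" if "z \<in> Z" for z
    using that polar_eq_0_left[OF \<phi>, of z z] by (simp add: \<alpha>_def)
  have bij: "bij_betw \<alpha> L L"
  proof (rule additive_bij[OF \<alpha>L \<alpha>add])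
    fix z assume "z \<in> Z" "\<alpha> z = 0"
    then have "\<phi> z = \<phi> 0" using \<alpha>Z[of z] by (simp add: ctr_def)
    then show "z = 0" using NH_inj[OF \<phi>, of z 0] \<open>z \<in> Z\<close> by auto
  qed auto
  show ?thesis
    using additive_Khat[OF bij \<alpha>add] \<alpha>Z by (intro bexI[of _ "restrict \<alpha> L"]) simp_all
qed

definition qmap :: "(nat \<Rightarrow> nat \<Rightarrow> 'v) \<Rightarrow> 'v \<Rightarrow> 'v" where
  "qmap s = (\<lambda>x\<in>L. x + bilmap s x x)"

text \<open>Restricting a bilinear map to the diagonal gives a quadratic map whose polarization is
  the symmetrization. These maps supply the preimages under \<open>table\<close>.\<close>

lemma qmap:
  assumes s: "\<And>i j. i < n \<Longrightarrow> j < n \<Longrightarrow> s i j \<in> Z"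
  shows "qmap s \<in> Ehat"
    and "\<And>x y. x \<in> L \<Longrightarrow> y \<in> L \<Longrightarrow> polar (qmap s) x y = bilmap s x y + bilmap s y x"
proof -
  note bilmap = bilmap_Z[of s, OF s] bilmap_add_left[of s, OF s] bilmap_add_right[of s, OF s]
    bilmap_eq_0_left[of s, OF s] bilmap_eq_0_right[of s, OF s]
  have "bij_betw (\<lambda>x. x + bilmap s x x) L L"
  proof (rule bij_betw_L)
    show "inj_on (\<lambda>x. x + bilmap s x x) L"
    proof (rule inj_onI)
      fix x y assume x: "x \<in> L" and y: "y \<in> L" and eq: "x + bilmap s x x = y + bilmap s y y"
      define z where "z = bilmap s y y - bilmap s x x"
      have z: "z \<in> Z" "x = y + z" using eq bilmap(1) by (auto simp: z_def algebra_simps)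
      then have "bilmap s x x = bilmap s y y" using y bilmap by simp
      then show "x = y" using eq by simp
    qed
  qed (use bilmap(1) in auto)
  then have B: "qmap s \<in> Bij L" by (simp add: qmap_def Bij_def)
  have "\<exists>h'\<in>H. \<forall>x\<in>L. qmap s (h x) = h' (qmap s x)" if "h \<in> H" for h
  proof -
    obtain \<tau> a where \<tau>: "\<tau> \<in> homs" and a: "a \<in> L" and h_eq: "h = (\<lambda>x\<in>L. x + \<tau> x + a)"
      using \<open>h \<in> H\<close> by (auto simp: H_def)
    \<comment> \<open>Shifting by \<open>a\<close> adds the derivative of the quadratic part at
      \<open>a\<close> to the linear part.\<close>
    define \<tau>' where "\<tau>' x = \<tau> x + bilmap s x a + bilmap s a x" for x
    have "\<tau>' \<in> homs"
      using \<tau> a bilmap by (auto simp: \<tau>'_def homs_def algebra_simps)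
    moreover have "qmap s (h x) = (\<lambda>x\<in>L. x + \<tau>' x + (a + bilmap s a a)) (qmap s x)" if x: "x \<in> L" for x
    proof -
      have "bilmap s (x + \<tau> x + a) (x + \<tau> x + a) = bilmap s x x + bilmap s x a + bilmap s a x + bilmap s a a"
        using x a homs_Z[OF \<tau> x] bilmap by (simp add: L_closed algebra_simps)
      moreover have "\<tau>' (x + bilmap s x x) = \<tau>' x"
        using x homs_add[OF \<open>\<tau>' \<in> homs\<close>] homs_0[OF \<open>\<tau>' \<in> homs\<close>] bilmap(1) by simp
      ultimately show ?thesis
        using x a \<tau> bilmap(1) by (simp add: h_eq qmap_def homs_L L_closed) (simp add: \<tau>'_def algebra_simps)
    qed
    moreover have "a + bilmap s a a \<in> L" using a bilmap(1) by auto
    ultimately show ?thesis using H_I by blast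
  qed
  with B have N: "qmap s \<in> NH" unfolding NH_iff by blast
  have "ctr (qmap s) z = z" if "z \<in> Z" for z
    using that bilmap by (simp add: ctr_def qmap_def)
  then show "qmap s \<in> Ehat" using N by (simp add: Ehat_def)
  show "polar (qmap s) x y = bilmap s x y + bilmap s y x" if "x \<in> L" "y \<in> L" for x y
    using that bilmap by (simp add: polar_def qmap_def L_closed algebra_simps)
qed

end

section \<open>The quotient by the holomorph and its elementary abelian part\<close>

context p_lattice
begin

definition NHg :: "('v \<Rightarrow> 'v) monoid" where
  "NHg = (perm_group L)\<lparr>carrier := NH\<rparr>"

lemma carrier_NHg [simp]: "carrier NHg = NH" by (simp add: NHg_def)

lemma NH_subgroup: "subgroup NH (perm_group L)"
  unfolding NH_def by (rule group.normalizer_imp_subgroup[OF group_perm_group]) (simp add: H_Bij)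

lemma group_NHg: "group NHg"
  unfolding NHg_def by (rule subgroup.subgroup_is_group[OF NH_subgroup group_perm_group])

sublocale NHg: group NHg by (rule group_NHg)

lemma NHg_mult: "\<phi> \<in> NH \<Longrightarrow> \<psi> \<in> NH \<Longrightarrow> \<phi> \<otimes>\<^bsub>NHg\<^esub> \<psi> = compose L \<psi> \<phi>"
  by (simp add: NHg_def NH_Bij)

lemma NHg_one: "\<one>\<^bsub>NHg\<^esub> = (\<lambda>x\<in>L. x)" by (simp add: NHg_def)

lemma ctr_mult: "\<phi> \<in> NH \<Longrightarrow> \<psi> \<in> NH \<Longrightarrow> z \<in> Z \<Longrightarrow> ctr (\<phi> \<otimes>\<^bsub>NHg\<^esub> \<psi>) z = ctr \<psi> (ctr \<phi> z)"
  by (simp add: NHg_mult ctr_compose)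

lemma polar_mult: "\<phi> \<in> NH \<Longrightarrow> \<psi> \<in> NH \<Longrightarrow> x \<in> L \<Longrightarrow> y \<in> L \<Longrightarrow>
    polar (\<phi> \<otimes>\<^bsub>NHg\<^esub> \<psi>) x y = polar \<psi> (ctr \<phi> x) (ctr \<phi> y) + ctr \<psi> (polar \<phi> x y)"
  by (simp add: NHg_mult polar_compose)

lemma ctr_one: "z \<in> Z \<Longrightarrow> ctr \<one>\<^bsub>NHg\<^esub> z = z"
  by (simp add: NHg_one ctr_def L_closed)

lemma polar_one: "x \<in> L \<Longrightarrow> y \<in> L \<Longrightarrow> polar \<one>\<^bsub>NHg\<^esub> x y = 0"
  by (simp add: NHg_one polar_def L_closed)

lemma inv_NH: "\<phi> \<in> NH \<Longrightarrow> inv\<^bsub>NHg\<^esub> \<phi> \<in> NH"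
  using NHg.inv_closed[of \<phi>] by simp

lemma ctr_inv_left: "\<phi> \<in> NH \<Longrightarrow> z \<in> Z \<Longrightarrow> ctr \<phi> (ctr (inv\<^bsub>NHg\<^esub> \<phi>) z) = z"
  using ctr_mult[of "inv\<^bsub>NHg\<^esub> \<phi>" \<phi> z] by (simp add: inv_NH ctr_one)

lemma ctr_inv_right: "\<phi> \<in> NH \<Longrightarrow> z \<in> Z \<Longrightarrow> ctr (inv\<^bsub>NHg\<^esub> \<phi>) (ctr \<phi> z) = z"
  using ctr_mult[of \<phi> "inv\<^bsub>NHg\<^esub> \<phi>" z] by (simp add: inv_NH ctr_one)

lemma ctr_eq_0: "\<phi> \<in> NH \<Longrightarrow> z \<in> Z \<Longrightarrow> ctr \<phi> z = 0 \<Longrightarrow> z = 0"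
  using ctr_inv_right[of \<phi> z] by simp

text \<open>\<open>Ehat\<close> is the kernel of the action of \<open>NH\<close> on \<open>Z\<close>
  by \<open>ctr\<close>.\<close>

lemma Ehat_normal: "Ehat \<lhd> NHg"
proof (rule NHg.normal_invI)
  show "subgroup Ehat NHg"
  proof
    fix \<phi> \<psi> assume "\<phi> \<in> Ehat" "\<psi> \<in> Ehat"
    then show "\<phi> \<otimes>\<^bsub>NHg\<^esub> \<psi> \<in> Ehat"
      using NHg.m_closed[of \<phi> \<psi>] by (simp add: Ehat_def ctr_mult)
  next
    show "\<one>\<^bsub>NHg\<^esub> \<in> Ehat" using NHg.one_closed by (simp add: Ehat_def ctr_one)
  next
    fix \<phi> assume \<phi>: "\<phi> \<in> Ehat"
    have "ctr (inv\<^bsub>NHg\<^esub> \<phi>) z = z" if "z \<in> Z" for z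
      using \<phi> that ctr_inv_right[of \<phi> z] by (simp add: Ehat_def)
    then show "inv\<^bsub>NHg\<^esub> \<phi> \<in> Ehat" using \<phi> inv_NH by (simp add: Ehat_def)
  qed (simp add: Ehat_def)
next
  fix \<phi> \<epsilon> assume \<phi>: "\<phi> \<in> carrier NHg" and \<epsilon>: "\<epsilon> \<in> Ehat"
  have N: "\<epsilon> \<in> NH" "inv\<^bsub>NHg\<^esub> \<phi> \<in> NH" "\<phi> \<in> NH" "\<phi> \<otimes>\<^bsub>NHg\<^esub> \<epsilon> \<in> NH"
    using \<phi> \<epsilon> inv_NH Ehat_NH NHg.m_closed[of \<phi> \<epsilon>] by auto
  then have "ctr (\<phi> \<otimes>\<^bsub>NHg\<^esub> \<epsilon> \<otimes>\<^bsub>NHg\<^esub> inv\<^bsub>NHg\<^esub> \<phi>) z = z" if "z \<in> Z" for z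
    using that \<epsilon> ctr_Z[OF N(3) that] by (simp add: ctr_mult ctr_inv_right) (simp add: Ehat_def ctr_inv_right)
  then show "\<phi> \<otimes>\<^bsub>NHg\<^esub> \<epsilon> \<otimes>\<^bsub>NHg\<^esub> inv\<^bsub>NHg\<^esub> \<phi> \<in> Ehat"
    using N NHg.m_closed[of "\<phi> \<otimes>\<^bsub>NHg\<^esub> \<epsilon>" "inv\<^bsub>NHg\<^esub> \<phi>"] by (simp add: Ehat_def)
qed

lemma Khat_subgroup: "subgroup Khat NHg"
proof
  fix \<phi> \<psi> assume "\<phi> \<in> Khat" "\<psi> \<in> Khat"
  then show "\<phi> \<otimes>\<^bsub>NHg\<^esub> \<psi> \<in> Khat"
    using NHg.m_closed[of \<phi> \<psi>] by (simp add: Khat_def polar_mult ctr_L)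
next
  show "\<one>\<^bsub>NHg\<^esub> \<in> Khat" using NHg.one_closed by (simp add: Khat_def polar_one)
next
  fix \<phi> assume \<phi>: "\<phi> \<in> Khat"
  then have N: "\<phi> \<in> NH" "inv\<^bsub>NHg\<^esub> \<phi> \<in> NH" using inv_NH Khat_NH by auto
  have "polar (inv\<^bsub>NHg\<^esub> \<phi>) x y = 0" if xy: "x \<in> L" "y \<in> L" for x y
  proof -
    \<comment> \<open>The chain rule for the product of the inverse with \<open>\<phi>\<close>,
      whose polarization is 0; injectivity of \<open>ctr \<phi>\<close> on \<open>Z\<close> then
      finishes.\<close>
    have "ctr \<phi> (polar (inv\<^bsub>NHg\<^esub> \<phi>) x y) = 0"
      using polar_mult[OF N(2,1) xy] \<phi> xy N(1) ctr_L[OF N(2)] by (simp add: polar_one Khat_def)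
    then show ?thesis using ctr_eq_0[OF N(1) polar_Z[OF N(2) xy]] by blast
  qed
  then show "inv\<^bsub>NHg\<^esub> \<phi> \<in> Khat" using N by (simp add: Khat_def)
qed (simp add: Khat_def)

text \<open>The subgroup laws come for free from \<open>H\<close> being the intersection of
  \<open>Ehat\<close> and \<open>Khat\<close>.\<close>

lemma H_subgroup: "subgroup H (perm_group L)"
proof -
  have "subgroup H NHg"
    unfolding Ehat_Int_Khat[symmetric]
    by (rule NHg.subgroups_Inter_pair[OF normal_imp_subgroup[OF Ehat_normal] Khat_subgroup])
  then show ?thesis unfolding NHg_def
    using group.incl_subgroup[OF group_perm_group NH_subgroup] by blast
qed

lemma H_normal: "H \<lhd> NHg"
  unfolding NHg_def NH_def by (rule group.subgroup_in_normalizer[OF group_perm_group H_subgroup])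

lemma H_Ehat: "h \<in> H \<Longrightarrow> h \<in> Ehat" and H_Khat: "h \<in> H \<Longrightarrow> h \<in> Khat"
  using Ehat_Int_Khat by auto

text \<open>Dividing \<open>\<phi>\<close> by an affine map with the same action on \<open>Z\<close>
  leaves an element of \<open>Ehat\<close>.\<close>

lemma Ehat_Khat: "Ehat <#>\<^bsub>NHg\<^esub> Khat = carrier NHg"
proof (intro equalityI subsetI)
  fix \<phi> assume "\<phi> \<in> Ehat <#>\<^bsub>NHg\<^esub> Khat"
  then show "\<phi> \<in> carrier NHg"
    using NHg.m_closed Ehat_NH Khat_NH by (auto simp: set_mult_def)
next
  fix \<phi> assume "\<phi> \<in> carrier NHg"
  then have \<phi>: "\<phi> \<in> NH" by simp
  obtain \<alpha> where \<alpha>: "\<alpha> \<in> Khat" "\<And>z. z \<in> Z \<Longrightarrow> ctr \<alpha> z = ctr \<phi> z" using NH_lift[OF \<phi>] by blast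
  have \<alpha>N: "\<alpha> \<in> NH" using \<alpha> Khat_NH by blast
  define \<epsilon> where "\<epsilon> = \<phi> \<otimes>\<^bsub>NHg\<^esub> inv\<^bsub>NHg\<^esub> \<alpha>"
  have "\<epsilon> \<in> NH" unfolding \<epsilon>_def using \<phi> \<alpha>N inv_NH NHg.m_closed by simp
  moreover have "ctr \<epsilon> z = z" if "z \<in> Z" for z
    using that \<phi> \<alpha>N ctr_inv_right[OF \<alpha>N that] \<alpha>(2)[OF that] by (simp add: \<epsilon>_def ctr_mult inv_NH)
  ultimately have "\<epsilon> \<in> Ehat" by (simp add: Ehat_def)
  moreover have "\<phi> = \<epsilon> \<otimes>\<^bsub>NHg\<^esub> \<alpha>"
    using \<phi> \<alpha>N by (simp add: \<epsilon>_def NHg.m_assoc inv_NH)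
  ultimately show "\<phi> \<in> Ehat <#>\<^bsub>NHg\<^esub> Khat" using \<alpha>(1) by (auto simp: set_mult_def)
qed

abbreviation rcos :: "('v \<Rightarrow> 'v) \<Rightarrow> ('v \<Rightarrow> 'v) set" where "rcos \<phi> \<equiv> H #>\<^bsub>NHg\<^esub> \<phi>"

lemma semidirect_NHg_Mod_H: "internal_semidirect (NHg Mod H) (rcos ` Ehat) (rcos ` Khat)"
  by (rule quotient_internal_semidirect[OF H_normal Ehat_normal Khat_subgroup Ehat_Int_Khat Ehat_Khat])

text \<open>The quotient of \<open>Khat\<close> by \<open>H\<close> acts faithfully on
  \<open>Z\<close>, since an affine map trivial on \<open>Z\<close> lies in both \<open>Ehat\<close>
  and \<open>Khat\<close>.\<close>

lemma rcos_Khat_eq_iff: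
  assumes \<phi>: "\<phi> \<in> Khat" and \<psi>: "\<psi> \<in> Khat"
  shows "rcos \<phi> = rcos \<psi> \<longleftrightarrow> (\<forall>z\<in>Z. ctr \<phi> z = ctr \<psi> z)"
proof
  have N: "\<phi> \<in> NH" "\<psi> \<in> NH" using assms Khat_NH by auto
  have sub: "subgroup H NHg" by (rule normal_imp_subgroup[OF H_normal])
  {
    assume "rcos \<phi> = rcos \<psi>"
    then have "\<phi> \<in> rcos \<psi>" using NHg.rcos_self[of \<phi> H] N sub by simp
    then obtain h where h: "h \<in> H" "\<phi> = h \<otimes>\<^bsub>NHg\<^esub> \<psi>" by (auto simp: r_coset_def)
    have "h \<in> NH" "h \<in> Ehat" using h H_Ehat Ehat_NH by auto
    then show "\<forall>z\<in>Z. ctr \<phi> z = ctr \<psi> z" using h N by (simp add: ctr_mult) (simp add: Ehat_def)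
  }
  {
    assume eq: "\<forall>z\<in>Z. ctr \<phi> z = ctr \<psi> z"
    define h where "h = \<phi> \<otimes>\<^bsub>NHg\<^esub> inv\<^bsub>NHg\<^esub> \<psi>"
    have "h \<in> Khat" unfolding h_def
      using \<phi> \<psi> Khat_subgroup by (simp add: subgroup.m_closed subgroup.m_inv_closed)
    moreover have "ctr h z = z" if "z \<in> Z" for z
      using that N eq ctr_inv_right[OF N(2) that] by (simp add: h_def ctr_mult inv_NH)
    ultimately have "h \<in> H" using Ehat_Int_Khat Khat_NH by (auto simp: Ehat_def)
    moreover have "\<phi> = h \<otimes>\<^bsub>NHg\<^esub> \<psi>" using N by (simp add: h_def NHg.m_assoc inv_NH)
    ultimately have "\<phi> \<in> rcos \<psi>" by (auto simp: r_coset_def)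
    then show "rcos \<phi> = rcos \<psi>" using NHg.repr_independence[of \<phi> H \<psi>] N sub by simp
  }
qed

text \<open>The diagonal is included: a symmetric bilinear map is given by its entries on and above
  it. Their number is the second factor of the exponent in the order.\<close>

definition pairs :: "(nat \<times> nat) set" where "pairs = {(i, j). i \<le> j \<and> j < n}"

definition forms :: "(nat \<times> nat \<Rightarrow> 'v) monoid" where
  "forms = \<lparr>carrier = PiE pairs (\<lambda>_. Z), monoid.mult = \<lambda>f g. \<lambda>q\<in>pairs. f q + g q, one = \<lambda>q\<in>pairs. 0\<rparr>"

definition table :: "('v \<Rightarrow> 'v) \<Rightarrow> nat \<times> nat \<Rightarrow> 'v" where
  "table \<phi> = (\<lambda>(i, j)\<in>pairs. polar \<phi> (e i) (e j))"

lemma pairs_finite_card: "finite pairs" "card pairs = (n + 1) choose 2"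
proof -
  have pairs: "pairs = (\<lambda>(j, i). (i, j)) ` (SIGMA j:{..<n}. {..j})" by (auto simp: pairs_def)
  show "finite pairs" unfolding pairs by auto
  have "card pairs = card (SIGMA j:{..<n}. {..j})"
    unfolding pairs by (rule card_image) (auto simp: inj_on_def)
  also have "\<dots> = (\<Sum>j<n. Suc j)" by simp
  also have "\<dots> = (n + 1) choose 2" by (induction n) (simp_all add: numeral_2_eq_2)
  finally show "card pairs = (n + 1) choose 2" .
qed

lemma forms_comm_group: "comm_group forms"
proof (rule comm_groupI)
  fix f assume f: "f \<in> carrier forms"
  then have "(\<lambda>q\<in>pairs. - f q) \<in> carrier forms" "(\<lambda>q\<in>pairs. - f q) \<otimes>\<^bsub>forms\<^esub> f = \<one>\<^bsub>forms\<^esub>"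
    by (auto simp: forms_def intro!: restrict_ext)
  then show "\<exists>g\<in>carrier forms. g \<otimes>\<^bsub>forms\<^esub> f = \<one>\<^bsub>forms\<^esub>" by blast
qed (auto simp: forms_def PiE_iff add_ac intro!: extensionalityI[of _ pairs] restrict_ext)

lemma forms_elementary_abelian: "elementary_abelian p forms"
proof -
  interpret X: comm_group forms by (rule forms_comm_group)
  have "f [^]\<^bsub>forms\<^esub> k = (\<lambda>q\<in>pairs. int k *\<^sub>Z f q)" if "f \<in> carrier forms" for f and k :: nat
    by (induction k) (auto simp: forms_def zscale_left_distrib add_ac intro!: restrict_ext)
  then have "f [^]\<^bsub>forms\<^esub> p = \<one>\<^bsub>forms\<^esub>" if "f \<in> carrier forms" for f
    using that by (auto simp: forms_def intro!: restrict_ext p_scale_Z dest: PiE_mem)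
  then show ?thesis by (simp add: elementary_abelian_def forms_comm_group)
qed

text \<open>In the chain rule both twists disappear: \<open>ctr \<phi>\<close> is the identity
  modulo \<open>Z\<close>, and \<open>ctr \<psi>\<close> is the identity on
  \<open>Z\<close>.\<close>

lemma polar_Ehat_mult:
  assumes \<phi>: "\<phi> \<in> Ehat" and \<psi>: "\<psi> \<in> Ehat" and x: "x \<in> L" and y: "y \<in> L"
  shows "polar (\<phi> \<otimes>\<^bsub>NHg\<^esub> \<psi>) x y = polar \<phi> x y + polar \<psi> x y"
proof -
  have N: "\<phi> \<in> NH" "\<psi> \<in> NH" using \<phi> \<psi> Ehat_NH by auto
  have a: "ctr \<phi> x = x + (ctr \<phi> x - x)" "ctr \<phi> y = y + (ctr \<phi> y - y)" by simp_all
  have "polar \<psi> (ctr \<phi> x) (ctr \<phi> y) = polar \<psi> x (ctr \<phi> y)"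
    using polar_add_left[OF N(2) x Z_L[OF Ehat_mod_Z[OF \<phi> x]] ctr_L[OF N(1) y]]
      polar_eq_0_left[OF N(2) Ehat_mod_Z[OF \<phi> x] ctr_L[OF N(1) y]] by simp
  also have "\<dots> = polar \<psi> x y"
    using polar_add_right[OF N(2) y Z_L[OF Ehat_mod_Z[OF \<phi> y]] x]
      polar_eq_0_right[OF N(2) Ehat_mod_Z[OF \<phi> y] x] by simp
  finally have "polar \<psi> (ctr \<phi> x) (ctr \<phi> y) = polar \<psi> x y" .
  moreover have "ctr \<psi> (polar \<phi> x y) = polar \<phi> x y" using \<psi> polar_Z[OF N(1) x y] by (simp add: Ehat_def)
  ultimately show ?thesis using N x y by (simp add: polar_mult)
qed

lemma polar_eq_0I:
  assumes \<phi>: "\<phi> \<in> NH" and *: "\<And>i j. i < n \<Longrightarrow> j < n \<Longrightarrow> polar \<phi> (e i) (e j) = 0"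
    and x: "x \<in> L" and y: "y \<in> L"
  shows "polar \<phi> x y = 0"
proof -
  have 1: "polar \<phi> (e i) y = 0" if i: "i < n" and "y \<in> L" for i y
    by (rule L_induct[OF \<open>y \<in> L\<close>])
      (auto simp: polar_eq_0_right[OF \<phi>] polar_add_right[OF \<phi>] * i)
  show ?thesis
    by (rule L_induct[OF x])
      (auto simp: polar_eq_0_left[OF \<phi>] polar_add_left[OF \<phi>] 1 y)
qed

lemma table_hom: "group_hom (NHg\<lparr>carrier := Ehat\<rparr>) forms table"
proof -
  have "group (NHg\<lparr>carrier := Ehat\<rparr>)"
    by (rule subgroup.subgroup_is_group[OF normal_imp_subgroup[OF Ehat_normal] group_NHg])
  moreover have "group forms" using forms_comm_group by (simp add: comm_group_def)
  moreover have "table \<in> hom (NHg\<lparr>carrier := Ehat\<rparr>) forms"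
    by (rule homI)
      (auto simp: table_def forms_def pairs_def Ehat_NH polar_Ehat_mult intro!: restrict_ext)
  ultimately show ?thesis by (simp add: group_hom_def group_hom_axioms_def)
qed

lemma table_kernel: "kernel (NHg\<lparr>carrier := Ehat\<rparr>) forms table = H"
proof (intro equalityI subsetI)
  fix \<phi> assume "\<phi> \<in> kernel (NHg\<lparr>carrier := Ehat\<rparr>) forms table"
  then have E: "\<phi> \<in> Ehat" and table: "table \<phi> = (\<lambda>q\<in>pairs. 0)" by (auto simp: kernel_def forms_def)
  note \<phi> = Ehat_NH[OF E]
  have *: "polar \<phi> (e i) (e j) = 0" if "i \<le> j" "j < n" for i j
    using fun_cong[OF table, of "(i, j)"] that by (simp add: table_def pairs_def)
  have "polar \<phi> (e i) (e j) = 0" if "i < n" "j < n" for i j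
    using that *[of i j] *[of j i] polar_commute[of \<phi> "e i" "e j"] by (metis nle_le)
  then have "\<phi> \<in> Khat" using polar_eq_0I[OF \<phi>] \<phi> by (simp add: Khat_def)
  then show "\<phi> \<in> H" using E Ehat_Int_Khat by blast
next
  fix \<phi> assume "\<phi> \<in> H"
  then have "\<phi> \<in> Ehat" "\<phi> \<in> Khat" using Ehat_Int_Khat by auto
  then show "\<phi> \<in> kernel (NHg\<lparr>carrier := Ehat\<rparr>) forms table"
    by (auto simp: kernel_def forms_def table_def pairs_def Khat_def intro!: restrict_ext)
qed

lemma table_surj: "table ` carrier (NHg\<lparr>carrier := Ehat\<rparr>) = carrier forms"
proof (intro equalityI subsetI)
  interpret table: group_hom "NHg\<lparr>carrier := Ehat\<rparr>" forms table by (rule table_hom)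
  fix f assume "f \<in> table ` carrier (NHg\<lparr>carrier := Ehat\<rparr>)"
  then show "f \<in> carrier forms" by auto
next
  fix f assume f: "f \<in> carrier forms"
  define h where "h = (int p + 1) div 2"
  \<comment> \<open>An upper triangular table with halved diagonal, so that its symmetrization has
    the entries of \<open>f\<close>.\<close>
  define s where "s i j = (if i < j then f (i, j) else if i = j then h *\<^sub>Z f (i, j) else 0)" for i j
  have fZ: "f (i, j) \<in> Z" if "i \<le> j" "j < n" for i j using f that by (auto simp: forms_def pairs_def PiE_mem)
  have s: "s i j \<in> Z" if "i < n" "j < n" for i j
    using that fZ[of i j] by (auto simp: s_def)
  have "polar (qmap s) (e i) (e j) = f (i, j)" if "i \<le> j" "j < n" for i j
  proof -
    have "polar (qmap s) (e i) (e j) = s i j + s j i"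
      using that by (simp add: qmap(2)[of s, OF s] bilmap_e[of s, OF s])
    also have "\<dots> = f (i, j)"
    proof (cases "i = j")
      case True
      have "h *\<^sub>Z f (i, j) + h *\<^sub>Z f (i, j) = h *\<^sub>Z (2 *\<^sub>Z f (i, j))"
        using zscale_left_distrib[of 1 1 "f (i, j)"] by (simp add: zscale_right_distrib)
      also have "\<dots> = f (i, j)" unfolding h_def by (rule half[OF fZ[OF that]])
      finally show ?thesis using True by (simp add: s_def)
    qed (use that in \<open>simp add: s_def\<close>)
    finally show ?thesis .
  qed
  then have "table (qmap s) = f"
    using f by (intro extensionalityI[of _ pairs]) (auto simp: table_def forms_def pairs_def PiE_def)
  then show "f \<in> table ` carrier (NHg\<lparr>carrier := Ehat\<rparr>)"
    using qmap(1)[of s, OF s] by auto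
qed

lemma elementary_abelian_part:
  defines "T \<equiv> NHg Mod H"
  shows "elementary_abelian p (T\<lparr>carrier := rcos ` Ehat\<rparr>)"
    and "card (rcos ` Ehat) = p ^ (N * ((n + 1) choose 2))"
proof -
  interpret table: group_hom "NHg\<lparr>carrier := Ehat\<rparr>" forms table by (rule table_hom)
  \<comment> \<open>Restricting the quotient to the cosets from \<open>Ehat\<close> is the same as
    dividing \<open>Ehat\<close> by \<open>H\<close>, so the first isomorphism theorem applies to
    \<open>table\<close>.\<close>
  have eq: "T\<lparr>carrier := rcos ` Ehat\<rparr> = (NHg\<lparr>carrier := Ehat\<rparr>) Mod H"
    by (auto simp: T_def FactGroup_def RCOSETS_def r_coset_def set_mult_def fun_eq_iff)
  have iso: "(\<lambda>X. the_elem (table ` X)) \<in> iso ((NHg\<lparr>carrier := Ehat\<rparr>) Mod H) forms"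
    using table.FactGroup_iso_set[OF table_surj] by (simp only: table_kernel)
  have grp: "group ((NHg\<lparr>carrier := Ehat\<rparr>) Mod H)"
    using normal.factorgroup_is_group[OF table.normal_kernel] by (simp only: table_kernel)
  show "elementary_abelian p (T\<lparr>carrier := rcos ` Ehat\<rparr>)"
    unfolding eq
    by (rule iso_elementary_abelian[OF table.H.is_group grp group.iso_set_sym[OF grp iso] forms_elementary_abelian])
  have "card (rcos ` Ehat) = card (carrier (T\<lparr>carrier := rcos ` Ehat\<rparr>))" by simp
  also have "\<dots> = card (carrier forms)"
    unfolding eq by (rule iso_same_card[OF is_isoI[OF iso]])
  also have "\<dots> = (p ^ N) ^ ((n + 1) choose 2)"
    by (simp add: forms_def card_PiE pairs_finite_card card_Z)
  finally show "card (rcos ` Ehat) = p ^ (N * ((n + 1) choose 2))" by (simp add: power_mult)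
qed

end

section \<open>Matrices over the prime field\<close>

lemma red_mat_carrier [simp]: "red_mat p A \<in> carrier_mat r c \<longleftrightarrow> A \<in> carrier_mat r c"
  by (simp add: red_mat_def)

lemma red_mat_dim [simp]: "dim_row (red_mat p A) = dim_row A" "dim_col (red_mat p A) = dim_col A"
  by (simp_all add: red_mat_def)

lemma red_mat_index [simp]:
  "i < dim_row A \<Longrightarrow> j < dim_col A \<Longrightarrow> red_mat p A $$ (i, j) = A $$ (i, j) mod int p"
  by (simp add: red_mat_def)

lemma red_mat_eq_iff:
  assumes "A \<in> carrier_mat r c" "B \<in> carrier_mat r c"
  shows "red_mat p A = red_mat p B \<longleftrightarrow> (\<forall>i<r. \<forall>j<c. [A $$ (i, j) = B $$ (i, j)] (mod int p))"
  using assms by (auto simp: mat_eq_iff cong_def)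

lemma red_mat_red_mat [simp]: "red_mat p (red_mat p A) = red_mat p A"
  by (rule eq_matI) auto

lemma mult_mat_index:
  assumes "A \<in> carrier_mat r k" "B \<in> carrier_mat k c" "i < r" "j < c"
  shows "(A * B) $$ (i, j) = (\<Sum>l<k. A $$ (i, l) * B $$ (l, j))"
  using assms by (auto simp: scalar_prod_def lessThan_atLeast0 intro!: sum.cong)

text \<open>Lets matrix identities be computed over the integers and reduced only at the
  end.\<close>

lemma red_mat_mult_cong:
  assumes "A \<in> carrier_mat r k" "A' \<in> carrier_mat r k" "B \<in> carrier_mat k c" "B' \<in> carrier_mat k c"
    and "red_mat p A = red_mat p A'" "red_mat p B = red_mat p B'"
  shows "red_mat p (A * B) = red_mat p (A' * B')"
proof -
  have "[(A * B) $$ (i, j) = (A' * B') $$ (i, j)] (mod int p)" if "i < r" "j < c" for i j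
    unfolding mult_mat_index[OF assms(1,3) that] mult_mat_index[OF assms(2,4) that]
    using that assms(5,6) assms(1-4)
    by (intro cong_sum cong_mult) (auto simp: red_mat_eq_iff[of _ r k] red_mat_eq_iff[of _ k c])
  then show ?thesis
    using assms(1-4) by (subst red_mat_eq_iff[of _ r c]) auto
qed

lemma red_mat_add_cong:
  assumes "A \<in> carrier_mat r c" "A' \<in> carrier_mat r c" "B \<in> carrier_mat r c" "B' \<in> carrier_mat r c"
    and "red_mat p A = red_mat p A'" "red_mat p B = red_mat p B'"
  shows "red_mat p (A + B) = red_mat p (A' + B')"
  using assms by (subst red_mat_eq_iff[of _ r c])
    (auto simp: red_mat_eq_iff[of _ r c] intro!: cong_add)

lemma red_mat_mult_left:
  "A \<in> carrier_mat r k \<Longrightarrow> B \<in> carrier_mat k c \<Longrightarrow> red_mat p (red_mat p A * B) = red_mat p (A * B)"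
  and red_mat_mult_right:
  "A \<in> carrier_mat r k \<Longrightarrow> B \<in> carrier_mat k c \<Longrightarrow> red_mat p (A * red_mat p B) = red_mat p (A * B)"
  by (rule red_mat_mult_cong[of _ r k _ _ c]; simp)+

lemma red_mat_one: "p > 1 \<Longrightarrow> red_mat p (1\<^sub>m k) = 1\<^sub>m k"
  by (rule eq_matI) auto

text \<open>Being fixed by reduction is easier to use than the range condition on the
  entries.\<close>

lemma mem_fp_mat_iff:
  assumes "p > 0" shows "A \<in> fp_mat p r c \<longleftrightarrow> A \<in> carrier_mat r c \<and> red_mat p A = A"
proof -
  have "elements_mat A \<subseteq> {0..<int p} \<longleftrightarrow> red_mat p A = A" if "A \<in> carrier_mat r c"
  proof
    assume s: "elements_mat A \<subseteq> {0..<int p}"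
    have "A $$ (i, j) mod int p = A $$ (i, j)" if "i < r" "j < c" for i j
      using elements_matI[OF \<open>A \<in> carrier_mat r c\<close> that refl] s by auto
    then show "red_mat p A = A" using that by (intro eq_matI) auto
  next
    assume r: "red_mat p A = A"
    have "A $$ (i, j) \<in> {0..<int p}" if "i < r" "j < c" for i j
    proof -
      have "A $$ (i, j) = A $$ (i, j) mod int p"
        using that \<open>A \<in> carrier_mat r c\<close> arg_cong[OF r, of "\<lambda>X. X $$ (i, j)"] by simp
      also have "\<dots> \<in> {0..<int p}" using assms by simp
      finally show ?thesis .
    qed
    then show "elements_mat A \<subseteq> {0..<int p}" using that by (auto dest!: elements_matD)
  qed
  then show ?thesis by (auto simp: fp_mat_def)
qed

lemma red_mat_fp_mat: "p > 0 \<Longrightarrow> A \<in> carrier_mat r c \<Longrightarrow> red_mat p A \<in> fp_mat p r c"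
  by (simp add: mem_fp_mat_iff)

lemma fp_mat_carrier: "A \<in> fp_mat p r c \<Longrightarrow> A \<in> carrier_mat r c"
  by (simp add: fp_mat_def)

lemma fp_mat_eqI:
  "p > 0 \<Longrightarrow> A \<in> fp_mat p r c \<Longrightarrow> B \<in> fp_mat p r c \<Longrightarrow> red_mat p A = red_mat p B \<Longrightarrow> A = B"
  by (simp add: mem_fp_mat_iff)

lemma fp_mat_mult_closed:
  "p > 0 \<Longrightarrow> A \<in> fp_mat p r k \<Longrightarrow> B \<in> fp_mat p k c \<Longrightarrow> fp_mat_mult p A B \<in> fp_mat p r c"
  unfolding fp_mat_mult_def by (intro red_mat_fp_mat mult_carrier_mat) (auto simp: fp_mat_def)

lemma monoid_fp_mat:
  assumes "p > 1"
  shows "monoid \<lparr>carrier = fp_mat p k k, monoid.mult = fp_mat_mult p, one = 1\<^sub>m k\<rparr>"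
proof (rule monoidI; simp)
  show "1\<^sub>m k \<in> fp_mat p k k" using assms by (simp add: mem_fp_mat_iff red_mat_one)
  fix A B C assume A: "A \<in> fp_mat p k k"
  then have A': "A \<in> carrier_mat k k" "red_mat p A = A" using assms by (auto simp: mem_fp_mat_iff)
  show "fp_mat_mult p (1\<^sub>m k) A = A" "fp_mat_mult p A (1\<^sub>m k) = A"
    using A' by (simp_all add: fp_mat_mult_def)
  assume B: "B \<in> fp_mat p k k"
  show "fp_mat_mult p A B \<in> fp_mat p k k" using assms A B by (simp add: fp_mat_mult_closed)
  assume C: "C \<in> fp_mat p k k"
  note c = A'(1) fp_mat_carrier[OF B] fp_mat_carrier[OF C]
  show "fp_mat_mult p (fp_mat_mult p A B) C = fp_mat_mult p A (fp_mat_mult p B C)"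
    using c red_mat_mult_left[of "A * B" k k C k p] red_mat_mult_right[of A k k "B * C" k p]
    by (simp add: fp_mat_mult_def assoc_mult_mat[of A k k B k C k])
qed

lemma carrier_GL:
  "carrier (GL p k) = {A \<in> fp_mat p k k. \<exists>B\<in>fp_mat p k k. fp_mat_mult p B A = 1\<^sub>m k \<and> fp_mat_mult p A B = 1\<^sub>m k}"
  by (auto simp: GL_def units_of_def Units_def)

lemma group_GL: "p > 1 \<Longrightarrow> group (GL p k)"
  unfolding GL_def by (rule monoid.units_group[OF monoid_fp_mat])

lemma mult_GL [simp]: "A \<otimes>\<^bsub>GL p k\<^esub> B = fp_mat_mult p A B"
  and one_GL [simp]: "\<one>\<^bsub>GL p k\<^esub> = 1\<^sub>m k"
  by (simp_all add: GL_def units_of_def)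

lemma GL_fp_mat: "A \<in> carrier (GL p k) \<Longrightarrow> A \<in> fp_mat p k k"
  by (simp add: carrier_GL)

lemma GL_inv:
  assumes "p > 1" "A \<in> carrier (GL p k)"
  shows "inv\<^bsub>GL p k\<^esub> A \<in> carrier (GL p k)"
    "red_mat p (A * inv\<^bsub>GL p k\<^esub> A) = 1\<^sub>m k" "red_mat p (inv\<^bsub>GL p k\<^esub> A * A) = 1\<^sub>m k"
  using assms group.inv_closed[OF group_GL] group.r_inv[OF group_GL, of p A k] group.l_inv[OF group_GL, of p A k]
  by (auto simp: fp_mat_mult_def)

lemma carrier_matrix_semidirect:
  "carrier (matrix_semidirect p n m) = (carrier (GL p n) \<times> carrier (GL p m)) \<times> fp_mat p m n"
  by (simp add: matrix_semidirect_def semidirect_def fp_mat_add_group_def)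

lemma mult_matrix_semidirect:
  "((A, M), Q) \<otimes>\<^bsub>matrix_semidirect p n m\<^esub> ((A', M'), Q') =
    ((fp_mat_mult p A A', fp_mat_mult p M M'),
     red_mat p (fp_mat_mult p (fp_mat_mult p (inv\<^bsub>GL p m\<^esub> M') Q) A' + Q'))"
  by (simp add: matrix_semidirect_def semidirect_def fp_mat_add_group_def GL_pair_action_def)

lemma matrix_semidirect_closed:
  assumes "p > 1" "x \<in> carrier (matrix_semidirect p n m)" "y \<in> carrier (matrix_semidirect p n m)"
  shows "x \<otimes>\<^bsub>matrix_semidirect p n m\<^esub> y \<in> carrier (matrix_semidirect p n m)"
proof -
  obtain A M Q where "x = ((A, M), Q)" by (metis surj_pair)
  moreover obtain A' M' Q' where "y = ((A', M'), Q')" by (metis surj_pair)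
  ultimately have xy: "x = ((A, M), Q)" "y = ((A', M'), Q')" by simp_all
  have *: "A \<in> carrier (GL p n)" "M \<in> carrier (GL p m)" "Q \<in> fp_mat p m n"
    "A' \<in> carrier (GL p n)" "M' \<in> carrier (GL p m)" "Q' \<in> fp_mat p m n"
    using assms unfolding xy by (auto simp: carrier_matrix_semidirect)
  have "fp_mat_mult p A A' \<in> carrier (GL p n)" "fp_mat_mult p M M' \<in> carrier (GL p m)"
    using group.is_monoid[OF group_GL[OF assms(1)]] * monoid.m_closed by (metis mult_GL)+
  moreover have "fp_mat_mult p (fp_mat_mult p (inv\<^bsub>GL p m\<^esub> M') Q) A' \<in> fp_mat p m n"
    using assms(1) * GL_inv(1)[OF assms(1) *(5)]
    by (intro fp_mat_mult_closed[of p _ m n] fp_mat_mult_closed[of p _ m m] GL_fp_mat) auto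
  moreover from this have "red_mat p (fp_mat_mult p (fp_mat_mult p (inv\<^bsub>GL p m\<^esub> M') Q) A' + Q') \<in> fp_mat p m n"
    using assms(1) by (intro red_mat_fp_mat add_carrier_mat fp_mat_carrier[OF *(6)]) auto
  ultimately show ?thesis
    unfolding xy mult_matrix_semidirect carrier_matrix_semidirect by simp
qed

section \<open>Invertible block triangular matrices\<close>

lemma uminus_zero_mat: "- 0\<^sub>m r c = (0\<^sub>m r c :: int mat)"
  by (rule eq_matI) auto

lemma add_uminus_mat: "X \<in> carrier_mat r c \<Longrightarrow> X + - X = (0\<^sub>m r c :: int mat)"
  by (rule eq_matI) auto

lemma four_block_mat_inj:
  assumes c: "A \<in> carrier_mat r1 c1" "B \<in> carrier_mat r1 c2" "C \<in> carrier_mat r2 c1" "D \<in> carrier_mat r2 c2"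
    and c': "A' \<in> carrier_mat r1 c1" "B' \<in> carrier_mat r1 c2" "C' \<in> carrier_mat r2 c1" "D' \<in> carrier_mat r2 c2"
    and eq: "four_block_mat A B C D = four_block_mat A' B' C' D'"
  shows "A = A'" "C = C'" "D = D'"
proof -
  note d = c[THEN carrier_matD(1)] c[THEN carrier_matD(2)] c'[THEN carrier_matD(1)] c'[THEN carrier_matD(2)]
  have entry: "four_block_mat A B C D $$ ij = four_block_mat A' B' C' D' $$ ij" for ij using eq by simp
  have "A $$ (i, j) = A' $$ (i, j)" if "i < r1" "j < c1" for i j
    using entry[of "(i, j)"] that by (simp add: d)
  then show "A = A'" by (intro eq_matI) (simp_all add: d)
  have "C $$ (i, j) = C' $$ (i, j)" if "i < r2" "j < c1" for i j
    using entry[of "(r1 + i, j)"] that by (simp add: d)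
  then show "C = C'" by (intro eq_matI) (simp_all add: d)
  have "D $$ (i, j) = D' $$ (i, j)" if "i < r2" "j < c2" for i j
    using entry[of "(r1 + i, c1 + j)"] that by (simp add: d)
  then show "D = D'" by (intro eq_matI) (simp_all add: d)
qed

text \<open>The product of the block diagonal matrix of \<open>A\<close>, \<open>M\<close> and the
  unipotent matrix with lower left block \<open>Q\<close>, in the order in which a pair
  \<open>(h, q)\<close> stands for \<open>h q\<close>. The zero block expresses that row vectors
  supported on the first \<open>n\<close> entries, that is p L, are preserved.\<close>

definition blk :: "nat \<Rightarrow> nat \<Rightarrow> (int mat \<times> int mat) \<times> int mat \<Rightarrow> int mat" where
  "blk n m = (\<lambda>((A, M), Q). four_block_mat A (0\<^sub>m n m) (M * Q) M)"

lemma blk_carrier: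
  assumes "x \<in> carrier (matrix_semidirect p n m)" shows "blk n m x \<in> carrier_mat (n + m) (n + m)"
  using assms by (auto simp: blk_def carrier_matrix_semidirect dest!: GL_fp_mat fp_mat_carrier)

lemma blk_upper:
  assumes "x \<in> carrier (matrix_semidirect p n m)" "i < n" "n \<le> j" "j < n + m"
  shows "blk n m x $$ (i, j) = 0"
  using assms by (auto simp: blk_def carrier_matrix_semidirect dest!: GL_fp_mat fp_mat_carrier)

lemma red_mat_four_block_mat:
  assumes "A \<in> carrier_mat r1 c1" "B \<in> carrier_mat r1 c2" "C \<in> carrier_mat r2 c1" "D \<in> carrier_mat r2 c2"
  shows "red_mat p (four_block_mat A B C D) =
    four_block_mat (red_mat p A) (red_mat p B) (red_mat p C) (red_mat p D)"
  unfolding red_mat_def by (rule map_four_block_mat[OF assms])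

lemma red_mat_zero [simp]: "red_mat p (0\<^sub>m r c) = 0\<^sub>m r c"
  by (rule eq_matI) auto

text \<open>With row vectors, the lower left block of a product of two block matrices is
  \<open>M Q A' + M M' Q'\<close>, and this is \<open>M M' (M'\<^sup>-\<^sup>1 Q A' + Q')\<close>; hence the parametrisation by
  \<open>M Q\<close> instead of \<open>Q\<close>.\<close>

lemma blk_mult:
  assumes p: "p > 1" and x: "x \<in> carrier (matrix_semidirect p n m)" and y: "y \<in> carrier (matrix_semidirect p n m)"
  shows "red_mat p (blk n m x * blk n m y) = red_mat p (blk n m (x \<otimes>\<^bsub>matrix_semidirect p n m\<^esub> y))"
proof -
  obtain A M Q where "x = ((A, M), Q)" by (metis surj_pair)
  moreover obtain A' M' Q' where "y = ((A', M'), Q')" by (metis surj_pair)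
  ultimately have xy: "x = ((A, M), Q)" "y = ((A', M'), Q')" by simp_all
  have *: "A \<in> carrier (GL p n)" "M \<in> carrier (GL p m)" "Q \<in> fp_mat p m n"
    "A' \<in> carrier (GL p n)" "M' \<in> carrier (GL p m)" "Q' \<in> fp_mat p m n"
    using x y unfolding xy by (auto simp: carrier_matrix_semidirect)
  define J where "J = inv\<^bsub>GL p m\<^esub> M'"
  have c: "A \<in> carrier_mat n n" "M \<in> carrier_mat m m" "Q \<in> carrier_mat m n"
    "A' \<in> carrier_mat n n" "M' \<in> carrier_mat m m" "Q' \<in> carrier_mat m n" "J \<in> carrier_mat m m"
    using * GL_inv(1)[OF p *(5)] by (auto simp: J_def dest!: GL_fp_mat fp_mat_carrier)
  have J: "red_mat p (M' * J) = 1\<^sub>m m" using GL_inv(2)[OF p *(5)] by (simp add: J_def)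
  define U where "U = red_mat p (red_mat p (red_mat p (J * Q) * A') + Q')"
  have U: "U \<in> carrier_mat m n" "red_mat p U = red_mat p (J * Q * A' + Q')"
  proof -
    have "red_mat p (red_mat p (red_mat p (J * Q) * A') + Q') = red_mat p (J * Q * A' + Q')"
      using c red_mat_mult_left[of "J * Q" m n A' n p]
      by (intro red_mat_add_cong[of _ m n]) simp_all
    then show "red_mat p U = red_mat p (J * Q * A' + Q')" by (simp add: U_def)
  qed (use c in \<open>simp add: U_def\<close>)
  have "red_mat p (red_mat p (M * M') * U) = red_mat p (M * M' * (J * Q * A' + Q'))"
    using c U by (intro red_mat_mult_cong[of _ m m _ _ n]) simp_all
  also have "M * M' * (J * Q * A' + Q') = M * ((M' * J) * (Q * A')) + M * M' * Q'"
    using c by (simp add: mult_add_distrib_mat[of _ m m _ n] assoc_mult_mat[of _ m m _ n _ n]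
        assoc_mult_mat[of _ m m _ m _ n] assoc_mult_mat[of _ m m _ m _ m])
  \<comment> \<open>\<open>M' * J\<close> is the identity only after reduction, so it is replaced
    inside the product by congruence.\<close>
  also have "red_mat p (M * ((M' * J) * (Q * A')) + M * M' * Q') =
      red_mat p (M * (1\<^sub>m m * (Q * A')) + M * M' * Q')"
  proof -
    have QA: "Q * A' \<in> carrier_mat m n" and MM: "M * M' * Q' \<in> carrier_mat m n" and MJ: "M' * J \<in> carrier_mat m m"
      using c by (metis mult_carrier_mat)+
    have "red_mat p (M' * J * (Q * A')) = red_mat p (1\<^sub>m m * (Q * A'))"
      by (rule red_mat_mult_cong[OF MJ _ QA QA]) (use J p in \<open>auto simp: red_mat_one\<close>)
    then have "red_mat p (M * (M' * J * (Q * A'))) = red_mat p (M * (1\<^sub>m m * (Q * A')))"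
      by (rule red_mat_mult_cong[OF c(2) c(2) mult_carrier_mat[OF MJ QA] mult_carrier_mat[OF one_carrier_mat QA] refl])
    then show ?thesis
      by (rule red_mat_add_cong[OF mult_carrier_mat[OF c(2) mult_carrier_mat[OF MJ QA]]
          mult_carrier_mat[OF c(2) mult_carrier_mat[OF one_carrier_mat QA]] MM MM _ refl])
  qed
  also have "M * (1\<^sub>m m * (Q * A')) + M * M' * Q' = M * Q * A' + M * (M' * Q')"
    using c by (simp add: left_mult_one_mat[of _ m n] assoc_mult_mat[of _ m m _ n _ n]
        assoc_mult_mat[of _ m m _ m _ n])
  finally have low: "red_mat p (red_mat p (M * M') * U) = red_mat p (M * Q * A' + M * (M' * Q'))" .
  have prod: "blk n m x * blk n m y =
      four_block_mat (A * A') (0\<^sub>m n m) (M * Q * A' + M * (M' * Q')) (M * M')"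
    unfolding xy blk_def using c
    by (simp add: mult_four_block_mat[of A n n _ m "M * Q" m M A' n _ m "M' * Q'"])
  have MU: "red_mat p (M * M') * U \<in> carrier_mat m n"
    by (rule mult_carrier_mat[OF _ U(1)]) (use c in simp)
  show ?thesis
    unfolding prod unfolding xy mult_matrix_semidirect blk_def fp_mat_mult_def J_def[symmetric] prod.case
      U_def[symmetric]
    using c U low MU
    by (simp add: red_mat_four_block_mat[of _ n n _ m _ m])
qed

lemma blk_right_inverse:
  assumes p: "p > 1" and x: "x \<in> carrier (matrix_semidirect p n m)"
  shows "\<exists>B'\<in>carrier_mat (n + m) (n + m). (\<forall>i j. i < n \<longrightarrow> n \<le> j \<longrightarrow> j < n + m \<longrightarrow> B' $$ (i, j) = 0) \<and>
    red_mat p (blk n m x * B') = 1\<^sub>m (n + m)"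
proof -
  obtain A M Q where xy: "x = ((A, M), Q)" by (metis surj_pair)
  have *: "A \<in> carrier (GL p n)" "M \<in> carrier (GL p m)" "Q \<in> fp_mat p m n"
    using x unfolding xy by (auto simp: carrier_matrix_semidirect)
  define I J where "I = inv\<^bsub>GL p n\<^esub> A" and "J = inv\<^bsub>GL p m\<^esub> M"
  have c: "A \<in> carrier_mat n n" "M \<in> carrier_mat m m" "Q \<in> carrier_mat m n" "I \<in> carrier_mat n n" "J \<in> carrier_mat m m"
    using * GL_inv(1)[OF p *(1)] GL_inv(1)[OF p *(2)] by (auto simp: I_def J_def dest!: GL_fp_mat fp_mat_carrier)
  \<comment> \<open>The inverse unipotent factor followed by the inverse block diagonal
    factor.\<close>
  define B' where "B' = four_block_mat I (0\<^sub>m n m) (- (Q * I)) J"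
  have "blk n m x * B' = four_block_mat (A * I) (0\<^sub>m n m) (M * Q * I + M * (- (Q * I))) (M * J)"
    unfolding xy blk_def B'_def using c
    by (simp add: mult_four_block_mat[of A n n _ m "M * Q" m M I n _ m "- (Q * I)"] uminus_zero_mat)
  also have "M * Q * I + M * (- (Q * I)) = 0\<^sub>m m n"
  proof -
    have "M * (Q * I) \<in> carrier_mat m n" using c by (metis mult_carrier_mat)
    then have "M * (Q * I) + - (M * (Q * I)) = 0\<^sub>m m n" by (rule add_uminus_mat)
    then show ?thesis using c by simp
  qed
  finally have prod: "blk n m x * B' = four_block_mat (A * I) (0\<^sub>m n m) (0\<^sub>m m n) (M * J)" .
  have "red_mat p (A * I) = 1\<^sub>m n" "red_mat p (M * J) = 1\<^sub>m m"
    using GL_inv(2)[OF p *(1)] GL_inv(2)[OF p *(2)] by (simp_all add: I_def J_def)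
  then have "red_mat p (blk n m x * B') = 1\<^sub>m (n + m)"
    unfolding prod
    using red_mat_four_block_mat[OF mult_carrier_mat[OF c(1,4)] zero_carrier_mat zero_carrier_mat
        mult_carrier_mat[OF c(2,5)], of p] by simp
  moreover have "B' \<in> carrier_mat (n + m) (n + m)" using c by (simp add: B'_def)
  moreover have "B' $$ (i, j) = 0" if "i < n" "n \<le> j" "j < n + m" for i j
    using that c by (auto simp: B'_def)
  ultimately show ?thesis by blast
qed

lemma blk_inj:
  assumes p: "p > 1" and x: "x \<in> carrier (matrix_semidirect p n m)" and y: "y \<in> carrier (matrix_semidirect p n m)"
    and eq: "red_mat p (blk n m x) = red_mat p (blk n m y)"
  shows "x = y"
proof -
  obtain A M Q where "x = ((A, M), Q)" by (metis surj_pair)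
  moreover obtain A' M' Q' where "y = ((A', M'), Q')" by (metis surj_pair)
  ultimately have xy: "x = ((A, M), Q)" "y = ((A', M'), Q')" by simp_all
  have *: "A \<in> carrier (GL p n)" "M \<in> carrier (GL p m)" "Q \<in> fp_mat p m n"
    "A' \<in> carrier (GL p n)" "M' \<in> carrier (GL p m)" "Q' \<in> fp_mat p m n"
    using x y unfolding xy by (auto simp: carrier_matrix_semidirect)
  have c: "A \<in> carrier_mat n n" "M \<in> carrier_mat m m" "Q \<in> carrier_mat m n"
    "A' \<in> carrier_mat n n" "M' \<in> carrier_mat m m" "Q' \<in> carrier_mat m n"
    using * by (auto dest!: GL_fp_mat fp_mat_carrier)
  define J where "J = inv\<^bsub>GL p m\<^esub> M"
  have J: "red_mat p (J * M) = 1\<^sub>m m" "J \<in> carrier_mat m m"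
    using GL_inv[OF p *(2)] by (auto simp: J_def dest!: GL_fp_mat fp_mat_carrier)
  have "four_block_mat (red_mat p A) (0\<^sub>m n m) (red_mat p (M * Q)) (red_mat p M) =
      four_block_mat (red_mat p A') (0\<^sub>m n m) (red_mat p (M' * Q')) (red_mat p M')"
    using eq c by (simp add: xy blk_def red_mat_four_block_mat[of _ n n _ m _ m])
  then have "red_mat p A = red_mat p A' \<and> red_mat p (M * Q) = red_mat p (M' * Q') \<and> red_mat p M = red_mat p M'"
    using four_block_mat_inj[of "red_mat p A" n n "0\<^sub>m n m" m "red_mat p (M * Q)" m "red_mat p M"
        "red_mat p A'" "0\<^sub>m n m" "red_mat p (M' * Q')" "red_mat p M'"] c by simp
  then have r: "red_mat p A = red_mat p A'" "red_mat p (M * Q) = red_mat p (M' * Q')" "red_mat p M = red_mat p M'"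
    by auto
  have p0: "p > 0" using p by simp
  have A: "A = A'" by (rule fp_mat_eqI[OF p0 GL_fp_mat[OF *(1)] GL_fp_mat[OF *(4)] r(1)])
  have M: "M = M'" by (rule fp_mat_eqI[OF p0 GL_fp_mat[OF *(2)] GL_fp_mat[OF *(5)] r(3)])
  have MQ: "red_mat p (M * Q) = red_mat p (M * Q')" using r(2) unfolding M .
  have Qr: "red_mat p R = red_mat p (J * (M * R))" if R: "R \<in> carrier_mat m n" for R
  proof -
    have "red_mat p (J * M * R) = red_mat p (1\<^sub>m m * R)"
      by (rule red_mat_mult_cong[OF mult_carrier_mat[OF J(2) c(2)] one_carrier_mat R R _ refl])
        (use J p in \<open>simp add: red_mat_one\<close>)
    then show ?thesis using R c J by (simp add: assoc_mult_mat[of J m m M m R n] left_mult_one_mat[of R m n])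
  qed
  have "red_mat p Q = red_mat p Q'"
    unfolding Qr[OF c(3)] Qr[OF c(6)]
    by (rule red_mat_mult_cong[OF J(2) J(2) mult_carrier_mat[OF c(2,3)] mult_carrier_mat[OF c(2,6)] refl MQ])
  then have "Q = Q'" by (rule fp_mat_eqI[OF p0 *(3) *(6)])
  then show ?thesis using A M xy by simp
qed

text \<open>The inverse is required to be block triangular too: then diagonal blocks multiply
  separately and those of \<open>B\<close> and \<open>B'\<close> are mutually inverse.\<close>

lemma ex_blk:
  assumes p: "p > 1" and B: "B \<in> carrier_mat (n + m) (n + m)" "B' \<in> carrier_mat (n + m) (n + m)"
    and up: "\<And>i j. i < n \<Longrightarrow> n \<le> j \<Longrightarrow> j < n + m \<Longrightarrow> B $$ (i, j) = 0"
      "\<And>i j. i < n \<Longrightarrow> n \<le> j \<Longrightarrow> j < n + m \<Longrightarrow> B' $$ (i, j) = 0"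
    and inv: "red_mat p (B * B') = 1\<^sub>m (n + m)" "red_mat p (B' * B) = 1\<^sub>m (n + m)"
  shows "\<exists>x\<in>carrier (matrix_semidirect p n m). red_mat p (blk n m x) = red_mat p B"
proof -
  define tl where "tl X = mat n n (\<lambda>(i, j). X $$ (i, j))" for X :: "int mat"
  define br where "br X = mat m m (\<lambda>(i, j). X $$ (n + i, n + j))" for X :: "int mat"
  define bl where "bl X = mat m n (\<lambda>(i, j). X $$ (n + i, j))" for X :: "int mat"
  have c: "tl X \<in> carrier_mat n n" "br X \<in> carrier_mat m m" "bl X \<in> carrier_mat m n" for X
    by (simp_all add: tl_def br_def bl_def)
  have split: "X = four_block_mat (tl X) (0\<^sub>m n m) (bl X) (br X)"
    if "X \<in> carrier_mat (n + m) (n + m)" "\<And>i j. i < n \<Longrightarrow> n \<le> j \<Longrightarrow> j < n + m \<Longrightarrow> X $$ (i, j) = 0" for X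
    using that by (intro eq_matI) (auto simp: tl_def br_def bl_def)
  have inv': "red_mat p (tl X * tl Y) = 1\<^sub>m n" "red_mat p (br X * br Y) = 1\<^sub>m m"
    if X: "X \<in> carrier_mat (n + m) (n + m)" "\<And>i j. i < n \<Longrightarrow> n \<le> j \<Longrightarrow> j < n + m \<Longrightarrow> X $$ (i, j) = 0"
      and Y: "Y \<in> carrier_mat (n + m) (n + m)" "\<And>i j. i < n \<Longrightarrow> n \<le> j \<Longrightarrow> j < n + m \<Longrightarrow> Y $$ (i, j) = 0"
      and XY: "red_mat p (X * Y) = 1\<^sub>m (n + m)" for X Y
  proof -
    have "X * Y = four_block_mat (tl X * tl Y) (0\<^sub>m n m) (bl X * tl Y + br X * bl Y) (br X * br Y)"
    proof -
      have "X * Y = four_block_mat (tl X) (0\<^sub>m n m) (bl X) (br X) * four_block_mat (tl Y) (0\<^sub>m n m) (bl Y) (br Y)"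
        by (rule arg_cong2[OF split[OF X] split[OF Y]])
      also have "\<dots> = four_block_mat (tl X * tl Y + 0\<^sub>m n m * bl Y) (tl X * 0\<^sub>m n m + 0\<^sub>m n m * br Y)
          (bl X * tl Y + br X * bl Y) (bl X * 0\<^sub>m n m + br X * br Y)"
        by (rule mult_four_block_mat[OF c(1) zero_carrier_mat c(3,2) c(1) zero_carrier_mat c(3,2)])
      finally show ?thesis
        using left_mult_zero_mat[OF c(3)] right_mult_zero_mat[OF c(1)] left_mult_zero_mat[OF c(2)]
          right_mult_zero_mat[OF c(3)] mult_carrier_mat[OF c(1) c(1)] mult_carrier_mat[OF c(2) c(2)]
        by simp
    qed
    then have "four_block_mat (red_mat p (tl X * tl Y)) (0\<^sub>m n m)
        (red_mat p (bl X * tl Y + br X * bl Y)) (red_mat p (br X * br Y)) =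
        four_block_mat (1\<^sub>m n) (0\<^sub>m n m) (0\<^sub>m m n) (1\<^sub>m m)"
      using XY mult_carrier_mat[OF c(1) c(1)] mult_carrier_mat[OF c(2) c(2)] mult_carrier_mat[OF c(3) c(1)]
        mult_carrier_mat[OF c(2) c(3)]
      by (simp add: red_mat_four_block_mat[of _ n n _ m _ m])
    note four_block_mat_inj[OF _ _ _ _ _ _ _ _ this, of n n m m]
    then show "red_mat p (tl X * tl Y) = 1\<^sub>m n" "red_mat p (br X * br Y) = 1\<^sub>m m"
      using mult_carrier_mat[OF c(1) c(1)] mult_carrier_mat[OF c(2) c(2)] mult_carrier_mat[OF c(3) c(1)]
        mult_carrier_mat[OF c(2) c(3)] by simp_all
  qed
  note 1 = inv'[OF B(1) up(1) B(2) up(2) inv(1)] and 2 = inv'[OF B(2) up(2) B(1) up(1) inv(2)]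
  define A M J where "A = red_mat p (tl B)" and "M = red_mat p (br B)" and "J = red_mat p (br B')"
  have fp: "A \<in> fp_mat p n n" "M \<in> fp_mat p m m" "J \<in> fp_mat p m m" "red_mat p (tl B') \<in> fp_mat p n n"
    using p c by (auto simp: A_def M_def J_def intro: red_mat_fp_mat)
  have rr: "red_mat p (red_mat p X * red_mat p Y) = red_mat p (X * Y)"
    if "X \<in> carrier_mat k k" "Y \<in> carrier_mat k k" for X Y k
    using that by (intro red_mat_mult_cong[of _ k k _ _ k]) auto
  have A: "A \<in> carrier (GL p n)"
    unfolding carrier_GL using fp 1 2 rr[OF c(1) c(1)]
    by (auto simp: fp_mat_mult_def A_def intro!: bexI[of _ "red_mat p (tl B')"])
  have MJ: "red_mat p (M * J) = 1\<^sub>m m" "red_mat p (J * M) = 1\<^sub>m m"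
    using 1 2 rr[OF c(2) c(2)] by (simp_all add: M_def J_def)
  then have M: "M \<in> carrier (GL p m)"
    unfolding carrier_GL using fp by (auto simp: fp_mat_mult_def intro!: bexI[of _ J])
  \<comment> \<open>Solves \<open>M * Q = bl B\<close> modulo \<open>p\<close>, because
    \<open>blk\<close> stores \<open>M * Q\<close>.\<close>
  define Q where "Q = red_mat p (J * bl B)"
  note mc = fp_mat_carrier[OF fp(2)] fp_mat_carrier[OF fp(3)]
  have Q: "Q \<in> fp_mat p m n" unfolding Q_def using p mc c by (intro red_mat_fp_mat) auto
  have "red_mat p (M * Q) = red_mat p (M * (J * bl B))"
    unfolding Q_def by (rule red_mat_mult_right[OF mc(1) mult_carrier_mat[OF mc(2) c(3)]])
  also have "M * (J * bl B) = M * J * bl B"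
    by (rule assoc_mult_mat[OF mc c(3), symmetric])
  also have "red_mat p \<dots> = red_mat p (1\<^sub>m m * bl B)"
    by (rule red_mat_mult_cong[OF mult_carrier_mat[OF mc] one_carrier_mat c(3) c(3) _ refl])
      (use MJ p in \<open>simp add: red_mat_one\<close>)
  also have "1\<^sub>m m * bl B = bl B" by (rule left_mult_one_mat[OF c(3)])
  finally have MQ: "red_mat p (M * Q) = red_mat p (bl B)" .
  have "red_mat p (blk n m ((A, M), Q)) = four_block_mat (red_mat p A) (0\<^sub>m n m) (red_mat p (M * Q)) (red_mat p M)"
    unfolding blk_def using fp_mat_carrier[OF fp(1)] mc fp_mat_carrier[OF Q]
    by (simp add: red_mat_four_block_mat[of _ n n _ m _ m])
  also have "\<dots> = four_block_mat (red_mat p (tl B)) (red_mat p (0\<^sub>m n m)) (red_mat p (bl B)) (red_mat p (br B))"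
    unfolding MQ by (simp add: A_def M_def)
  also have "\<dots> = red_mat p (four_block_mat (tl B) (0\<^sub>m n m) (bl B) (br B))"
    by (rule red_mat_four_block_mat[OF c(1) zero_carrier_mat c(3,2), symmetric])
  finally have "red_mat p (blk n m ((A, M), Q)) = red_mat p B"
    by (simp only: split[OF B(1) up(1), symmetric])
  moreover have "((A, M), Q) \<in> carrier (matrix_semidirect p n m)"
    using A M Q by (simp add: carrier_matrix_semidirect)
  ultimately show ?thesis by blast
qed

section \<open>The complement as a group of matrices\<close>

text \<open>Closure of the source puts the product of two preimages where \<open>h\<close> is
  injective.\<close>

lemma iso_inv_into:
  assumes "h \<in> iso G G'" "\<And>x y. x \<in> carrier G \<Longrightarrow> y \<in> carrier G \<Longrightarrow> x \<otimes>\<^bsub>G\<^esub> y \<in> carrier G"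
  shows "inv_into (carrier G) h \<in> iso G' G"
proof -
  let ?k = "inv_into (carrier G) h"
  have bij: "bij_betw h (carrier G) (carrier G')" and hom: "h \<in> hom G G'" using assms(1) by (auto simp: iso_def)
  have k: "?k x \<in> carrier G" "h (?k x) = x" if "x \<in> carrier G'" for x
    using that bij bij_betwE[OF bij_betw_inv_into[OF bij]] by (auto simp: bij_betw_inv_into_right)
  have "?k (x \<otimes>\<^bsub>G'\<^esub> y) = ?k x \<otimes>\<^bsub>G\<^esub> ?k y" if xy: "x \<in> carrier G'" "y \<in> carrier G'" for x y
  proof -
    have "h (?k x \<otimes>\<^bsub>G\<^esub> ?k y) = x \<otimes>\<^bsub>G'\<^esub> y" using hom k xy by (simp add: hom_mult)
    then show ?thesis
      using bij_betw_inv_into_left[OF bij assms(2)[OF k(1)[OF xy(1)] k(1)[OF xy(2)]]] by simp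
  qed
  then have "?k \<in> hom G' G" using k by (intro homI) auto
  then show ?thesis using bij_betw_inv_into[OF bij] by (simp add: iso_def)
qed

context p_lattice
begin

text \<open>Row vector times matrix on lifted coordinates. On \<open>L\<close> the entries of
  \<open>B\<close> count modulo \<open>p * p\<close>, on \<open>Z\<close> only modulo
  \<open>p\<close>.\<close>

definition row_act :: "int mat \<Rightarrow> 'v \<Rightarrow> 'v" where
  "row_act B x = pnt (\<lambda>j. \<Sum>i<N. co x i * B $$ (i, j))"

definition up0 :: "int mat \<Rightarrow> bool" where
  "up0 B \<longleftrightarrow> (\<forall>i j. i < n \<longrightarrow> n \<le> j \<longrightarrow> j < N \<longrightarrow> B $$ (i, j) = 0)"

lemma pnt_L: "(\<And>i. n \<le> i \<Longrightarrow> i < N \<Longrightarrow> int p dvd u i) \<Longrightarrow> pnt u \<in> L"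
  unfolding L_def lat_def by (rule imageI) auto

lemma row_act_L:
  assumes x: "x \<in> L" and B: "up0 B" shows "row_act B x \<in> L"
  unfolding row_act_def
proof (rule pnt_L)
  fix j assume j: "n \<le> j" "j < N"
  show "int p dvd (\<Sum>i<N. co x i * B $$ (i, j))"
  proof (rule dvd_sum)
    fix i assume "i \<in> {..<N}"
    \<comment> \<open>For \<open>i < n\<close> the matrix entry is 0; for the other \<open>i\<close>
      the coordinate of \<open>x\<close> is divisible by \<open>p\<close>.\<close>
    then show "int p dvd co x i * B $$ (i, j)"
      using B j co_dvd[OF x, of i] by (cases "i < n") (auto simp: up0_def)
  qed
qed

lemma row_act_add:
  assumes "x \<in> L" "y \<in> L" shows "row_act B (x + y) = row_act B x + row_act B y"
proof -
  have "[(\<Sum>i<N. co (x + y) i * B $$ (i, j)) = (\<Sum>i<N. (co x i + co y i) * B $$ (i, j))] (mod (int p * int p))" for j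
    by (intro cong_sum cong_mult cong_refl co_add2 assms) simp
  then show ?thesis
    unfolding row_act_def pnt_add pnt_eq_iff by (simp add: distrib_right sum.distrib)
qed

lemma Z_pnt: "z \<in> Z \<Longrightarrow> \<exists>b. z = pnt (\<lambda>j. int p * b j)"
proof -
  assume "z \<in> Z"
  then obtain u where u: "z = pnt u" "\<forall>i<N. int p dvd u i" by (auto simp: Z_def lat_def)
  have "z = pnt (\<lambda>j. int p * (u j div int p))" unfolding u(1) pnt_eq_iff using u(2) by simp
  then show ?thesis by (rule exI[of _ "\<lambda>j. u j div int p"])
qed

lemma pnt_p_Z: "pnt (\<lambda>j. int p * b j) \<in> Z"
  unfolding Z_def lat_def by (rule imageI) auto

lemma pnt_p_eq_iff:
  "pnt (\<lambda>j. int p * b j) = pnt (\<lambda>j. int p * b' j) \<longleftrightarrow> (\<forall>j<N. [b j = b' j] (mod int p))"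
  using p_gt_0 by (simp add: pnt_eq_iff cong_iff_dvd_diff flip: right_diff_distrib)

lemma row_act_pnt_p: "row_act B (pnt (\<lambda>j. int p * b j)) = pnt (\<lambda>j. int p * (\<Sum>i<N. b i * B $$ (i, j)))"
proof -
  have "[(\<Sum>i<N. co (pnt (\<lambda>j. int p * b j)) i * B $$ (i, j)) = (\<Sum>i<N. (int p * b i) * B $$ (i, j))] (mod (int p * int p))" for j
    by (intro cong_sum cong_mult cong_refl co_pnt Z_L pnt_p_Z) simp
  then show ?thesis
    unfolding row_act_def pnt_eq_iff by (simp add: sum_distrib_left mult.assoc)
qed

lemma eps_pnt_p: "eps i = pnt (\<lambda>j. int p * (if j = i then 1 else 0))"
  unfolding eps_def by (rule arg_cong[of _ _ pnt]) auto

lemma row_act_eps: "i < N \<Longrightarrow> row_act B (eps i) = pnt (\<lambda>j. int p * B $$ (i, j))"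
  unfolding eps_pnt_p row_act_pnt_p by (rule arg_cong[of _ _ pnt]) (simp add: if_distrib[of "\<lambda>x. x * _"] cong: if_cong)

lemma row_act_Z:
  assumes "z \<in> Z" shows "row_act B z \<in> Z"
proof -
  obtain b where b: "z = pnt (\<lambda>j. int p * b j)" using Z_pnt[OF assms] by blast
  show ?thesis unfolding b row_act_pnt_p by (rule pnt_p_Z)
qed

lemma row_act_mult:
  assumes B: "B \<in> carrier_mat N N" "B' \<in> carrier_mat N N" and z: "z \<in> Z"
  shows "row_act B' (row_act B z) = row_act (B * B') z"
proof -
  obtain b where b: "z = pnt (\<lambda>j. int p * b j)" using Z_pnt[OF z] by blast
  have "(\<Sum>k<N. (\<Sum>i<N. b i * B $$ (i, k)) * B' $$ (k, j)) = (\<Sum>i<N. b i * (B * B') $$ (i, j))" if "j < N" for j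
  proof -
    have "(\<Sum>k<N. (\<Sum>i<N. b i * B $$ (i, k)) * B' $$ (k, j)) = (\<Sum>k<N. \<Sum>i<N. b i * (B $$ (i, k) * B' $$ (k, j)))"
      by (simp add: sum_distrib_right mult.assoc)
    also have "\<dots> = (\<Sum>i<N. \<Sum>k<N. b i * (B $$ (i, k) * B' $$ (k, j)))" by (rule sum.swap)
    also have "\<dots> = (\<Sum>i<N. b i * (B * B') $$ (i, j))"
      using that by (intro sum.cong refl) (simp add: mult_mat_index[OF B] sum_distrib_left)
    finally show ?thesis .
  qed
  then show ?thesis unfolding b row_act_pnt_p pnt_p_eq_iff by simp
qed

text \<open>In the basis \<open>eps\<close> the rows of the reduced matrix are the images of the
  basis vectors.\<close>

lemma row_act_eq_iff:
  assumes B: "B \<in> carrier_mat N N" "B' \<in> carrier_mat N N"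
  shows "(\<forall>z\<in>Z. row_act B z = row_act B' z) \<longleftrightarrow> red_mat p B = red_mat p B'"
proof
  assume "\<forall>z\<in>Z. row_act B z = row_act B' z"
  then have *: "row_act B (eps i) = row_act B' (eps i)" for i by blast
  have "[B $$ (i, j) = B' $$ (i, j)] (mod int p)" if "i < N" "j < N" for i j
    using *[of i] that unfolding row_act_eps[OF that(1)] pnt_p_eq_iff by blast
  then show "red_mat p B = red_mat p B'" by (simp add: red_mat_eq_iff[OF B])
next
  assume eq: "red_mat p B = red_mat p B'"
  show "\<forall>z\<in>Z. row_act B z = row_act B' z"
  proof
    fix z assume "z \<in> Z"
    then obtain b where b: "z = pnt (\<lambda>j. int p * b j)" using Z_pnt by blast
    show "row_act B z = row_act B' z"
      unfolding b row_act_pnt_p pnt_p_eq_iff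
      using eq by (auto simp: red_mat_eq_iff[OF B] intro!: cong_sum cong_mult)
  qed
qed

lemma row_act_one: "z \<in> Z \<Longrightarrow> row_act (1\<^sub>m N) z = z"
proof -
  assume "z \<in> Z"
  then obtain b where b: "z = pnt (\<lambda>j. int p * b j)" using Z_pnt by blast
  have "(\<Sum>i<N. b i * 1\<^sub>m N $$ (i, j)) = b j" if "j < N" for j
  proof -
    have "(\<Sum>i<N. b i * 1\<^sub>m N $$ (i, j)) = (\<Sum>i<N. if i = j then b i else 0)"
      using that by (intro sum.cong) auto
    then show ?thesis using that by simp
  qed
  then show ?thesis unfolding b row_act_pnt_p pnt_p_eq_iff by simp
qed

abbreviation mm :: nat where "mm \<equiv> N - n"
abbreviation MS :: "((int mat \<times> int mat) \<times> int mat) monoid" where "MS \<equiv> matrix_semidirect p n mm"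
abbreviation bl :: "(int mat \<times> int mat) \<times> int mat \<Rightarrow> int mat" where "bl \<equiv> blk n mm"

lemma n_mm: "n + mm = N" using nN by simp

lemma p1: "p > 1" using prime prime_gt_1_nat by blast

lemma bl_carrier: "x \<in> carrier MS \<Longrightarrow> bl x \<in> carrier_mat N N"
  using blk_carrier[of x p n mm] by (simp add: n_mm)

lemma bl_up0: "x \<in> carrier MS \<Longrightarrow> up0 (bl x)"
  unfolding up0_def using blk_upper[of x p n mm] by (simp add: n_mm)

definition lift :: "(int mat \<times> int mat) \<times> int mat \<Rightarrow> 'v \<Rightarrow> 'v" where
  "lift x = restrict (row_act (bl x)) L"

lemma lift_Khat:
  assumes x: "x \<in> carrier MS"
  shows "lift x \<in> Khat" and "\<And>z. z \<in> Z \<Longrightarrow> ctr (lift x) z = row_act (bl x) z"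
proof -
  obtain B' where B': "B' \<in> carrier_mat N N" "red_mat p (bl x * B') = 1\<^sub>m N"
    using blk_right_inverse[OF p1 x] by (auto simp: n_mm)
  \<comment> \<open>A right inverse matrix is a left inverse of the action on rows, which gives
    injectivity on \<open>Z\<close>.\<close>
  have id: "row_act B' (row_act (bl x) z) = z" if z: "z \<in> Z" for z
  proof -
    have "row_act (bl x * B') z = row_act (1\<^sub>m N) z"
      using row_act_eq_iff[of "bl x * B'" "1\<^sub>m N"] mult_carrier_mat[OF bl_carrier[OF x] B'(1)] B'(2) z p1
      by (simp add: red_mat_one)
    then show ?thesis using row_act_mult[OF bl_carrier[OF x] B'(1) z] row_act_one[OF z] by simp
  qed
  have B'0: "row_act B' 0 = 0" using row_act_add[of 0 0 B'] by simp
  have bij: "bij_betw (row_act (bl x)) L L"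
  proof (rule additive_bij[OF row_act_L[OF _ bl_up0[OF x]] row_act_add])
    fix z assume "z \<in> Z" "row_act (bl x) z = 0"
    then show "z = 0" using id[of z] B'0 by simp
  qed auto
  show "lift x \<in> Khat" unfolding lift_def by (rule additive_Khat(1)[OF bij row_act_add])
  show "ctr (lift x) z = row_act (bl x) z" if "z \<in> Z" for z
    unfolding lift_def by (rule additive_Khat(2)[OF bij row_act_add]) (use that in auto)
qed

lemma rcos_lift_eq_iff:
  assumes "x \<in> carrier MS" "\<phi> \<in> Khat"
  shows "rcos (lift x) = rcos \<phi> \<longleftrightarrow> (\<forall>z\<in>Z. row_act (bl x) z = ctr \<phi> z)"
  using rcos_Khat_eq_iff[OF lift_Khat(1)[OF assms(1)] assms(2)] lift_Khat(2)[OF assms(1)] by simp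

text \<open>The matrix of the action on \<open>Z\<close> in the basis \<open>eps\<close>.
  Coordinates of elements of \<open>Z\<close> carry a factor \<open>p\<close>, which the division
  removes.\<close>

definition mat_of :: "('v \<Rightarrow> 'v) \<Rightarrow> int mat" where
  "mat_of \<phi> = mat N N (\<lambda>(i, j). (co (ctr \<phi> (eps i)) j div int p) mod int p)"

lemma mat_of_carrier: "mat_of \<phi> \<in> carrier_mat N N"
  by (simp add: mat_of_def)

lemma row_act_mat_of:
  assumes \<phi>: "\<phi> \<in> NH" and z: "z \<in> Z" shows "row_act (mat_of \<phi>) z = ctr \<phi> z"
proof (rule Z_induct[OF z])
  show "row_act (mat_of \<phi>) 0 = ctr \<phi> 0" using row_act_add[of 0 0 "mat_of \<phi>"] by simp
next
  fix z i assume z: "z \<in> Z" and IH: "row_act (mat_of \<phi>) z = ctr \<phi> z" and i: "i < N"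
  have Zi: "ctr \<phi> (eps i) \<in> Z" using \<phi> by blast
  have "row_act (mat_of \<phi>) (eps i) = pnt (\<lambda>j. int p * mat_of \<phi> $$ (i, j))" by (rule row_act_eps[OF i])
  also have "\<dots> = pnt (\<lambda>j. int p * (co (ctr \<phi> (eps i)) j div int p))"
    unfolding pnt_p_eq_iff using i by (simp add: mat_of_def)
  also have "\<dots> = pnt (co (ctr \<phi> (eps i)))"
    unfolding pnt_eq_iff using co_dvd_Z[OF Zi] by simp
  also have "\<dots> = ctr \<phi> (eps i)" by (rule pnt_co[OF Z_L[OF Zi]])
  finally show "row_act (mat_of \<phi>) (z + eps i) = ctr \<phi> (z + eps i)"
    using ctr_add_Z[OF \<phi> Z_L[OF z] eps_Z[of i]] row_act_add[OF Z_L[OF z] Z_L[OF eps_Z[of i]]] IH by simp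
qed

text \<open>\<open>eps i\<close> is p times \<open>e i\<close> for \<open>i < n\<close>, so its
  image is p times an element of \<open>L\<close>, whose coordinates from \<open>n\<close> on are 0
  modulo \<open>p * p\<close>.\<close>

lemma mat_of_up0:
  assumes \<phi>: "\<phi> \<in> NH" shows "i < n \<Longrightarrow> n \<le> j \<Longrightarrow> j < N \<Longrightarrow> mat_of \<phi> $$ (i, j) = 0"
proof -
  assume ij: "i < n" "n \<le> j" "j < N"
  let ?y = "ctr \<phi> (e i)"
  have y: "?y \<in> L" using \<phi> ij by blast
  have "ctr \<phi> (eps i) = int p *\<^sub>Z ?y" using ctr_p[OF \<phi> e_L[OF ij(1)]] by (simp add: p_e)
  also have "\<dots> = pnt (\<lambda>j. int p * co ?y j)" using pnt_co[OF y] pnt_scale[of "int p" "co ?y"] by simp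
  finally have eq: "ctr \<phi> (eps i) = pnt (\<lambda>j. int p * co ?y j)" .
  then have "[co (ctr \<phi> (eps i)) j = int p * co ?y j] (mod (int p * int p))"
    using co_pnt[of "\<lambda>j. int p * co ?y j" j] Z_L[OF pnt_p_Z[of "co ?y"]] ij by simp
  moreover have "int p * int p dvd int p * co ?y j" using co_dvd[OF y ij(2,3)] by simp
  ultimately have "int p * int p dvd co (ctr \<phi> (eps i)) j" by (simp add: cong_dvd_iff)
  then obtain k where "co (ctr \<phi> (eps i)) j = int p * (int p * k)" by (auto simp: dvd_def mult.assoc)
  then show ?thesis using ij p_gt_0 by (simp add: mat_of_def)
qed

lemma mat_of_inv:
  assumes \<phi>: "\<phi> \<in> NH" shows "red_mat p (mat_of \<phi> * mat_of (inv\<^bsub>NHg\<^esub> \<phi>)) = 1\<^sub>m N"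
    "red_mat p (mat_of (inv\<^bsub>NHg\<^esub> \<phi>) * mat_of \<phi>) = 1\<^sub>m N"
proof -
  have *: "red_mat p (mat_of \<phi> * mat_of \<psi>) = 1\<^sub>m N"
    if "\<phi> \<in> NH" "\<psi> \<in> NH" and inv: "\<And>z. z \<in> Z \<Longrightarrow> ctr \<psi> (ctr \<phi> z) = z" for \<phi> \<psi>
  proof -
    have "row_act (mat_of \<phi> * mat_of \<psi>) z = row_act (1\<^sub>m N) z" if z: "z \<in> Z" for z
      using row_act_mult[OF mat_of_carrier[of \<phi>] mat_of_carrier[of \<psi>] z] row_act_mat_of[OF \<open>\<phi> \<in> NH\<close> z]
        row_act_mat_of[OF \<open>\<psi> \<in> NH\<close> ctr_Z[OF \<open>\<phi> \<in> NH\<close> z]] inv[OF z] row_act_one[OF z] by simp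
    then show ?thesis
      using row_act_eq_iff[of "mat_of \<phi> * mat_of \<psi>" "1\<^sub>m N"] mult_carrier_mat[OF mat_of_carrier mat_of_carrier] p1
      by (simp add: red_mat_one)
  qed
  show "red_mat p (mat_of \<phi> * mat_of (inv\<^bsub>NHg\<^esub> \<phi>)) = 1\<^sub>m N"
    by (rule *[OF \<phi> inv_NH[OF \<phi>] ctr_inv_right[OF \<phi>]])
  show "red_mat p (mat_of (inv\<^bsub>NHg\<^esub> \<phi>) * mat_of \<phi>) = 1\<^sub>m N"
    by (rule *[OF inv_NH[OF \<phi>] \<phi> ctr_inv_left[OF \<phi>]])
qed

lemma lift_surj:
  assumes \<phi>: "\<phi> \<in> Khat" shows "\<exists>x\<in>carrier MS. rcos (lift x) = rcos \<phi>"
proof -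
  have N: "\<phi> \<in> NH" using \<phi> Khat_NH by blast
  obtain x where x: "x \<in> carrier MS" "red_mat p (bl x) = red_mat p (mat_of \<phi>)"
    using ex_blk[OF p1, of "mat_of \<phi>" n mm "mat_of (inv\<^bsub>NHg\<^esub> \<phi>)"] mat_of_carrier mat_of_up0[OF N]
      mat_of_up0[OF inv_NH[OF N]] mat_of_inv[OF N] by (auto simp: n_mm)
  have "\<forall>z\<in>Z. row_act (bl x) z = row_act (mat_of \<phi>) z"
    using row_act_eq_iff[OF bl_carrier[OF x(1)] mat_of_carrier] x(2) by blast
  then have "rcos (lift x) = rcos \<phi>"
    using rcos_lift_eq_iff[OF x(1) \<phi>] row_act_mat_of[OF N] by simp
  then show ?thesis using x(1) by blast
qed

text \<open>Products of block matrices agree with \<open>bl\<close> of the product only modulo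
  \<open>p\<close>, so \<open>lift\<close> is multiplicative up to maps trivial on \<open>Z\<close>;
  inside \<open>Khat\<close> these form \<open>H\<close>.\<close>

lemma complement_iso:
  defines "T \<equiv> NHg Mod H"
  shows "T\<lparr>carrier := rcos ` Khat\<rparr> \<cong> matrix_semidirect p n (N - n)"
proof -
  have mult: "rcos (lift (x \<otimes>\<^bsub>MS\<^esub> y)) = rcos (lift x) <#>\<^bsub>NHg\<^esub> rcos (lift y)"
    if x: "x \<in> carrier MS" and y: "y \<in> carrier MS" for x y
  proof -
    have xy: "x \<otimes>\<^bsub>MS\<^esub> y \<in> carrier MS" by (rule matrix_semidirect_closed[OF p1 x y])
    note K = lift_Khat(1)[OF x] lift_Khat(1)[OF y]
    note Nx = Khat_NH[OF K(1)] and Ny = Khat_NH[OF K(2)]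
    have xyK: "lift x \<otimes>\<^bsub>NHg\<^esub> lift y \<in> Khat"
      using subgroup.m_closed[OF Khat_subgroup K] .
    have "red_mat p (bl (x \<otimes>\<^bsub>MS\<^esub> y)) = red_mat p (bl x * bl y)"
      using blk_mult[OF p1 x y] by simp
    then have "\<forall>z\<in>Z. row_act (bl (x \<otimes>\<^bsub>MS\<^esub> y)) z = row_act (bl x * bl y) z"
      using row_act_eq_iff[OF bl_carrier[OF xy] mult_carrier_mat[OF bl_carrier[OF x] bl_carrier[OF y]]] by blast
    moreover have "row_act (bl x * bl y) z = ctr (lift x \<otimes>\<^bsub>NHg\<^esub> lift y) z" if z: "z \<in> Z" for z
      using z ctr_Z[OF Nx z] by (simp add: ctr_mult[OF Nx Ny] lift_Khat(2) x y row_act_mult[OF bl_carrier[OF x] bl_carrier[OF y]] row_act_Z)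
    ultimately have "rcos (lift (x \<otimes>\<^bsub>MS\<^esub> y)) = rcos (lift x \<otimes>\<^bsub>NHg\<^esub> lift y)"
      using rcos_lift_eq_iff[OF xy xyK] by simp
    also have "\<dots> = rcos (lift x) <#>\<^bsub>NHg\<^esub> rcos (lift y)"
      using normal.rcos_sum[OF H_normal, of "lift x" "lift y"] Nx Ny by simp
    finally show ?thesis .
  qed
  have "(\<lambda>x. rcos (lift x)) \<in> iso MS (T\<lparr>carrier := rcos ` Khat\<rparr>)"
  proof (rule isoI)
    show "(\<lambda>x. rcos (lift x)) \<in> hom MS (T\<lparr>carrier := rcos ` Khat\<rparr>)"
      by (rule homI) (use lift_Khat(1) mult in \<open>auto simp: T_def\<close>)
    have "inj_on (\<lambda>x. rcos (lift x)) (carrier MS)"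
    proof (rule inj_onI)
      fix x y assume x: "x \<in> carrier MS" and y: "y \<in> carrier MS" and "rcos (lift x) = rcos (lift y)"
      then have "\<forall>z\<in>Z. row_act (bl x) z = row_act (bl y) z"
        using rcos_lift_eq_iff[OF x lift_Khat(1)[OF y]] lift_Khat(2)[OF y] by simp
      then show "x = y"
        using row_act_eq_iff[OF bl_carrier[OF x] bl_carrier[OF y]] blk_inj[OF p1 x y] by blast
    qed
    moreover have "(\<lambda>x. rcos (lift x)) ` carrier MS = rcos ` Khat"
      using lift_surj lift_Khat(1) by (auto simp: image_iff) metis
    ultimately show "bij_betw (\<lambda>x. rcos (lift x)) (carrier MS) (carrier (T\<lparr>carrier := rcos ` Khat\<rparr>))"
      by (simp add: bij_betw_def)
  qed
  from iso_inv_into[OF this matrix_semidirect_closed[OF p1]] show ?thesis by (rule is_isoI)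
qed

end

section \<open>A rigid system of minors\<close>

text \<open>If \<open>v\<close> holds the coordinates modulo \<open>p\<close> of an element \<open>x\<close> of \<open>L/Z\<close>, then \<open>pcoef n v c d\<close> is the coefficient
  of \<open>p x\<close> at the commutator \<open>[e\<^sub>c, e\<^sub>d]\<close>.\<close>

definition pcoef :: "nat \<Rightarrow> (nat \<Rightarrow> int) \<Rightarrow> nat \<Rightarrow> nat \<Rightarrow> int" where
  "pcoef n v c d = (if c = 1 \<and> d = 3 then v 0 else if c = 1 \<and> d = 2 then v 1
    else if c = 0 \<and> d + 1 < n then v (d + 1) else 0)"

text \<open>Substitutes known values for the four entries of a minor in one step.\<close>

lemma cong_minor:
  fixes q :: int
  assumes "[s = x * y - z * t] (mod q)" "[x = x'] (mod q)" "[y = y'] (mod q)" "[z = z'] (mod q)" "[t = t'] (mod q)"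
  shows "[s = x' * y' - z' * t'] (mod q)"
  by (rule cong_trans[OF assms(1)]) (intro cong_diff cong_mult assms)

text \<open>\<open>E1\<close> constrains row 1 through itself and isolates it by the Pluecker
  relation. Rows 2, 0 and 3 are then compared with it, and the later rows follow from
  \<open>E\<close> by induction.\<close>

lemma rigid_rows:
  fixes r :: "nat \<Rightarrow> nat \<Rightarrow> int" and q :: int
  assumes q: "prime q" and n: "4 \<le> n"
    and E0: "\<And>c d. c < d \<Longrightarrow> d < n \<Longrightarrow> [pcoef n (r 0) c d = r 1 c * r 3 d - r 1 d * r 3 c] (mod q)"
    and E1: "\<And>c d. c < d \<Longrightarrow> d < n \<Longrightarrow> [pcoef n (r 1) c d = r 1 c * r 2 d - r 1 d * r 2 c] (mod q)"
    and E: "\<And>i c d. 1 \<le> i \<Longrightarrow> i + 1 < n \<Longrightarrow> c < d \<Longrightarrow> d < n \<Longrightarrow>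
      [pcoef n (r (i + 1)) c d = r 0 c * r i d - r 0 d * r i c] (mod q)"
    and nz: "\<exists>j<n. \<not> q dvd r 1 j"
    and ij: "i < n" "j < n"
  shows "[r i j = (if i = j then 1 else 0)] (mod q)"
proof -
  define u v w x where "u = r 0" and "v = r 1" and "w = r 2" and "x = r 3"
  have cancel: "[s = t] (mod q)" if "[a * s = a * t] (mod q)" "\<not> q dvd a" for a s t
    using that prime_imp_coprime[OF q] by (metis cong_mult_lcancel coprime_commute)
  have square: "[s = 0] (mod q)" if "[s * s = 0] (mod q)" for s
    using that prime_dvd_mult_iff[OF q] by (auto simp: cong_0_iff)
  \<comment> \<open>the Pluecker relation, because \<open>pcoef n v\<close> is the exterior product of \<open>v\<close> and \<open>w\<close>\<close>
  have plucker: "[v c * pcoef n v d f - v d * pcoef n v c f + v f * pcoef n v c d = 0] (mod q)"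
    if "c < d" "d < f" "f < n" for c d f
  proof -
    have "[v c * pcoef n v d f - v d * pcoef n v c f + v f * pcoef n v c d =
        v c * (v d * w f - v f * w d) - v d * (v c * w f - v f * w c) + v f * (v c * w d - v d * w c)] (mod q)"
      unfolding v_def w_def using that by (intro cong_add cong_diff cong_mult cong_refl E1) auto
    then show ?thesis by (simp add: algebra_simps)
  qed
  \<comment> \<open>Downward in \<open>k\<close>: the Pluecker relation at 0, \<open>k - 1\<close>,
    \<open>k\<close> reduces to the square of \<open>v k\<close> minus
    \<open>v (k - 1) * v (k + 1)\<close>, whose last factor is 0 by induction, or counts as 0 for
    the top index.\<close>
  have v_ge3: "[v k = 0] (mod q)" if "3 \<le> k" "k < n" for k
    using that
  proof (induction "n - k" arbitrary: k rule: less_induct)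
    case less
    have 1: "[v (k - 1) * pcoef n v 0 k = 0] (mod q)"
    proof (cases "k + 1 < n")
      case True
      then have "[v (k + 1) = 0] (mod q)" using less by (intro less(1)) auto
      then have "[v (k - 1) * v (k + 1) = v (k - 1) * 0] (mod q)" by (intro cong_mult cong_refl)
      then show ?thesis using True by (simp add: pcoef_def)
    qed (simp add: pcoef_def)
    have "[v 0 * pcoef n v (k - 1) k - v (k - 1) * pcoef n v 0 k + v k * pcoef n v 0 (k - 1) = 0] (mod q)"
      using less by (intro plucker) auto
    moreover have "pcoef n v (k - 1) k = 0" "pcoef n v 0 (k - 1) = v k" using less by (auto simp: pcoef_def)
    ultimately have "[v k * v k = v (k - 1) * pcoef n v 0 k] (mod q)"
      by (simp add: cong_iff_dvd_diff algebra_simps)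
    then have "[v k * v k = 0] (mod q)" using 1 cong_trans by blast
    then show ?case by (rule square)
  qed
  \<comment> \<open>The Pluecker relation at 0, 1, 3, where \<open>pcoef n v 1 3\<close> is
    \<open>v 0\<close>.\<close>
  have v0: "[v 0 = 0] (mod q)"
  proof (rule square)
    have "[v 1 * pcoef n v 0 3 = v 1 * 0] (mod q)"
      using v_ge3[of 4] by (intro cong_mult cong_refl) (auto simp: pcoef_def)
    moreover have "[v 3 * pcoef n v 0 1 = 0 * pcoef n v 0 1] (mod q)"
      using v_ge3[of 3] n by (intro cong_mult cong_refl) auto
    ultimately have "[v 0 * v 0 - v 1 * pcoef n v 0 3 + v 3 * pcoef n v 0 1 = v 0 * v 0 - v 1 * 0 + 0 * pcoef n v 0 1] (mod q)"
      by (intro cong_add cong_diff cong_refl)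
    moreover have "[v 0 * pcoef n v 1 3 - v 1 * pcoef n v 0 3 + v 3 * pcoef n v 0 1 = 0] (mod q)"
      using n by (intro plucker) auto
    moreover have "pcoef n v 1 3 = v 0" by (simp add: pcoef_def)
    ultimately show "[v 0 * v 0 = 0] (mod q)" by (simp add: cong_def)
  qed
  \<comment> \<open>The Pluecker relation at 0, 1, 2.\<close>
  have v2: "[v 2 = 0] (mod q)"
  proof (rule square)
    have "[v 0 * v 1 - v 1 * v 3 + v 2 * v 2 = 0 * v 1 - v 1 * 0 + v 2 * v 2] (mod q)"
      using v_ge3[of 3] n v0 by (intro cong_add cong_diff cong_mult cong_refl) auto
    moreover have "[v 0 * pcoef n v 1 2 - v 1 * pcoef n v 0 2 + v 2 * pcoef n v 0 1 = 0] (mod q)"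
      using n by (intro plucker) auto
    moreover have "pcoef n v 1 2 = v 1" "pcoef n v 0 2 = v 3" "pcoef n v 0 1 = v 2"
      using n by (simp_all add: pcoef_def numeral_3_eq_3 numeral_2_eq_2)
    ultimately show "[v 2 * v 2 = 0] (mod q)" by (simp add: cong_def)
  qed
  have v: "[v k = 0] (mod q)" if "k < n" "k \<noteq> 1" for k
    using that v0 v2 v_ge3[of k] by (cases "k = 0 \<or> k = 2") auto
  have a: "\<not> q dvd v 1"
    using nz v by (metis cong_0_iff v_def)
  have E1': "[pcoef n v c d = v c * w d - v d * w c] (mod q)" if "c < d" "d < n" for c d
    using E1[OF that] by (simp add: v_def w_def)
  have Ew: "[pcoef n w c d = u c * v d - u d * v c] (mod q)" if "c < d" "d < n" for c d
    using E[of 1, OF _ _ that] n by (simp add: u_def v_def w_def numeral_2_eq_2)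
  have Ex: "[pcoef n x c d = u c * w d - u d * w c] (mod q)" if "c < d" "d < n" for c d
    using E[of 2, OF _ _ that] n by (simp add: u_def x_def w_def)
  have Eu: "[pcoef n u c d = v c * x d - v d * x c] (mod q)" if "c < d" "d < n" for c d
    using E0[OF that] by (simp add: u_def x_def v_def)
  \<comment> \<open>As \<open>v\<close> is supported at 1, minors with \<open>w\<close> are
    multiples of the unit \<open>v 1\<close>, so the entries of \<open>w\<close> can be read off by
    cancelling.\<close>
  have vw: "[pcoef n v 1 d = v 1 * w d] (mod q)" if "2 \<le> d" "d < n" for d
    using cong_minor[OF E1'[of 1 d] cong_refl cong_refl v[of d] cong_refl] that by simp
  have w2: "[w 2 = 1] (mod q)"
  proof (rule cancel[OF _ a])
    show "[v 1 * w 2 = v 1 * 1] (mod q)"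
      using cong_sym[OF vw[of 2]] n by (simp add: pcoef_def)
  qed
  have w_ge3: "[w d = 0] (mod q)" if "3 \<le> d" "d < n" for d
  proof -
    have "pcoef n v 1 d = (if d = 3 then v 0 else 0)" using that by (simp add: pcoef_def)
    then have "[pcoef n v 1 d = 0] (mod q)" using v0 by (cases "d = 3") simp_all
    moreover have "[v 1 * w d = pcoef n v 1 d] (mod q)" using that by (intro cong_sym[OF vw[of d]]) auto
    ultimately have "[v 1 * w d = 0] (mod q)" using cong_trans by blast
    then have "[v 1 * w d = v 1 * 0] (mod q)" by simp
    then show ?thesis by (rule cancel[OF _ a])
  qed
  have w0: "[w 0 = 0] (mod q)"
  proof (rule cancel[OF _ a])
    have "[pcoef n v 0 1 = 0 * w 1 - v 1 * w 0] (mod q)"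
      by (rule cong_minor[OF E1'[of 0 1] v0]) (use n in auto)
    moreover have "[pcoef n v 0 1 = 0] (mod q)" using v2 n by (simp add: pcoef_def numeral_2_eq_2)
    ultimately have "[0 * w 1 - v 1 * w 0 = 0] (mod q)" by (simp add: cong_def)
    then show "[v 1 * w 0 = v 1 * 0] (mod q)" by (simp add: cong_0_iff)
  qed
  \<comment> \<open>Row 2 is the exterior product of rows 0 and 1, so the same cancelling determines
    entries of \<open>u\<close>.\<close>
  have uv: "[pcoef n w 1 d = - (v 1 * u d)] (mod q)" if "2 \<le> d" "d < n" for d
    using cong_minor[OF Ew[of 1 d] cong_refl v[of d] cong_refl cong_refl] that by (simp add: mult.commute)
  have u_ge3: "[u d = 0] (mod q)" if "3 \<le> d" "d < n" for d
  proof -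
    have "pcoef n w 1 d = (if d = 3 then w 0 else 0)" using that by (simp add: pcoef_def)
    then have "[pcoef n w 1 d = 0] (mod q)" using w0 by (cases "d = 3") simp_all
    moreover have "[- (v 1 * u d) = pcoef n w 1 d] (mod q)" using that by (intro cong_sym[OF uv[of d]]) auto
    ultimately have "[- (v 1 * u d) = 0] (mod q)" using cong_trans by blast
    then have "[v 1 * u d = v 1 * 0] (mod q)" by (simp add: cong_0_iff)
    then show ?thesis by (rule cancel[OF _ a])
  qed
  have au0: "[v 1 * u 0 = 1] (mod q)"
  proof -
    have "[pcoef n w 0 1 = u 0 * v 1 - u 1 * 0] (mod q)"
      by (rule cong_minor[OF Ew[of 0 1] cong_refl cong_refl cong_refl v0]) (use n in auto)
    then have "[w 2 = v 1 * u 0] (mod q)" using n by (simp add: pcoef_def numeral_2_eq_2 mult.commute)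
    then show ?thesis using w2 by (simp add: cong_def)
  qed
  \<comment> \<open>The next three use p e_3 = [e_0, e_2], which expresses \<open>x\<close> by
    \<open>u\<close> and \<open>w\<close>.\<close>
  have x0: "[x 0 = 0] (mod q)"
    using cong_minor[OF Ex[of 1 3] cong_refl w_ge3[of 3] u_ge3[of 3] cong_refl] n by (simp add: pcoef_def)
  have x3: "[x 3 = u 0] (mod q)"
    using cong_minor[OF Ex[of 0 2] cong_refl w2 cong_refl w0] n by (simp add: pcoef_def numeral_3_eq_3 numeral_2_eq_2)
  have x2: "[x 2 = u 0 * w 1] (mod q)"
    using cong_minor[OF Ex[of 0 1] cong_refl cong_refl cong_refl w0] n by (simp add: pcoef_def numeral_2_eq_2)
  have u0: "\<not> q dvd u 0"
  proof
    assume "q dvd u 0"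
    then have "[v 1 * u 0 = 0] (mod q)" by (simp add: cong_0_iff)
    then have "[1 = 0] (mod q)" using au0 by (simp add: cong_def)
    then show False using q not_prime_unit[of q] cong_0_iff[of 1 q] by blast
  qed
  \<comment> \<open>The coefficient of p e_0 = [e_1, e_3] at (1, 3) reads
    \<open>u 0 = v 1 * u 0\<close>; this fixes the scaling left open by \<open>au0\<close>.\<close>
  have v1: "[v 1 = 1] (mod q)"
  proof (rule cancel[OF _ u0])
    have "[u 0 = v 1 * u 0 - 0 * x 1] (mod q)"
      using cong_minor[OF Eu[of 1 3] cong_refl x3 v[of 3] cong_refl] n by (simp add: pcoef_def)
    then have "[u 0 = v 1 * u 0] (mod q)" by simp
    then have "[v 1 * u 0 = u 0] (mod q)" by (rule cong_sym)
    then show "[u 0 * v 1 = u 0 * 1] (mod q)" by (simp add: mult.commute)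
  qed
  have u0': "[u 0 = 1] (mod q)"
  proof -
    have "[v 1 * u 0 = 1 * u 0] (mod q)" by (intro cong_mult v1 cong_refl)
    then show ?thesis using au0 by (simp add: cong_def)
  qed
  have u2: "[u 2 = 0] (mod q)"
    using cong_minor[OF Eu[of 0 1] v0 cong_refl cong_refl x0] n by (simp add: pcoef_def numeral_2_eq_2)
  have w1: "[w 1 = 0] (mod q)"
  proof -
    have "[w 1 = - (v 1 * u 2)] (mod q)" using uv[of 2] n by (simp add: pcoef_def)
    moreover have "[- (v 1 * u 2) = 0] (mod q)" using u2 by (simp add: cong_0_iff)
    ultimately show ?thesis by (rule cong_trans)
  qed
  have x2': "[x 2 = 0] (mod q)"
  proof (rule cong_trans[OF x2])
    show "[u 0 * w 1 = 0] (mod q)" using w1 by (simp add: cong_0_iff)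
  qed
  have u1: "[u 1 = 0] (mod q)"
  proof -
    have "[u 1 = v 1 * 0 - 0 * x 1] (mod q)"
      using cong_minor[OF Eu[of 1 2] cong_refl x2' v[of 2] cong_refl] n by (simp add: pcoef_def)
    then show ?thesis by simp
  qed
  have u: "[u k = (if k = 0 then 1 else 0)] (mod q)" if "k < n" for k
  proof -
    have "k = 0 \<or> k = 1 \<or> k = 2 \<or> 3 \<le> k" by arith
    then show ?thesis using that u0' u1 u2 u_ge3[of k] by (elim disjE) simp_all
  qed
  have v': "[v k = (if k = 1 then 1 else 0)] (mod q)" if "k < n" for k
    using that v1 v[of k] by auto
  have row: "[r (i + 1) k = (if k = i + 1 then 1 else 0)] (mod q)" if "i + 1 < n" "k < n" for i k
    using that
  proof (induction i arbitrary: k)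
    case 0
    then show ?case using v'[of k] by (simp add: v_def)
  next
    case (Suc i)
    let ?s = "r (i + 1)" and ?t = "r (i + 2)"
    have s: "[?s k = (if k = i + 1 then 1 else 0)] (mod q)" if "k < n" for k
      using Suc.IH[of k] Suc.prems that by simp
    have Et: "[pcoef n ?t c d = (if c = 0 then 1 else 0) * (if d = i + 1 then 1 else 0)
        - (if d = 0 then 1 else 0) * (if c = i + 1 then 1 else 0)] (mod q)" if cd: "c < d" "d < n" for c d
    proof -
      have c: "c < n" using cd by simp
      have "[pcoef n ?t c d = u c * ?s d - u d * ?s c] (mod q)"
        using E[of "i + 1", OF _ _ cd] Suc.prems by (simp add: u_def)
      then show ?thesis
        by (rule cong_minor[OF _ u[OF c] s[OF cd(2)] u[OF cd(2)] s[OF c]])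
    qed
    have "[?t k = (if k = i + 2 then 1 else 0)] (mod q)"
    proof -
      \<comment> \<open>The entries of a row in columns 0, 1 and \<open>k \<ge> 2\<close> occur in
        \<open>pcoef\<close> at (1, 3), (1, 2) and (0, \<open>k - 1\<close>).\<close>
      consider "k = 0" | "k = 1" | "2 \<le> k" by arith
      then show ?thesis
      proof cases
        case 1
        then show ?thesis using Et[of 1 3] n by (simp add: pcoef_def)
      next
        case 2
        then show ?thesis using Et[of 1 2] n by (simp add: pcoef_def)
      next
        case 3
        define d where "d = k - 1"
        have d: "k = d + 1" "1 \<le> d" using 3 by (simp_all add: d_def)
        then show ?thesis using Et[of 0 d] Suc.prems by (simp add: pcoef_def)
      qed
    qed
    then show ?case by (simp add: eval_nat_numeral)
  qed
  show ?thesis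
  proof (cases "i = 0")
    case True
    then show ?thesis using u[OF ij(2)] by (auto simp: u_def)
  next
    case False
    then obtain i' where "i = i' + 1" by (metis Suc_eq_plus1 not0_implies_Suc)
    then show ?thesis using row[of i' j] ij by auto
  qed
qed

section \<open>The group and its holomorph\<close>

text \<open>The commutator \<open>[e\<^sub>a, e\<^sub>b]\<close> is the basis vector of \<open>Z\<close> with number \<open>idx (a, b)\<close>, and the basis vectors with
  number \<open>i < n\<close> are the \<open>p e\<^sub>i\<close>.\<close>

locale rigid_p_lattice = p_lattice p n N pnt for p n N and pnt :: "(nat \<Rightarrow> int) \<Rightarrow> 'v::ab_group_add" +
  fixes idx :: "nat \<times> nat \<Rightarrow> nat"
  assumes n4: "4 \<le> n" and idx_bij: "bij_betw idx {(a, b). a < b \<and> b < n} {..<N}"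
    and idx13: "idx (1, 3) = 0" and idx12: "idx (1, 2) = 1"
    and idx0: "1 \<le> i \<Longrightarrow> i + 1 < n \<Longrightarrow> idx (0, i) = i + 1"
begin

text \<open>Only entries above the diagonal are nonzero, so the commutator of \<open>e a\<close> and
  \<open>e b\<close> with \<open>a < b\<close> is a single basis vector, without a factor 2.\<close>

definition sc :: "nat \<Rightarrow> nat \<Rightarrow> 'v" where
  "sc a b = (if a < b then eps (idx (a, b)) else 0)"

definition beta :: "'v \<Rightarrow> 'v \<Rightarrow> 'v" where "beta = bilmap sc"

definition G :: "'v monoid" where
  "G = \<lparr>carrier = L, monoid.mult = \<lambda>x y. x + y + beta x y, one = 0\<rparr>"

lemma sc_Z: "sc a b \<in> Z" by (simp add: sc_def)

lemma beta_Z [simp, intro]: "beta x y \<in> Z"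
  unfolding beta_def by (rule bilmap_Z) (rule sc_Z)
lemma beta_add_left: "x \<in> L \<Longrightarrow> x' \<in> L \<Longrightarrow> beta (x + x') y = beta x y + beta x' y"
  unfolding beta_def by (rule bilmap_add_left) (rule sc_Z)
lemma beta_add_right: "y \<in> L \<Longrightarrow> y' \<in> L \<Longrightarrow> beta x (y + y') = beta x y + beta x y'"
  unfolding beta_def by (rule bilmap_add_right) (rule sc_Z)
lemma beta_0_left: "z \<in> Z \<Longrightarrow> beta z y = 0"
  unfolding beta_def by (rule bilmap_eq_0_left) (rule sc_Z)
lemma beta_0_right: "z \<in> Z \<Longrightarrow> beta x z = 0"
  unfolding beta_def by (rule bilmap_eq_0_right) (rule sc_Z)
lemma beta_minus_left: "x \<in> L \<Longrightarrow> beta (- x) y = - beta x y"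
  unfolding beta_def by (rule bilmap_minus_left) (rule sc_Z)
lemma beta_e: "a < n \<Longrightarrow> b < n \<Longrightarrow> beta (e a) (e b) = sc a b"
  unfolding beta_def by (rule bilmap_e) (rule sc_Z)

lemmas beta_simps = beta_add_left beta_add_right beta_0_left beta_0_right L_closed

lemma G_simps [simp]: "carrier G = L" "x \<otimes>\<^bsub>G\<^esub> y = x + y + beta x y" "\<one>\<^bsub>G\<^esub> = 0"
  by (simp_all add: G_def)

lemma group_G: "group G"
proof (rule groupI)
  fix x assume x: "x \<in> carrier G"
  \<comment> \<open>The inverse of \<open>x\<close> in the group is
    \<open>- x + beta x x\<close>.\<close>
  have "beta (- x + beta x x) x = - beta x x"
    using x beta_add_left[of "- x" "beta x x" x] by (simp add: beta_minus_left beta_0_left L_closed)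
  then have "(- x + beta x x) \<otimes>\<^bsub>G\<^esub> x = \<one>\<^bsub>G\<^esub>"
    by (simp only: G_simps) simp
  then show "\<exists>y\<in>carrier G. y \<otimes>\<^bsub>G\<^esub> x = \<one>\<^bsub>G\<^esub>"
    using x by (intro bexI[of _ "- x + beta x x"]) auto
qed (auto simp: beta_simps algebra_simps)

section \<open>Commutators and the nilpotency class\<close>

definition comm :: "'v \<Rightarrow> 'v \<Rightarrow> 'v" where "comm x y = beta x y - beta y x"

lemma comm_Z [simp, intro]: "comm x y \<in> Z" by (auto simp: comm_def)

lemma comm_add_Z:
  "x \<in> L \<Longrightarrow> y \<in> L \<Longrightarrow> z \<in> Z \<Longrightarrow> z' \<in> Z \<Longrightarrow> comm (x + z) (y + z') = comm x y"
  by (simp add: comm_def beta_simps)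

lemma comm_e: "a < b \<Longrightarrow> b < n \<Longrightarrow> comm (e a) (e b) = eps (idx (a, b))"
  by (simp add: comm_def beta_e sc_def)

lemma mult_comm: "x + y + beta x y = (y + x + beta y x) + comm x y"
  by (simp add: comm_def algebra_simps)

lemma commutator_G:
  assumes "x \<in> L" "y \<in> L"
  shows "inv\<^bsub>G\<^esub> x \<otimes>\<^bsub>G\<^esub> inv\<^bsub>G\<^esub> y \<otimes>\<^bsub>G\<^esub> x \<otimes>\<^bsub>G\<^esub> y = comm x y"
proof -
  interpret G: group G by (rule group_G)
  have c: "x \<in> carrier G" "y \<in> carrier G" "comm x y \<in> carrier G" using assms by auto
  have "x \<otimes>\<^bsub>G\<^esub> y = (y \<otimes>\<^bsub>G\<^esub> x) \<otimes>\<^bsub>G\<^esub> comm x y"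
    using mult_comm[of x y] by (simp add: beta_0_right)
  then have "inv\<^bsub>G\<^esub> (y \<otimes>\<^bsub>G\<^esub> x) \<otimes>\<^bsub>G\<^esub> (x \<otimes>\<^bsub>G\<^esub> y) = comm x y"
    using c G.inv_solve_left'[of "comm x y" "y \<otimes>\<^bsub>G\<^esub> x" "x \<otimes>\<^bsub>G\<^esub> y"] G.m_closed by metis
  then show ?thesis
    using c G.inv_mult_group[of y x] G.m_assoc[of "inv\<^bsub>G\<^esub> x \<otimes>\<^bsub>G\<^esub> inv\<^bsub>G\<^esub> y" x y] G.inv_closed G.m_closed
    by metis
qed

lemma idx_lt: "a < b \<Longrightarrow> b < n \<Longrightarrow> idx (a, b) < N"
  using bij_betwE[OF idx_bij] by auto

lemma idx_inj: "a < b \<Longrightarrow> b < n \<Longrightarrow> c < d \<Longrightarrow> d < n \<Longrightarrow> idx (a, b) = idx (c, d) \<Longrightarrow> (a, b) = (c, d)"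
  using idx_bij by (auto simp: bij_betw_def dest!: inj_onD)

lemma idx_surj: "q < N \<Longrightarrow> \<exists>a b. a < b \<and> b < n \<and> idx (a, b) = q"
proof -
  assume "q < N"
  then have "q \<in> idx ` {(a, b). a < b \<and> b < n}" using idx_bij by (simp add: bij_betw_def)
  then show ?thesis by auto
qed

lemma eps_neq_0: "i < N \<Longrightarrow> eps i \<noteq> 0"
proof
  assume i: "i < N" and "eps i = 0"
  then have "int p * int p dvd int p" by (auto simp: eps_def pnt_eq_0_iff dest!: spec[of _ i])
  then show False using p_gt_1 by (auto dest: zdvd_imp_le)
qed

lemma commutator_subgroup_G:
  assumes "A \<subseteq> L" shows "commutator_subgroup G A (carrier G) = generate G {comm x y | x y. x \<in> A \<and> y \<in> L}"
proof -
  have "(\<lambda>(x, y). inv\<^bsub>G\<^esub> x \<otimes>\<^bsub>G\<^esub> inv\<^bsub>G\<^esub> y \<otimes>\<^bsub>G\<^esub> x \<otimes>\<^bsub>G\<^esub> y) ` (A \<times> L) = (\<lambda>(x, y). comm x y) ` (A \<times> L)"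
  proof (rule image_cong[OF refl], clarify)
    fix x y assume "x \<in> A" "y \<in> L"
    then show "inv\<^bsub>G\<^esub> x \<otimes>\<^bsub>G\<^esub> inv\<^bsub>G\<^esub> y \<otimes>\<^bsub>G\<^esub> x \<otimes>\<^bsub>G\<^esub> y = comm x y"
      using assms by (intro commutator_G) auto
  qed
  then show ?thesis by (simp only: commutator_subgroup_def setcompr2_eq_image G_simps(1))
qed

lemma nilpotency_class_G: "has_nilpotency_class G 2"
proof -
  interpret G: group G by (rule group_G)
  have sub: "subgroup Z G"
  proof (rule G.subgroupI)
    fix z assume z: "z \<in> Z"
    have "- z \<otimes>\<^bsub>G\<^esub> z = \<one>\<^bsub>G\<^esub>" using z by (simp add: beta_0_right)
    then have "inv\<^bsub>G\<^esub> z = - z" using z by (intro G.inv_equality) auto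
    then show "inv\<^bsub>G\<^esub> z \<in> Z" using z by simp
  next
    show "Z \<noteq> {}" using Z_closed(1) by blast
  qed (auto simp: beta_0_left)
  have 1: "lower_central G (Suc 0) = generate G {comm x y | x y. x \<in> L \<and> y \<in> L}"
    using commutator_subgroup_G[of L] by simp
  have 1: "lower_central G (Suc 0) \<subseteq> Z"
    unfolding 1 by (rule G.generate_subgroup_incl[OF _ sub]) auto
  have "comm (e 0) (e 1) \<in> {comm x y | x y. x \<in> L \<and> y \<in> L}"
    using e_L[of 0] e_L[of 1] n4 by (intro CollectI exI[of _ "e 0"] exI[of _ "e 1"]) simp
  then have "comm (e 0) (e 1) \<in> lower_central G (Suc 0)"
    using commutator_subgroup_G[of L] by (simp add: generate.incl)
  then have "eps (idx (0, 1)) \<in> lower_central G (Suc 0)"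
    using n4 comm_e[of 0 1] by simp
  then have ne1: "lower_central G (Suc 0) \<noteq> {\<one>\<^bsub>G\<^esub>}"
    using eps_neq_0[OF idx_lt[of 0 1]] n4 by auto
  have ne0: "lower_central G 0 \<noteq> {\<one>\<^bsub>G\<^esub>}"
    using eps_neq_0[of 0] n nN Z_L[OF eps_Z[of 0]] by auto
  have "{comm x y | x y. x \<in> lower_central G (Suc 0) \<and> y \<in> L} \<subseteq> {\<one>\<^bsub>G\<^esub>}"
    using 1 by (auto simp: comm_def beta_0_left beta_0_right)
  then have "generate G {comm x y | x y. x \<in> lower_central G (Suc 0) \<and> y \<in> L} \<subseteq> generate G {\<one>\<^bsub>G\<^esub>}"
    by (rule G.mono_generate)
  moreover have "\<one>\<^bsub>G\<^esub> \<in> generate G {comm x y | x y. x \<in> lower_central G (Suc 0) \<and> y \<in> L}"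
    by (rule generate.one)
  ultimately have 2: "lower_central G 2 = {\<one>\<^bsub>G\<^esub>}"
    using 1 Z_subset_L commutator_subgroup_G[of "lower_central G (Suc 0)"] G.generate_one
    by (auto simp: numeral_2_eq_2 simp del: G_simps(3))
  have "i = 0 \<or> i = Suc 0" if "i < 2" for i :: nat using that by auto
  then show ?thesis using 2 ne0 ne1 unfolding has_nilpotency_class_def by blast
qed

lemma pnt_sum: "pnt (\<lambda>q. \<Sum>i\<in>I. f i q) = (\<Sum>i\<in>I. pnt (f i))"
  by (induction I rule: infinite_finite_induct) (simp_all add: pnt_0 pnt_plus)

text \<open>In coordinates, so that antisymmetrizing produces minors of coordinate vectors.\<close>

lemma beta_pnt:
  "beta x y = pnt (\<lambda>q. int p * (\<Sum>i<n. \<Sum>j<n. if i < j \<and> idx (i, j) = q then co x i * co y j else 0))"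
proof -
  have sc: "sc i j = pnt (\<lambda>q. if i < j \<and> idx (i, j) = q then int p else 0)" for i j
    by (auto simp: sc_def eps_def pnt_0 intro!: arg_cong[of _ _ pnt])
  have "beta x y = (\<Sum>i<n. \<Sum>j<n. pnt (\<lambda>q. int p * (if i < j \<and> idx (i, j) = q then co x i * co y j else 0)))"
    unfolding beta_def bilmap_def linmap_def zmod.scale_sum_right zscale_scale sc pnt_scale
    by (intro sum.cong refl arg_cong[of _ _ pnt]) (auto simp: mult.commute)
  also have "\<dots> = pnt (\<lambda>q. int p * (\<Sum>i<n. \<Sum>j<n. if i < j \<and> idx (i, j) = q then co x i * co y j else 0))"
    by (simp add: pnt_sum sum_distrib_left)
  finally show ?thesis .
qed

lemma idx_coeff:
  assumes "c < d" "d < n"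
  shows "(\<Sum>i<n. \<Sum>j<n. if i < j \<and> idx (i, j) = idx (c, d) then f i j else (0::int)) = f c d"
proof -
  have "(\<Sum>i<n. \<Sum>j<n. if i < j \<and> idx (i, j) = idx (c, d) then f i j else 0)
      = (\<Sum>i<n. \<Sum>j<n. if j = d then (if i = c then f i j else 0) else 0)"
  proof (intro sum.cong refl)
    fix i j assume "i \<in> {..<n}" "j \<in> {..<n}"
    then show "(if i < j \<and> idx (i, j) = idx (c, d) then f i j else 0)
        = (if j = d then (if i = c then f i j else 0) else 0)"
      using idx_inj[of i j c d] assms by auto
  qed
  then show ?thesis using assms by simp
qed

text \<open>Translates the cases of \<open>pcoef\<close> into the numbering: 0, 1 and
  \<open>k + 1\<close> belong to (1, 3), (1, 2) and (0, \<open>k\<close>), and from \<open>n\<close>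
  on the coordinates vanish modulo \<open>p\<close>.\<close>

lemma pcoef_idx:
  assumes v: "\<And>q. n \<le> q \<Longrightarrow> q < N \<Longrightarrow> [v q = 0] (mod int p)" and cd: "c < d" "d < n"
  shows "[pcoef n v c d = v (idx (c, d))] (mod int p)"
proof (cases "idx (c, d) < n")
  case True
  consider "idx (c, d) = 0" | "idx (c, d) = 1" | "2 \<le> idx (c, d)" by arith
  then show ?thesis
  proof cases
    case 1
    then have "(c, d) = (1, 3)" using cd n4 idx13 by (intro idx_inj) auto
    then show ?thesis using idx13 by (simp add: pcoef_def)
  next
    case 2
    then have "(c, d) = (1, 2)" using cd n4 idx12 by (intro idx_inj) auto
    then show ?thesis using idx12 by (simp add: pcoef_def)
  next
    case 3
    define k where "k = idx (c, d) - 1"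
    have k: "idx (c, d) = k + 1" "1 \<le> k" "k + 1 < n" using 3 True by (simp_all add: k_def)
    then have "(c, d) = (0, k)" using cd idx0[of k] by (intro idx_inj) auto
    then show ?thesis using k by (simp add: pcoef_def)
  qed
next
  case False
  have "(c, d) \<noteq> (1, 3)" "(c, d) \<noteq> (1, 2)" using False idx13 idx12 n4 by auto
  moreover have "\<not> (c = 0 \<and> d + 1 < n)" using False idx0[of d] cd by auto
  ultimately have "pcoef n v c d = 0" by (auto simp: pcoef_def)
  then show ?thesis using v[of "idx (c, d)"] False idx_lt[OF cd] by (simp add: cong_sym)
qed

lemma pnt_p_eqD:
  "pnt (\<lambda>j. int p * b j) = pnt (\<lambda>j. int p * b' j) \<Longrightarrow> j < N \<Longrightarrow> [b j = b' j] (mod int p)"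
  using pnt_p_eq_iff by blast

text \<open>An automorphism \<open>\<psi>\<close> acts on \<open>L / Z\<close> by a matrix \<open>r\<close>. Comparing \<open>p\<close>-th powers with
  commutators in the relations \<open>p e\<^sub>i = [e\<^sub>a, e\<^sub>b]\<close> expresses the rows of \<open>r\<close> by
  \<open>2 \<times> 2\<close> minors of \<open>r\<close>, and this forces \<open>r\<close> to be the identity.\<close>

lemma automorphism_homs:
  assumes \<psi>L: "\<And>x. x \<in> L \<Longrightarrow> \<psi> x \<in> L" and inj: "inj_on \<psi> L"
    and hom: "\<And>x y. x \<in> L \<Longrightarrow> y \<in> L \<Longrightarrow> \<psi> (x + y + beta x y) = \<psi> x + \<psi> y + beta (\<psi> x) (\<psi> y)"
  shows "(\<lambda>x. \<psi> x - x) \<in> homs"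
proof -
  have \<psi>0: "\<psi> 0 = 0"
  proof -
    have "\<psi> 0 = \<psi> 0 + \<psi> 0 + beta (\<psi> 0) (\<psi> 0)" using hom[of 0 0] by (simp add: beta_0_left)
    then have *: "\<psi> 0 = - beta (\<psi> 0) (\<psi> 0)" by (simp add: eq_neg_iff_add_eq_0 add.assoc)
    have "\<psi> 0 \<in> Z" by (subst *) blast
    then show ?thesis using * by (simp add: beta_0_left)
  qed
  \<comment> \<open>The argument is the k-th power of \<open>x\<close> in the group, written
    additively; for \<open>k = p\<close> the correction term vanishes.\<close>
  have pow: "\<psi> (int k *\<^sub>Z x + int (k choose 2) *\<^sub>Z beta x x)
      = int k *\<^sub>Z \<psi> x + int (k choose 2) *\<^sub>Z beta (\<psi> x) (\<psi> x)" if x: "x \<in> L" for x k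
  proof (induction k)
    case 0
    then show ?case by (simp add: \<psi>0 numeral_2_eq_2)
  next
    case (Suc k)
    have bk: "beta (int k *\<^sub>Z w) w = int k *\<^sub>Z beta w w" if "w \<in> L" for w k
      using that by (induction k) (simp_all add: beta_simps zscale_left_distrib)
    have step: "(int k *\<^sub>Z w + int (k choose 2) *\<^sub>Z beta w w) + w
          + beta (int k *\<^sub>Z w + int (k choose 2) *\<^sub>Z beta w w) w
        = int (Suc k) *\<^sub>Z w + int (Suc k choose 2) *\<^sub>Z beta w w" if w: "w \<in> L" for w
    proof -
      have "Suc k choose 2 = k + (k choose 2)" by (simp add: numeral_2_eq_2)
      then have C: "int (Suc k choose 2) *\<^sub>Z beta w w = int k *\<^sub>Z beta w w + int (k choose 2) *\<^sub>Z beta w w"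
        by (simp add: zscale_left_distrib)
      have S: "int (Suc k) *\<^sub>Z w = int k *\<^sub>Z w + w" by (simp add: zscale_left_distrib)
      show ?thesis unfolding C S using w by (simp add: beta_simps bk algebra_simps)
    qed
    have kx: "int k *\<^sub>Z x + int (k choose 2) *\<^sub>Z beta x x \<in> L" using x by auto
    show ?case
      unfolding step[OF x, symmetric] step[OF \<psi>L[OF x], symmetric] hom[OF kx x] Suc.IH ..
  qed
  have \<psi>p: "\<psi> (int p *\<^sub>Z x) = int p *\<^sub>Z \<psi> x" if x: "x \<in> L" for x
  proof -
    have "int (p choose 2) *\<^sub>Z beta w w = 0" for w
      using scale_cong[OF beta_Z[of w w], of "int (p choose 2)" 0] p_dvd_choose by (simp add: cong_0_iff)
    then show ?thesis using pow[OF x, of p] by simp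
  qed
  have \<psi>Z: "\<psi> z \<in> Z" if "z \<in> Z" for z
    using \<psi>p[of z] that \<psi>L[of z] \<psi>0 by (intro L_torsion) (auto simp: p_scale_Z)
  have addZ: "\<psi> (x + z) = \<psi> x + \<psi> z" if "x \<in> L" "z \<in> Z" for x z
    using hom[of x z] that \<psi>Z by (simp add: beta_0_right)
  have \<psi>comm: "\<psi> (comm x y) = comm (\<psi> x) (\<psi> y)" if "x \<in> L" "y \<in> L" for x y
  proof -
    have "\<psi> (x + y + beta x y) = \<psi> (y + x + beta y x) + \<psi> (comm x y)"
      unfolding mult_comm[of x y] using that by (intro addZ) auto
    then have "\<psi> (comm x y) = (\<psi> x + \<psi> y + beta (\<psi> x) (\<psi> y)) - (\<psi> y + \<psi> x + beta (\<psi> y) (\<psi> x))"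
      unfolding hom[OF that] hom[OF that(2,1)] by (simp add: algebra_simps)
    then show ?thesis by (simp add: comm_def[of "\<psi> x"])
  qed
  define r where "r i = co (\<psi> (e i))" for i
  have minors: "[pcoef n (r i) c d = r a c * r b d - r a d * r b c] (mod int p)"
    if i: "i < n" "idx (a, b) = i" and ab: "a < b" "b < n" and cd: "c < d" "d < n" for i a b c d
  proof -
    have L: "\<psi> (e i) \<in> L" using \<psi>L i by auto
    have "[r i q = 0] (mod int p)" if "n \<le> q" "q < N" for q
      using co_dvd[OF L that] by (simp add: r_def cong_0_iff)
    then have 1: "[pcoef n (r i) c d = r i (idx (c, d))] (mod int p)" by (rule pcoef_idx[OF _ cd])
    \<comment> \<open>The coordinate, up to the factor \<open>p\<close>, of the commutator of the
      images at basis vector \<open>q\<close>; it collapses to one minor.\<close>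
    define S where "S q = (\<Sum>i<n. \<Sum>j<n. if i < j \<and> idx (i, j) = q then r a i * r b j else 0)
        - (\<Sum>i<n. \<Sum>j<n. if i < j \<and> idx (i, j) = q then r b i * r a j else 0)" for q
    have "pnt (\<lambda>q. int p * r i q) = int p *\<^sub>Z \<psi> (e i)"
      using pnt_co[OF L] pnt_scale[of "int p" "r i"] by (simp add: r_def)
    also have "\<dots> = \<psi> (eps i)" using \<psi>p[OF e_L[OF i(1)]] by (simp add: p_e)
    also have "\<dots> = comm (\<psi> (e a)) (\<psi> (e b))" using \<psi>comm[of "e a" "e b"] comm_e[OF ab] ab i by simp
    also have "\<dots> = pnt (\<lambda>q. int p * S q)"
      unfolding comm_def beta_pnt pnt_diff r_def S_def by (simp add: right_diff_distrib)
    finally have "[r i (idx (c, d)) = S (idx (c, d))] (mod int p)"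
      by (rule pnt_p_eqD[of "r i" S, OF _ idx_lt[OF cd]])
    then have "[r i (idx (c, d)) = r a c * r b d - r b c * r a d] (mod int p)"
      by (simp only: S_def idx_coeff[OF cd])
    then show ?thesis using 1 cong_trans by (simp add: mult.commute) blast
  qed
  have rows: "[r i j = (if i = j then 1 else 0)] (mod int p)" if ij: "i < n" "j < n" for i j
  proof (rule rigid_rows[OF prime_int n4 _ _ _ _ ij])
    show "[pcoef n (r 0) c d = r 1 c * r 3 d - r 1 d * r 3 c] (mod int p)" if "c < d" "d < n" for c d
      using minors[of 0 1 3 c d] idx13 n4 that by simp
    show "[pcoef n (r 1) c d = r 1 c * r 2 d - r 1 d * r 2 c] (mod int p)" if "c < d" "d < n" for c d
      using minors[of 1 1 2 c d] idx12 n4 that by simp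
    show "[pcoef n (r (i + 1)) c d = r 0 c * r i d - r 0 d * r i c] (mod int p)"
      if "1 \<le> i" "i + 1 < n" "c < d" "d < n" for i c d
      using minors[of "i + 1" 0 i c d] idx0[of i] that by simp
    show "\<exists>j<n. \<not> int p dvd r 1 j"
    proof (rule ccontr)
      \<comment> \<open>Otherwise the image of \<open>e 1\<close> lies in \<open>Z\<close>, and the
        nonzero element \<open>eps 1\<close> would be sent to 0.\<close>
      assume *: "\<not> (\<exists>j<n. \<not> int p dvd r 1 j)"
      have L: "\<psi> (e 1) \<in> L" using \<psi>L n4 by auto
      have "int p dvd co (\<psi> (e 1)) j" if "j < N" for j
        using * co_dvd[OF L, of j] that by (cases "j < n") (auto simp: r_def)
      then have "pnt (co (\<psi> (e 1))) \<in> Z" unfolding Z_def lat_def by blast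
      then have "\<psi> (e 1) \<in> Z" using pnt_co[OF L] by simp
      then have "\<psi> (eps 1) = \<psi> 0"
        using \<psi>p[of "e 1"] n4 by (simp add: p_e p_scale_Z \<psi>0)
      then have "eps 1 = 0" using inj by (auto dest!: inj_onD)
      then show False using eps_neq_0[of 1] n4 nN by simp
    qed
  qed
  have e_mod: "\<psi> (e i) - e i \<in> Z" if i: "i < n" for i
  proof -
    have L: "\<psi> (e i) \<in> L" using \<psi>L i by auto
    have "\<psi> (e i) - e i = pnt (\<lambda>j. co (\<psi> (e i)) j - (if j = i then 1 else 0))"
      using pnt_co[OF L] by (simp add: e_def flip: pnt_diff)
    moreover have "int p dvd co (\<psi> (e i)) j - (if j = i then 1 else 0)" if "j < N" for j
    proof (cases "j < n")
      case True
      then show ?thesis using rows[OF i True] by (auto simp: r_def cong_iff_dvd_diff)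
    next
      case False
      then show ?thesis using co_dvd[OF L, of j] that i by auto
    qed
    ultimately show ?thesis unfolding Z_def lat_def by blast
  qed
  have \<psi>eps: "\<psi> (eps q) = eps q" if "q < N" for q
  proof -
    obtain a b where ab: "a < b" "b < n" "idx (a, b) = q" using idx_surj[OF \<open>q < N\<close>] by blast
    have "eps q = comm (e a) (e b)" using comm_e[OF ab(1,2)] ab(3) by simp
    then have "\<psi> (eps q) = \<psi> (comm (e a) (e b))" by (rule arg_cong)
    also have "\<dots> = comm (\<psi> (e a)) (\<psi> (e b))" by (rule \<psi>comm) (use ab in auto)
    \<comment> \<open>Each \<open>eps q\<close> is a commutator, and commutators depend only on
      classes modulo \<open>Z\<close>, where \<open>\<psi>\<close> is trivial.\<close>
    also have "\<dots> = comm (e a + (\<psi> (e a) - e a)) (e b + (\<psi> (e b) - e b))" by simp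
    also have "\<dots> = comm (e a) (e b)" using ab by (intro comm_add_Z e_L e_mod) auto
    finally show ?thesis using comm_e[OF ab(1,2)] ab by simp
  qed
  have \<psi>_id: "\<psi> z = z" if "z \<in> Z" for z
    by (rule Z_induct[OF that]) (auto simp: \<psi>0 addZ \<psi>eps)
  have mod: "\<psi> x - x \<in> Z" if "x \<in> L" for x
  proof (rule L_induct[OF that])
    show "\<psi> 0 - 0 \<in> Z" by (simp add: \<psi>0)
  next
    fix x i assume x: "x \<in> L" and IH: "\<psi> x - x \<in> Z" and i: "i < n"
    have "\<psi> (x + e i) + beta x (e i) = \<psi> x + \<psi> (e i) + beta (\<psi> x) (\<psi> (e i))"
      using hom[of x "e i"] addZ[of "x + e i" "beta x (e i)"] x i by (simp add: \<psi>_id)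
    then have "\<psi> (x + e i) - (x + e i) = (\<psi> x - x) + (\<psi> (e i) - e i) + (beta (\<psi> x) (\<psi> (e i)) - beta x (e i))"
      by (simp add: algebra_simps)
    then show "\<psi> (x + e i) - (x + e i) \<in> Z"
      by (simp only:) (intro Z_closed(2,3) IH e_mod[OF i] beta_Z)
  next
    fix x i assume x: "x \<in> L" and IH: "\<psi> x - x \<in> Z" and i: "i < N"
    then show "\<psi> (x + eps i) - (x + eps i) \<in> Z" by (simp add: addZ \<psi>eps)
  qed
  have "\<psi> (x + y) = \<psi> x + \<psi> y" if x: "x \<in> L" and y: "y \<in> L" for x y
  proof -
    \<comment> \<open>Triviality modulo \<open>Z\<close> makes the two cocycle terms equal, so the
      homomorphism law becomes additivity.\<close>
    have "beta (\<psi> x) (\<psi> y) = beta (x + (\<psi> x - x)) (y + (\<psi> y - y))" by simp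
    also have "\<dots> = beta x y"
      unfolding beta_add_left[OF x Z_L[OF mod[OF x]]] beta_add_right[OF y Z_L[OF mod[OF y]]]
      by (simp only: beta_0_left[OF mod[OF x]] beta_0_right[OF mod[OF y]] add_0_right)
    finally show ?thesis
      using hom[OF x y] addZ[of "x + y" "beta x y"] x y by (simp add: \<psi>_id)
  qed
  then show ?thesis using mod by (auto simp: homs_def \<psi>_id algebra_simps)
qed

lemma right_regular_G: "y \<in> L \<Longrightarrow> right_regular G y = (\<lambda>x\<in>L. x + y + beta x y)"
  by (simp add: right_regular_def)

lemma holomorph_iff:
  "\<phi> \<in> holomorph G \<longleftrightarrow> \<phi> \<in> Bij L \<and> (\<forall>a\<in>L. \<exists>b\<in>L. \<forall>x\<in>L. \<phi> (x + a + beta x a) = \<phi> x + b + beta (\<phi> x) b)"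
proof -
  have "\<phi> \<in> holomorph G \<longleftrightarrow> \<phi> \<in> Bij L \<and>
      (\<forall>h\<in>right_regular G ` L. \<exists>h'\<in>right_regular G ` L. \<forall>x\<in>L. \<phi> (h x) = h' (\<phi> x))"
    unfolding holomorph_def G_simps(1)
    by (rule mem_normalizer_perm_group_iff[OF finite_L])
      (use right_regular_Bij[OF group_G] in auto)
  then show ?thesis
    using Bij_apply[of \<phi> L] by (auto simp: right_regular_G)
qed

text \<open>A member of the holomorph is an automorphism followed by a right translation, and right
  translations lie in \<open>H\<close> because \<open>beta x c\<close> is linear in \<open>x\<close>
  and vanishes on \<open>Z\<close>.\<close>

lemma holomorph_G: "holomorph G = H"
proof (intro equalityI subsetI)
  interpret G: group G by (rule group_G)
  fix \<phi> assume "\<phi> \<in> holomorph G"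
  then have \<phi>: "\<phi> \<in> Bij L" and ex: "\<And>a. a \<in> L \<Longrightarrow> \<exists>b\<in>L. \<forall>x\<in>L. \<phi> (x \<otimes>\<^bsub>G\<^esub> a) = \<phi> x \<otimes>\<^bsub>G\<^esub> b"
    by (auto simp: holomorph_iff)
  have \<phi>L: "\<phi> x \<in> carrier G" if "x \<in> L" for x using Bij_apply[OF \<phi> that] by simp
  have c: "\<phi> 0 \<in> carrier G" by (rule \<phi>L) simp
  \<comment> \<open>Dividing by the right translation by \<open>\<phi> 0\<close> leaves the
    automorphism part.\<close>
  define \<psi> where "\<psi> x = \<phi> x \<otimes>\<^bsub>G\<^esub> inv\<^bsub>G\<^esub> \<phi> 0" for x
  have \<psi>_L: "\<psi> x \<in> L" if "x \<in> L" for x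
    using G.m_closed[OF \<phi>L[OF that] G.inv_closed[OF c]] unfolding \<psi>_def by simp
  have \<phi>\<psi>: "\<phi> x = \<psi> x \<otimes>\<^bsub>G\<^esub> \<phi> 0" if "x \<in> L" for x
    unfolding \<psi>_def using G.m_assoc[OF \<phi>L[OF that] G.inv_closed[OF c] c] G.l_inv[OF c] G.r_one[OF \<phi>L[OF that]]
    by (simp del: G_simps)
  have "(\<lambda>x. \<psi> x - x) \<in> homs"
  proof (rule automorphism_homs[OF \<psi>_L])
    show "inj_on \<psi> L"
    proof (rule inj_onI)
      fix x y assume "x \<in> L" "y \<in> L" "\<psi> x = \<psi> y"
      then show "x = y" using \<phi>\<psi> \<phi> by (metis Bij_def Int_iff bij_betw_def inj_onD mem_Collect_eq)
    qed
  next
    fix x y assume x: "x \<in> L" and y: "y \<in> L"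
    obtain b where b: "b \<in> L" "\<forall>x\<in>L. \<phi> (x \<otimes>\<^bsub>G\<^esub> y) = \<phi> x \<otimes>\<^bsub>G\<^esub> b" using ex[OF y] by blast
    \<comment> \<open>Evaluation at the identity determines which right translation \<open>b\<close>
      is.\<close>
    have "\<phi> y = \<phi> 0 \<otimes>\<^bsub>G\<^esub> b" using b(2)[rule_format, of 0] G.l_one[of y] y by (simp add: beta_0_left)
    then have b_eq: "b = inv\<^bsub>G\<^esub> \<phi> 0 \<otimes>\<^bsub>G\<^esub> \<phi> y"
      using G.inv_solve_left[of b "\<phi> 0" "\<phi> y"] b(1) c \<phi>L[OF y] by (simp del: G_simps(2,3))
    have "\<psi> (x \<otimes>\<^bsub>G\<^esub> y) = \<phi> x \<otimes>\<^bsub>G\<^esub> (inv\<^bsub>G\<^esub> \<phi> 0 \<otimes>\<^bsub>G\<^esub> \<phi> y) \<otimes>\<^bsub>G\<^esub> inv\<^bsub>G\<^esub> \<phi> 0"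
      unfolding \<psi>_def using b(2) x b_eq by (simp del: G_simps)
    also have "\<dots> = \<psi> x \<otimes>\<^bsub>G\<^esub> \<psi> y"
      unfolding \<psi>_def using \<phi>L[OF x] \<phi>L[OF y] c G.inv_closed[OF c] G.m_closed
      by (simp add: G.m_assoc del: G_simps)
    finally show "\<psi> (x + y + beta x y) = \<psi> x + \<psi> y + beta (\<psi> x) (\<psi> y)" by simp
  qed
  then have \<tau>: "(\<lambda>x. \<psi> x - x) \<in> homs" .
  have cL: "\<phi> 0 \<in> L" using c by simp
  have "(\<lambda>x. (\<psi> x - x) + beta x (\<phi> 0)) \<in> homs"
    using \<tau> cL by (auto simp: homs_def beta_simps)
  moreover have "\<phi> = (\<lambda>x\<in>L. x + ((\<psi> x - x) + beta x (\<phi> 0)) + \<phi> 0)"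
  proof (rule extensionalityI[of _ L])
    fix x assume x: "x \<in> L"
    have "beta (\<psi> x) (\<phi> 0) = beta (x + (\<psi> x - x)) (\<phi> 0)" by simp
    also have "\<dots> = beta x (\<phi> 0)"
      unfolding beta_add_left[OF x Z_L[OF homs_Z[OF \<tau> x]]] by (simp only: beta_0_left[OF homs_Z[OF \<tau> x]] add_0_right)
    finally show "\<phi> x = (\<lambda>x\<in>L. x + ((\<psi> x - x) + beta x (\<phi> 0)) + \<phi> 0) x"
      using \<phi>\<psi>[OF x] x by (simp add: algebra_simps)
  qed (use \<phi> in \<open>auto simp: Bij_def\<close>)
  ultimately show "\<phi> \<in> H" using H_I[of "\<lambda>x. (\<psi> x - x) + beta x (\<phi> 0)" "\<phi> 0"] cL by simp
next
  fix h assume h: "h \<in> H"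
  then obtain \<tau> c where \<tau>: "\<tau> \<in> homs" and c: "c \<in> L" and h_eq: "h = (\<lambda>x\<in>L. x + \<tau> x + c)"
    by (auto simp: H_def)
  have "\<exists>b\<in>L. \<forall>x\<in>L. h (x + a + beta x a) = h x + b + beta (h x) b" if a: "a \<in> L" for a
  \<comment> \<open>The term \<open>\<tau> a\<close> comes from the linear part of \<open>h\<close>;
    \<open>beta c a\<close> compensates the cocycle contribution of the translation by
    \<open>c\<close>.\<close>
  proof (rule bexI[of _ "a + (\<tau> a - beta c a)"], rule ballI)
    have z: "\<tau> a - beta c a \<in> Z" using homs_Z[OF \<tau> a] by simp
    show "a + (\<tau> a - beta c a) \<in> L" using a z by auto
    fix x assume x: "x \<in> L"
    have "beta (x + \<tau> x + c) (a + (\<tau> a - beta c a)) = beta x a + beta c a"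
      using x a c z homs_Z[OF \<tau> x] by (simp add: beta_simps)
    then show "h (x + a + beta x a) = h x + (a + (\<tau> a - beta c a)) + beta (h x) (a + (\<tau> a - beta c a))"
      using x a c z by (simp add: h_eq L_closed homs_add[OF \<tau>] homs_0[OF \<tau>] algebra_simps)
  qed
  then show "h \<in> holomorph G" using h H_Bij by (auto simp: holomorph_iff)
qed

lemma T_group_G: "T_group G = NHg Mod H"
  by (simp add: T_group_def multiple_holomorph_def holomorph_G NHg_def NH_def)

lemma structure_G:
  "\<exists>E K. internal_semidirect (T_group G) E K \<and>
    elementary_abelian p ((T_group G)\<lparr>carrier := E\<rparr>) \<and>
    card E = p ^ (N * ((n + 1) choose 2)) \<and>
    (T_group G)\<lparr>carrier := K\<rparr> \<cong> matrix_semidirect p n (N - n)"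
  unfolding T_group_G using semidirect_NHg_Mod_H elementary_abelian_part complement_iso by blast

end

lemma iso_carrier_update:
  "t \<in> iso T T' \<Longrightarrow> A \<subseteq> carrier T \<Longrightarrow> t \<in> iso (T\<lparr>carrier := A\<rparr>) (T'\<lparr>carrier := t ` A\<rparr>)"
  by (auto simp: iso_def hom_def bij_betw_def inj_on_def subset_iff)

section \<open>Counting and numbering the commutators of generators\<close>

lemma card_pairs: "finite {(a, b). a < b \<and> b < (n::nat)}" "card {(a, b). a < b \<and> b < n} = n choose 2"
proof -
  have eq: "{(a, b). a < b \<and> b < n} = (\<lambda>(b, a). (a, b)) ` (SIGMA b:{..<n}. {..<b})" by auto
  show "finite {(a, b). a < b \<and> b < n}" unfolding eq by auto
  have "card {(a, b). a < b \<and> b < n} = card (SIGMA b:{..<n}. {..<b})"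
    unfolding eq by (rule card_image) (auto simp: inj_on_def)
  also have "\<dots> = (\<Sum>b<n. b)" by simp
  also have "\<dots> = n choose 2" by (induction n) (simp_all add: numeral_2_eq_2)
  finally show "card {(a, b). a < b \<and> b < n} = n choose 2" .
qed

text \<open>The first \<open>n\<close> numbers are prescribed and distinct pairs receive them, which
  also proves that there are at least \<open>n\<close> pairs; the rest is numbered
  arbitrarily.\<close>

lemma ex_idx:
  assumes n: "4 \<le> n"
  shows "n \<le> n choose 2 \<and> (\<exists>idx. bij_betw idx {(a, b). a < b \<and> b < n} {..<n choose 2} \<and>
    idx (1, 3) = 0 \<and> idx (1, 2) = 1 \<and> (\<forall>i. 1 \<le> i \<longrightarrow> i + 1 < n \<longrightarrow> idx (0, i) = i + 1))"
proof -
  let ?P = "{(a, b). a < b \<and> b < n}"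
  \<comment> \<open>\<open>f k\<close> is the pair whose commutator is p times generator
    \<open>k\<close>; \<open>g\<close> undoes \<open>f\<close>.\<close>
  define f :: "nat \<Rightarrow> nat \<times> nat" where "f k = (if k = 0 then (1, 3) else if k = 1 then (1, 2) else (0, k - 1))" for k
  define g :: "nat \<times> nat \<Rightarrow> nat" where "g q = (if q = (1, 3) then 0 else if q = (1, 2) then 1 else snd q + 1)" for q
  have gf: "g (f k) = k" for k by (auto simp: f_def g_def)
  then have inj: "inj_on f {..<n}" by (metis inj_on_inverseI)
  have sub: "f ` {..<n} \<subseteq> ?P" using n by (auto simp: f_def split: if_splits)
  have bg: "bij_betw g (f ` {..<n}) {..<n}"
    by (rule bij_betw_imageI) (auto simp: inj_on_def gf image_image)
  have card: "card (f ` {..<n}) = n" using card_image[OF inj] by simp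
  have nN: "n \<le> n choose 2" using card_mono[OF card_pairs(1) sub] card card_pairs(2) by metis
  have "card (?P - f ` {..<n}) = (n choose 2) - n"
    using card_Diff_subset[OF _ sub] card card_pairs(2)[of n] by simp
  then obtain h where h: "bij_betw h (?P - f ` {..<n}) {n..<n choose 2}"
    using finite_same_card_bij[of "?P - f ` {..<n}" "{n..<n choose 2}"] card_pairs(1)[of n] by auto
  define idx where "idx q = (if q \<in> f ` {..<n} then g q else h q)" for q
  have "bij_betw idx (f ` {..<n}) {..<n}"
    by (rule bij_betw_cong[THEN iffD1, OF _ bg]) (simp add: idx_def)
  moreover have "bij_betw idx (?P - f ` {..<n}) {n..<n choose 2}"
    by (rule bij_betw_cong[THEN iffD1, OF _ h]) (simp add: idx_def)
  ultimately have "bij_betw idx (f ` {..<n} \<union> (?P - f ` {..<n})) ({..<n} \<union> {n..<n choose 2})"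
    by (rule bij_betw_combine) auto
  moreover have "f ` {..<n} \<union> (?P - f ` {..<n}) = ?P" using sub by (simp add: Un_absorb1)
  moreover have "{..<n} \<union> {n..<n choose 2} = {..<n choose 2}" using nN by auto
  ultimately have bij: "bij_betw idx ?P {..<n choose 2}" by (simp only:)
  have idxf: "idx (f k) = k" if "k < n" for k using that by (simp add: idx_def gf)
  have f: "f 0 = (1, 3)" "f 1 = (1, 2)" "\<And>i. 1 \<le> i \<Longrightarrow> f (i + 1) = (0, i)" by (auto simp: f_def)
  have "idx (1, 3) = 0" using idxf[of 0] n unfolding f by simp
  moreover have "idx (1, 2) = 1" using idxf[of 1] n unfolding f by simp
  moreover have "idx (0, i) = i + 1" if "1 \<le> i" "i + 1 < n" for i
    using idxf[OF that(2)] unfolding f(3)[OF that(1)] .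
  ultimately show ?thesis using nN bij by blast
qed

theorem theorem1p1:
  fixes p n :: nat
  assumes "prime p" and "odd p" and "n \<ge> 4"
  shows "\<exists>G :: nat monoid.
    group G \<and> finite (carrier G) \<and>
    has_nilpotency_class G 2 \<and>
    order G = p ^ (n + (n choose 2)) \<and>
    (\<exists>E K. internal_semidirect (T_group G) E K \<and>
      elementary_abelian p ((T_group G)\<lparr>carrier := E\<rparr>) \<and>
      card E = p ^ ((n choose 2) * ((n + 1) choose 2)) \<and>
      (T_group G)\<lparr>carrier := K\<rparr> \<cong> matrix_semidirect p n ((n choose 2) - n))"
proof -
  define N where "N = n choose 2"
  obtain idx where nN: "n \<le> N" and idx: "bij_betw idx {(a, b). a < b \<and> b < n} {..<N}"
    "idx (1, 3) = 0" "idx (1, 2) = 1" "\<And>i. 1 \<le> i \<Longrightarrow> i + 1 < n \<Longrightarrow> idx (0, i) = i + 1"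
    using ex_idx[OF assms(3)] unfolding N_def by blast
  have "int p * int p > 0" using assms(1) prime_gt_0_nat by simp
  then obtain f :: "int \<Rightarrow> qz" where f: "\<And>a b. f (a + b) = f a + f b" "\<And>a. f a = 0 \<longleftrightarrow> int p * int p dvd a"
    using ex_int_hom by blast
  \<comment> \<open>Entries from \<open>N\<close> on are set to 0, so that vanishing is decided by
    the first \<open>N\<close> entries.\<close>
  define pnt where "pnt u = (\<lambda>i. if i < N then f (u i) else 0)" for u
  interpret R: rigid_p_lattice p n N pnt idx
  proof
    show "pnt (\<lambda>i. u i + v i) = pnt u + pnt v" for u v by (auto simp: pnt_def f)
    show "pnt u = 0 \<longleftrightarrow> (\<forall>i<N. int p * int p dvd u i)" for u
      by (auto simp: pnt_def fun_eq_iff f(2)[symmetric])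
    show "prime p" "odd p" "0 < n" "n \<le> N" "4 \<le> n" using assms nN by simp_all
    show "bij_betw idx {(a, b). a < b \<and> b < n} {..<N}" by (rule idx(1))
    show "idx (1, 3) = 0" "idx (1, 2) = 1" by (rule idx(2), rule idx(3))
    show "idx (0, i) = i + 1" if "1 \<le> i" "i + 1 < n" for i by (rule idx(4)[OF that])
  qed
  have fin: "finite (carrier R.G)" using R.finite_L by simp
  obtain G' :: "nat monoid" and h where G': "group G'" and h: "h \<in> iso R.G G'"
    using obtain_nat_copy[OF R.group_G fin] by blast
  obtain E K where EK: "internal_semidirect (T_group R.G) E K"
      "elementary_abelian p ((T_group R.G)\<lparr>carrier := E\<rparr>)"
      "card E = p ^ (N * ((n + 1) choose 2))"
      "(T_group R.G)\<lparr>carrier := K\<rparr> \<cong> matrix_semidirect p n (N - n)"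
    using R.structure_G by blast
  note T = group_T_group[OF R.group_G] and T' = group_T_group[OF G']
  obtain t where t: "t \<in> iso (T_group R.G) (T_group G')"
    using T_group_iso[OF R.group_G G' h] by (auto simp: is_iso_def)
  have sd: "internal_semidirect (T_group G') (t ` E) (t ` K)"
    by (rule iso_internal_semidirect[OF T T' t EK(1)])
  have sub: "subgroup E (T_group R.G)" "subgroup K (T_group R.G)"
    using EK(1) by (auto simp: internal_semidirect_def normal_imp_subgroup)
  have sub': "subgroup (t ` E) (T_group G')"
    using sd by (auto simp: internal_semidirect_def normal_imp_subgroup)
  have tr: "t \<in> iso ((T_group R.G)\<lparr>carrier := A\<rparr>) ((T_group G')\<lparr>carrier := t ` A\<rparr>)"
    if "subgroup A (T_group R.G)" for A
    by (rule iso_carrier_update[OF t subgroup.subset[OF that]])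
  have "elementary_abelian p ((T_group G')\<lparr>carrier := t ` E\<rparr>)"
    by (rule iso_elementary_abelian[OF subgroup.subgroup_is_group[OF sub(1) T]
          subgroup.subgroup_is_group[OF sub' T'] tr[OF sub(1)] EK(2)])
  moreover have "card (t ` E) = p ^ (N * ((n + 1) choose 2))"
    using t subgroup.subset[OF sub(1)] EK(3)
    by (subst card_image) (auto simp: iso_def bij_betw_def intro: inj_on_subset)
  moreover have "(T_group G')\<lparr>carrier := t ` K\<rparr> \<cong> matrix_semidirect p n (N - n)"
    using group.iso_sym[OF subgroup.subgroup_is_group[OF sub(2) T] is_isoI[OF tr[OF sub(2)]]] EK(4) iso_trans
    by blast
  moreover have "finite (carrier G')" "order G' = p ^ (n + N)"
    using h fin iso_finite[OF is_isoI[OF h]] iso_same_card[OF is_isoI[OF h]] R.card_L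
    by (simp_all add: order_def)
  moreover have "has_nilpotency_class G' 2"
    using iso_has_nilpotency_class[OF R.group_G G' h] R.nilpotency_class_G by blast
  ultimately show ?thesis using sd G' unfolding N_def by blast
qed

end
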